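(* Let $n\ge 1$, let $\tau>0$, let $A\in\mathbb{R}^{n\times n}$ be a matrix all of whose eigenvalues have negative real part, and let $Q\in\mathbb{R}^{n\times n}$ be positive definite. Let $(x(t),\eta(t))$ be the stationary $\mathbb{R}^n\times\mathbb{R}^n$-valued process solving $$\frac{d}{dt}x = Ax+\sqrt{2Q}\,\eta,\qquad \frac{d}{dt}\eta=-\frac1\tau\,\eta+\frac1\tau\,\xi,$$ where $\xi$ is $n$-dimensional normalized Gaussian white noise. Let $K(s)=\langle x(t+s)x(t)^T\rangle$ be the correlation function of $x$, and put $C=K(0)=\langle x(t)x(t)^T\rangle$ and $B=(I-\tau A)^{-1}$. Then the following hold. (i) (Generalized fluctuation-dissipation relation) $$0=AC+CA^T+QB^T+BQ. \tag{a}$$ (ii) The first, second and third derivatives of the correlation function $K$ at $s=0$ satisfy $$K'(0)=\tfrac12\big(AC-CA^T+QB^T-BQ\big),$$ $$K''(0)=\tfrac12\Big(A\big(K'(0)+\tfrac1\tau C\big)+\big(K'(0)^T+\tfrac1\tau C\big)A^T\Big), \tag{b}$$ $$K'''(0)=\tfrac12\Big(\tfrac1{\tau^2}K'(0)+A\big(K''(0)-\tfrac1{\tau^2}C\big)-\tfrac1{\tau^2}K'(0)^T-\big(K''(0)-\tfrac1{\tau^2}C\big)A^T\Big). \tag{c}$$ (iii) $K'(0)$ and $K'''(0)$ are skew-symmetric, and $K''(0)$ is negative definite. (iv) Therefore, for given $\tau$, the system of equations (a), (b), (c) characterizes $A$ and $Q$: with $\tau$ and the matrices $C=K(0)$, $K'(0)$,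 $K''(0)$, $K'''(0)$ regarded as given data, $(A,Q)$ is the only pair of real $n\times n$ matrices, with all eigenvalues of the first having negative real part and the second positive definite, that satisfies (a), (b) and (c) (with $B$ the matrix $(I-\tau A)^{-1}$ formed from the first matrix of the pair). (v) In particular, if $A$ is negative definite, then equations (a) and (b) are sufficient: with $\tau$, $C$, $K'(0)$, $K''(0)$ regarded as given data, $(A,Q)$ is the only pair consisting of a negative definite matrix and a positive definite matrix that satisfies (a) and (b).
   Context: All matrices are real, $I$ is the $n\times n$ identity, vectors are column vectors, and $\langle\cdot\rangle$ denotes expectation. A positive (resp. negative) definite matrix is by convention symmetric with all eigenvalues strictly positive (resp. strictly negative). $\sqrt{2Q}$ denotes the symmetric positive definite square root of $2Q$. The normalized Gaussian white noise $\xi$ has zero mean and $\langle\xi(t+s)\xi(t)^T\rangle=\delta(s)I$ with $\delta$ the Dirac delta; that is, the equation for $\eta$ means the Itô equation $d\eta=-\frac1\tau\eta\,dt+\frac1\tau\,dW$ with $W$ a standard $n$-dimensional Brownian motion. The process $\eta$ is called (Ornstein-Uhlenbeck) colored noise and $\tau$ the noise correlation time. The joint process $(x,\eta)$ is assumed stationary, so $K(s)$ does not depend on $t$. The matrix $I-\tau A$ is invertible since $A$ has no non-negative real eigenvalue. $K'(0)$, $K''(0)$ and $K'''(0)$ denote the first, second and third derivatives of $K$ with respect to $s$ at $s=0$.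
   Formalization: The third derivative of K at s=0 does not exist: the left and right derivatives of K'' at 0 differ by 2Q/τ², which is nonzero. K'''(0) is therefore taken to be the mean of these two one-sided derivatives, both of which are shown to exist. *)

theory Defs
  imports "HOL-Probability.Probability"
begin

definition eigenvalue :: "('a::field)^'n^'n \<Rightarrow> 'a \<Rightarrow> bool" where
  "eigenvalue P l \<longleftrightarrow> (\<exists>v. v \<noteq> 0 \<and> P *v v = l *s v)"

definition hurwitz :: "real^'n^'n \<Rightarrow> bool" where
  "hurwitz P \<longleftrightarrow> (\<forall>l. eigenvalue (map_matrix complex_of_real P) l \<longrightarrow> Re l < 0)"

text \<open>For symmetric real matrices all complex eigenvalues are real, so only real ones need
  to be considered here.\<close>

definition pos_def :: "real^'n^'n \<Rightarrow> bool" where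
  "pos_def P \<longleftrightarrow> transpose P = P \<and> (\<forall>l. eigenvalue P l \<longrightarrow> l > 0)"

definition neg_def :: "real^'n^'n \<Rightarrow> bool" where
  "neg_def P \<longleftrightarrow> transpose P = P \<and> (\<forall>l. eigenvalue P l \<longrightarrow> l < 0)"

definition matrix_sqrt :: "real^'n^'n \<Rightarrow> real^'n^'n" where
  "matrix_sqrt P = (THE R. pos_def R \<and> R ** R = P)"

text \<open>Brownian motion is two-sided, since stationary processes are indexed by all real times.
  Each increment over \<open>[s,t]\<close> is \<open>N(0, (t-s) I)\<close>, expressed through independent components;
  \<^const>\<open>normal_density\<close> takes the standard deviation as its second argument.\<close>

definition brownian_motion :: "'w measure \<Rightarrow> (real \<Rightarrow> 'w \<Rightarrow> real^'n) \<Rightarrow> bool" where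
  "brownian_motion M W \<longleftrightarrow>
     prob_space M \<and>
     (\<forall>t. W t \<in> borel_measurable M) \<and>
     (AE \<omega> in M. W 0 \<omega> = 0) \<and>
     (AE \<omega> in M. continuous_on UNIV (\<lambda>t. W t \<omega>)) \<and>
     (\<forall>(t :: nat \<Rightarrow> real) m. mono t \<longrightarrow>
        prob_space.indep_vars M (\<lambda>_. borel) (\<lambda>k \<omega>. W (t (Suc k)) \<omega> - W (t k) \<omega>) {..<m}) \<and>
     (\<forall>s t. s < t \<longrightarrow>
        prob_space.indep_vars M (\<lambda>_. borel) (\<lambda>i \<omega>. (W t \<omega> - W s \<omega>) $ i) UNIV \<and>
        (\<forall>i. distributed M lborel (\<lambda>\<omega>. (W t \<omega> - W s \<omega>) $ i) (normal_density 0 (sqrt (t - s)))))"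

text \<open>Strict stationarity: the law of the process on the product \<open>\<sigma>\<close>-algebra, equivalently each
  finite-dimensional distribution, is invariant under time shifts.\<close>

definition stationary_process :: "'w measure \<Rightarrow> (real \<Rightarrow> 'w \<Rightarrow> 'a::topological_space) \<Rightarrow> bool" where
  "stationary_process M z \<longleftrightarrow>
     (\<forall>t. z t \<in> borel_measurable M) \<and>
     (\<forall>h. distr M (\<Pi>\<^sub>M t\<in>UNIV. borel) (\<lambda>\<omega> t. z (t + h) \<omega>) =
          distr M (\<Pi>\<^sub>M t\<in>UNIV. borel) (\<lambda>\<omega> t. z t \<omega>))"

text \<open>As the noise is additive, the Ito equation for \<open>\<eta>\<close> in integrated form involves no
  stochastic integral and is read pathwise. No adaptedness has to be imposed: stationarity over
  all real times forces \<open>\<eta>\<close> and \<open>x\<close> to depend on the past of \<open>W\<close> only. Likewise, finiteness of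
  the second moments is a consequence. The integral equation makes the paths of \<open>\<eta>\<close>
  continuous, so the equation for \<open>x\<close> is an ordinary differential equation for each path.\<close>

definition colored_noise_solution ::
  "'w measure \<Rightarrow> real \<Rightarrow> real^'n^'n \<Rightarrow> real^'n^'n \<Rightarrow> (real \<Rightarrow> 'w \<Rightarrow> real^'n) \<Rightarrow>
    (real \<Rightarrow> 'w \<Rightarrow> real^'n) \<Rightarrow> (real \<Rightarrow> 'w \<Rightarrow> real^'n) \<Rightarrow> bool" where
  "colored_noise_solution M \<tau> A Q W x \<eta> \<longleftrightarrow>
     (AE \<omega> in M. \<forall>t. ((\<lambda>t. x t \<omega>) has_vector_derivative
        (A *v x t \<omega> + matrix_sqrt (2 *\<^sub>R Q) *v \<eta> t \<omega>)) (at t)) \<and>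
     (AE \<omega> in M. \<forall>s t. s \<le> t \<longrightarrow> ((\<lambda>u. - (1 / \<tau>) *\<^sub>R \<eta> u \<omega>) has_integral
        (\<eta> t \<omega> - \<eta> s \<omega> - (1 / \<tau>) *\<^sub>R (W t \<omega> - W s \<omega>))) {s..t})"

definition correlation ::
  "'w measure \<Rightarrow> (real \<Rightarrow> 'w \<Rightarrow> real^'n) \<Rightarrow> real \<Rightarrow> real \<Rightarrow> real^'n^'n" where
  "correlation M x t s = (\<chi> i j. \<integral>\<omega>. x (t + s) \<omega> $ i * x t \<omega> $ j \<partial>M)"

text \<open>The second derivative of the correlation function has a kink at \<open>0\<close>: the left and right
  third derivatives there differ by \<open>(2 / \<tau>\<^sup>2) Q \<noteq> 0\<close>, so the two-sided third derivative does not
  exist. Its value at \<open>0\<close> is taken to be the mean of the left and right derivatives (which is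
  the ordinary derivative whenever that exists).\<close>

definition mean_derivative :: "(real \<Rightarrow> 'a::real_normed_vector) \<Rightarrow> real \<Rightarrow> 'a" where
  "mean_derivative f s =
     (1 / 2) *\<^sub>R (vector_derivative f (at_left s) + vector_derivative f (at_right s))"

definition resolvent_matrix :: "real \<Rightarrow> real^'n^'n \<Rightarrow> real^'n^'n" where
  "resolvent_matrix \<tau> A = matrix_inv (mat 1 - \<tau> *\<^sub>R A)"

definition eq_a :: "real \<Rightarrow> real^'n^'n \<Rightarrow> real^'n^'n \<Rightarrow> real^'n^'n \<Rightarrow> bool" where
  "eq_a \<tau> C A Q \<longleftrightarrow> (let B = resolvent_matrix \<tau> A in
     0 = A ** C + C ** transpose A + Q ** transpose B + B ** Q)"

definition eq_b :: "real \<Rightarrow> real^'n^'n \<Rightarrow> real^'n^'n \<Rightarrow> real^'n^'n \<Rightarrow> real^'n^'n \<Rightarrow> bool" where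
  "eq_b \<tau> C K1 K2 A \<longleftrightarrow>
     K2 = (1 / 2) *\<^sub>R (A ** (K1 + (1 / \<tau>) *\<^sub>R C) + (transpose K1 + (1 / \<tau>) *\<^sub>R C) ** transpose A)"

definition eq_c ::
  "real \<Rightarrow> real^'n^'n \<Rightarrow> real^'n^'n \<Rightarrow> real^'n^'n \<Rightarrow> real^'n^'n \<Rightarrow> real^'n^'n \<Rightarrow> bool" where
  "eq_c \<tau> C K1 K2 K3 A \<longleftrightarrow>
     K3 = (1 / 2) *\<^sub>R ((1 / \<tau>\<^sup>2) *\<^sub>R K1 + A ** (K2 - (1 / \<tau>\<^sup>2) *\<^sub>R C)
            - (1 / \<tau>\<^sup>2) *\<^sub>R transpose K1 - (K2 - (1 / \<tau>\<^sup>2) *\<^sub>R C) ** transpose A)"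

end

theory Submission
  imports Defs "HOL-Computational_Algebra.Fundamental_Theorem_Algebra"
begin

text \<open>
  Only second moments matter. The energy estimate
  \<open>\<bar>y(0)\<bar>\<^sup>2 \<le> e\<^bsup>\<mu> s\<^esup> \<bar>y(s)\<bar>\<^sup>2 + \<mu>\<^bsup>-1\<^esup> \<integral> e\<^bsup>\<mu> u\<^esup> \<bar>g(u)\<bar>\<^sup>2 du\<close> (over \<open>s \<le> u \<le> 0\<close>) for
  \<open>y' = - \<mu> y + g\<close>, together with stationarity as \<open>s\<close> tends to \<open>-\<infinity>\<close>, shows that \<open>\<eta>\<close> and then \<open>x\<close> are square
  integrable. The covariance of an increment of \<open>W\<close> with the past solves a stable linear equation
  on a half-line unbounded to the left and is bounded, hence zero. All covariances then follow
  from linear equations: with \<open>R\<^sup>2 = 2 Q\<close>, \<open>\<langle>\<eta> \<eta>\<^sup>T\<rangle> = I / (2 \<tau>)\<close>, \<open>R \<langle>\<eta> x\<^sup>T\<rangle> = Q B\<^sup>T\<close> and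
  \<open>K'(s) = A K(s) + e\<^bsup>-s/\<tau>\<^esup> Q B\<^sup>T\<close> for \<open>s \<ge> 0\<close>, while \<open>K(-s) = K(s)\<^sup>T\<close>.

  For uniqueness, the difference \<open>E\<close> of two drift matrices is self-adjoint for the inner product
  defined by \<open>(C / \<tau>\<^sup>2 - K''(0))\<^bsup>-1\<^esup>\<close> by (c), and (b) makes a weighted trace norm of \<open>E\<close> vanish.
  Then (a) is a Lyapunov equation for \<open>Q\<close>.
\<close>


section \<open>Positive definite matrices and their square roots\<close>

text \<open>Three obstacles shape the work. Neither integrability nor adaptedness is given, so
  nothing may be averaged before second moments are finite; that step is done with extended
  nonnegative integrals. No matrix exponential is used: induction along the eigenvalues of
  \<open>A\<close> reduces vector equations to scalar ones for row functionals, the forcing of each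
  being controlled by the preceding functional. And the second derivative of \<open>K\<close> has a
  kink at \<open>0\<close>, so right-hand formulas are carried to negative times by reflection; they
  match up to second order because \<open>K''(0)\<close> is symmetric. Definiteness rests on an
  identity that the formulas hide: \<open>- K''(0)\<close> is the covariance of the velocity
  \<open>A x + R \<eta>\<close>. In a degenerate direction the skewness of \<open>K'(0)\<close>
  would force the noise component to vanish. Positivity of \<open>C\<close> is then deduced from
  that of \<open>- K''(0)\<close>, not conversely. The variance \<open>1 / (2 \<tau>)\<close> is
  found without Ito's formula: the equation for \<open>\<eta>\<close> is integrated against
  \<open>\<eta>(1)\<close> over the unit interval.\<close>

lemma matrix_diff_ldistrib: "A ** (B - C) = A ** B - A ** (C :: 'a::ring_1^'n^'m)"
  by (simp add: matrix_matrix_mult_def vec_eq_iff right_diff_distrib sum_subtractf)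

lemma matrix_diff_rdistrib: "(A - B) ** C = A ** C - B ** (C :: 'a::ring_1^'n^'m)"
  by (simp add: matrix_matrix_mult_def vec_eq_iff left_diff_distrib sum_subtractf)

lemma inner_transpose_mult:
  fixes P :: "real^'n^'m"
  shows "(transpose P *v v) \<bullet> w = v \<bullet> (P *v w)"
  by (simp add: dot_lmul_matrix)

text \<open>A maximiser of the quadratic form on the unit sphere of \<open>S\<close> is an
  eigenvector: moving from it along the residual \<open>P *v v - l *\<^sub>R v\<close> would
  otherwise raise the Rayleigh quotient to first order. The invariant subspace serves the induction
  that builds an eigenbasis.\<close>

lemma symmetric_rayleigh_max:
  fixes P :: "real^'n^'n"
  assumes sym: "transpose P = P" and S: "subspace S" "\<exists>w\<in>S. w \<noteq> 0"
    and inv: "\<And>w. w \<in> S \<Longrightarrow> P *v w \<in> S"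
  obtains v l where "v \<in> S" "norm v = 1" "P *v v = l *\<^sub>R v"
    "\<And>w. w \<in> S \<Longrightarrow> w \<bullet> (P *v w) \<le> l * (w \<bullet> w)"
proof -
  have comm: "(P *v u) \<bullet> w = u \<bullet> (P *v w)" for u w
    using inner_transpose_mult[of P u w] sym by simp
  have cl: "closed S" using S(1) by (rule closed_subspace)
  then have "compact (sphere 0 1 \<inter> S)"
    by (intro compact_Int_closed compact_sphere)
  moreover obtain w0 where w0: "w0 \<in> S" "w0 \<noteq> 0" using S(2) by blast
  have "(1 / norm w0) *\<^sub>R w0 \<in> sphere 0 1 \<inter> S"
    using w0 S(1) by (simp add: subspace_scale)
  then have "sphere 0 1 \<inter> S \<noteq> {}" by blast
  moreover have "continuous_on (sphere 0 1 \<inter> S) (\<lambda>w. w \<bullet> (P *v w))"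
    by (intro continuous_intros linear_continuous_on matrix_vector_mul_bounded_linear)
  ultimately obtain v where v: "v \<in> sphere 0 1 \<inter> S"
    and max: "\<And>w. w \<in> sphere 0 1 \<inter> S \<Longrightarrow> w \<bullet> (P *v w) \<le> v \<bullet> (P *v v)"
    using continuous_attains_sup[of "sphere 0 1 \<inter> S" "\<lambda>w. w \<bullet> (P *v w)"] by blast
  define l where "l = v \<bullet> (P *v v)"
  have nv: "norm v = 1" and vS: "v \<in> S" using v by auto
  then have vv: "v \<bullet> v = 1" by (simp add: norm_eq_1)
  have le: "w \<bullet> (P *v w) \<le> l * (w \<bullet> w)" if "w \<in> S" for w
  proof (cases "w = 0")
    case False
    have "(1 / norm w) *\<^sub>R w \<in> sphere 0 1 \<inter> S"
      using that False S(1) by (simp add: subspace_scale)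
    from max[OF this] have "(w \<bullet> (P *v w)) / (norm w)\<^sup>2 \<le> l"
      by (simp add: l_def matrix_vector_mult_scaleR power2_eq_square)
    then show ?thesis using False
      by (simp add: field_simps power2_norm_eq_inner)
  qed auto
  \<comment> \<open>The residual of the eigenvalue equation; it lies in \<open>S\<close> by
    invariance and is therefore an admissible direction of variation.\<close>
  define u where "u = P *v v - l *\<^sub>R v"
  have uS: "u \<in> S" unfolding u_def using S(1) inv vS by (simp add: subspace_diff subspace_scale)
  define q where "q = l * (u \<bullet> u) - u \<bullet> (P *v u)"
  have q0: "q \<ge> 0" using le[OF uS] by (simp add: q_def)
  have quad: "2 * s * (u \<bullet> u) \<le> s\<^sup>2 * q" for s
  proof -
    have "v + s *\<^sub>R u \<in> S" using S(1) vS uS by (simp add: subspace_add subspace_scale)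
    from le[OF this] have "v \<bullet> (P *v v) + 2 * s * (u \<bullet> (P *v v)) + s\<^sup>2 * (u \<bullet> (P *v u))
      \<le> l * (v \<bullet> v + 2 * s * (u \<bullet> v) + s\<^sup>2 * (u \<bullet> u))"
      using comm[of v u]
      by (simp add: matrix_vector_right_distrib matrix_vector_mult_scaleR inner_add
          inner_commute power2_eq_square algebra_simps)
    moreover have "u \<bullet> (P *v v) = u \<bullet> u + l * (u \<bullet> v)"
      by (subst (3) u_def) (simp add: inner_diff)
    ultimately have "l + 2 * s * (u \<bullet> u + l * (u \<bullet> v)) + s\<^sup>2 * (u \<bullet> (P *v u))
      \<le> l * (1 + 2 * s * (u \<bullet> v) + s\<^sup>2 * (u \<bullet> u))"
      by (simp only: l_def[symmetric] vv)
    then show ?thesis by (simp add: q_def algebra_simps)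
  qed
  have "u \<bullet> u = 0"
  proof (rule ccontr)
    assume "u \<bullet> u \<noteq> 0"
    then have pos: "u \<bullet> u > 0" by simp
    \<comment> \<open>The summand \<open>1\<close> guards against \<open>q = 0\<close>. This choice
      makes \<open>s * q\<close> at most \<open>u \<bullet> u\<close>, while the variation demands
      at least twice that.\<close>
    define s where "s = (u \<bullet> u) / (q + 1)"
    have "s > 0" using pos q0 by (simp add: s_def)
    then have "2 * (u \<bullet> u) \<le> s * q" using quad[of s] by (simp add: power2_eq_square)
    also have "s * q \<le> s * (q + 1)" using \<open>s > 0\<close> by simp
    also have "\<dots> = u \<bullet> u" using q0 by (simp add: s_def)
    finally show False using pos by simp
  qed
  then have "P *v v = l *\<^sub>R v" by (simp add: u_def)
  with nv vS le show ?thesis by (intro that)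
qed

lemma scalar_mult_eq_scaleR_vec: "c *s v = c *\<^sub>R (v :: real^'n)"
  by (simp add: vec_eq_iff)

lemma uminus_matrix_vector_mult: "(- P) *v v = - (P *v (v :: real^'n))"
  by (simp add: vec_eq_iff matrix_vector_mult_def sum_negf)

text \<open>Definiteness is defined by eigenvalues, but the later arguments use the quadratic form.
  The maximal Rayleigh quotient of \<open>- P\<close> is attained at an eigenvector, so it is the
  negative of an eigenvalue of \<open>P\<close>, hence negative.\<close>

lemma pos_def_quadratic_form_pos:
  fixes P :: "real^'n^'n"
  assumes "pos_def P" "w \<noteq> 0"
  shows "w \<bullet> (P *v w) > 0"
proof -
  have "transpose (- P) = - P" using assms(1) by (simp add: pos_def_def transpose_def vec_eq_iff)
  then obtain v l where v: "norm v = 1" "(- P) *v v = l *\<^sub>R v"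
    and le: "\<And>w. w \<bullet> ((- P) *v w) \<le> l * (w \<bullet> w)"
    by (rule symmetric_rayleigh_max[of "- P" UNIV]) (use assms(2) in auto)
  have "v \<noteq> 0" using v(1) by auto
  moreover have "P *v v = (- l) *s v"
    using v(2) by (simp add: uminus_matrix_vector_mult scalar_mult_eq_scaleR_vec neg_eq_iff_add_eq_0 add_eq_0_iff)
  ultimately have "- l > 0" using assms(1) unfolding pos_def_def eigenvalue_def by blast
  then have "l * (w \<bullet> w) < 0" using assms(2) by (simp add: mult_neg_pos)
  then show ?thesis using le[of w] by (simp add: uminus_matrix_vector_mult)
qed

lemma pos_defI:
  fixes P :: "real^'n^'n"
  assumes "transpose P = P" "\<And>w. w \<noteq> 0 \<Longrightarrow> w \<bullet> (P *v w) > 0"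
  shows "pos_def P"
  unfolding pos_def_def eigenvalue_def
proof (intro conjI allI impI assms(1))
  fix l assume "\<exists>v. v \<noteq> 0 \<and> P *v v = l *s v"
  then obtain v where v: "v \<noteq> 0" "P *v v = l *s v" by blast
  from assms(2)[OF v(1)] have "0 < l * (v \<bullet> v)" by (simp add: v(2) scalar_mult_eq_scaleR_vec)
  then show "l > 0" using v(1) by (simp add: zero_less_mult_iff) (metis inner_ge_zero not_le)
qed

lemma neg_def_iff_pos_def_uminus:
  fixes P :: "real^'n^'n"
  shows "neg_def P \<longleftrightarrow> pos_def (- P)"
proof -
  have "eigenvalue (- P) l \<longleftrightarrow> eigenvalue P (- l)" for l
    unfolding eigenvalue_def
    by (metis minus_minus scaleR_minus_left scalar_mult_eq_scaleR_vec uminus_matrix_vector_mult)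
  moreover have "transpose (- P) = - P \<longleftrightarrow> transpose P = P"
    by (simp add: transpose_def vec_eq_iff)
  ultimately show ?thesis
    unfolding neg_def_def pos_def_def by (metis minus_minus neg_0_less_iff_less)
qed

text \<open>Induction on the dimension of an invariant subspace: a Rayleigh maximiser is split off,
  and symmetry makes its orthogonal complement within the subspace invariant again.\<close>

lemma symmetric_orthonormal_eigenbasis:
  fixes P :: "real^'n^'n"
  assumes sym: "transpose P = P"
  obtains B :: "(real^'n) set" where "pairwise orthogonal B" "\<And>b. b \<in> B \<Longrightarrow> norm b = 1" "span B = UNIV"
    "\<And>b. b \<in> B \<Longrightarrow> \<exists>l. P *v b = l *\<^sub>R b"
proof -
  have comm: "(P *v u) \<bullet> w = u \<bullet> (P *v w)" for u w
    using inner_transpose_mult[of P u w] sym by simp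
  have "\<exists>B. pairwise orthogonal B \<and> (\<forall>b\<in>B. norm b = 1) \<and> span B = S \<and>
      (\<forall>b\<in>B. \<exists>l. P *v b = l *\<^sub>R b)"
    if "subspace S" "\<And>w. w \<in> S \<Longrightarrow> P *v w \<in> S" for S
    using that
  proof (induction "dim S" arbitrary: S rule: less_induct)
    case less
    show ?case
    proof (cases "\<exists>w\<in>S. w \<noteq> 0")
      case False
      then have "S = {0}" using subspace_0[OF less.prems(1)] by auto
      then show ?thesis by (intro exI[of _ "{}"]) auto
    next
      case True
      then obtain v l where v: "v \<in> S" "norm v = 1" "P *v v = l *\<^sub>R v"
        by (rule symmetric_rayleigh_max[OF sym less.prems(1) _ less.prems(2)])
      define T where "T = {w \<in> S. v \<bullet> w = 0}"
      have vv: "v \<bullet> v = 1" using v(2) by (simp add: norm_eq_1)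
      have T: "subspace T" using less.prems(1)
        by (auto simp: T_def subspace_def inner_add)
      have "P *v w \<in> T" if "w \<in> T" for w
        using that less.prems(2) comm[of v w] v(3) by (simp add: T_def)
      moreover have "T \<subseteq> S" "v \<notin> T" using vv by (auto simp: T_def)
      then have "T \<subset> S" using v(1) by blast
      then have "dim T < dim S" using T less.prems(1) by (simp add: dim_psubset span_eq_iff[THEN iffD2])
      ultimately obtain B where B: "pairwise orthogonal B" "\<forall>b\<in>B. norm b = 1" "span B = T"
        "\<forall>b\<in>B. \<exists>l. P *v b = l *\<^sub>R b"
        using less.hyps T by meson
      have BT: "B \<subseteq> T" using B(3) span_superset by blast
      have "span (insert v B) = S"
      proof
        show "span (insert v B) \<subseteq> S"
          using v(1) BT less.prems(1) by (intro span_minimal) (auto simp: T_def)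
        show "S \<subseteq> span (insert v B)"
        proof
          fix w assume "w \<in> S"
          then have "w - (v \<bullet> w) *\<^sub>R v \<in> T"
            using less.prems(1) v(1) vv by (simp add: T_def subspace_diff subspace_scale inner_diff)
          then show "w \<in> span (insert v B)"
            unfolding span_insert using B(3) by blast
        qed
      qed
      moreover have "pairwise orthogonal (insert v B)"
        using B(1) BT by (auto simp: pairwise_insert T_def orthogonal_def inner_commute)
      ultimately show ?thesis using B v by (intro exI[of _ "insert v B"]) auto
    qed
  qed
  from this[of UNIV] show ?thesis by (auto intro: that)
qed

text \<open>Used to read a vanishing trace column by column: for positive semidefinite
  \<open>G\<close> all these diagonal values are nonnegative, so each of them vanishes.\<close>

lemma trace_conjugation_diag:
  fixes S G :: "real^'n^'n"
  assumes "transpose S = S"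
  shows "(S ** G ** S) $ i $ i = (S *v axis i 1) \<bullet> (G *v (S *v axis i 1))"
proof -
  have "(S ** G ** S) $ i $ i = axis i 1 \<bullet> ((S ** G ** S) *v axis i 1)"
    by (simp add: inner_axis' matrix_vector_mult_basis column_def)
  also have "\<dots> = axis i 1 \<bullet> (S *v (G *v (S *v axis i 1)))"
    by (simp only: matrix_vector_mul_assoc matrix_mul_assoc)
  also have "\<dots> = (S *v axis i 1) \<bullet> (G *v (S *v axis i 1))"
    using inner_transpose_mult[of S "axis i 1"] assms by simp
  finally show ?thesis .
qed

text \<open>If \<open>R\<^sup>2 = S\<^sup>2\<close> then \<open>D = R - S\<close> satisfies \<open>D R + S D = 0\<close>, so the traces of the positive
  semidefinite matrices \<open>D R D\<close> and \<open>D S D\<close> add up to zero.\<close>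

lemma pos_def_sqrt_unique:
  fixes R S :: "real^'n^'n"
  assumes R: "pos_def R" and S: "pos_def S" and eq: "R ** R = S ** S"
  shows "R = S"
proof -
  define D where "D = R - S"
  have Dt: "transpose D = D"
    using R S by (simp add: D_def pos_def_def transpose_def vec_eq_iff)
  have 0: "D ** R + S ** D = 0"
    using eq by (simp add: D_def matrix_diff_ldistrib matrix_diff_rdistrib)
  have "trace (D ** S ** D) = trace (D ** (S ** D))"
    by (simp add: matrix_mul_assoc)
  moreover have "trace (D ** R ** D) = trace (D ** (D ** R))"
    by (rule trace_mul_sym)
  ultimately have "trace (D ** R ** D) + trace (D ** S ** D) = trace (D ** (D ** R + S ** D))"
    by (simp add: matrix_add_ldistrib trace_add)
  then have tr: "trace (D ** R ** D) + trace (D ** S ** D) = 0"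
    by (simp add: 0 trace_def)
  have nn: "(w \<bullet> (R *v w)) \<ge> 0" "(w \<bullet> (S *v w)) \<ge> 0" for w
    using pos_def_quadratic_form_pos[OF R, of w] pos_def_quadratic_form_pos[OF S, of w]
    by (cases "w = 0"; simp)+
  have "D *v axis i 1 = 0" for i
  proof -
    have "(\<Sum>i\<in>UNIV. (D ** R ** D) $ i $ i + (D ** S ** D) $ i $ i) = 0"
      using tr by (simp add: trace_def sum.distrib)
    then have "(D ** R ** D) $ i $ i + (D ** S ** D) $ i $ i = 0"
      by (subst (asm) sum_nonneg_eq_0_iff)
        (auto simp: trace_conjugation_diag[OF Dt] nn add_nonneg_nonneg)
    then have "(D *v axis i 1) \<bullet> (R *v (D *v axis i 1)) = 0"
      using nn[of "D *v axis i 1"] by (simp add: trace_conjugation_diag[OF Dt])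
    then show ?thesis using pos_def_quadratic_form_pos[OF R, of "D *v axis i 1"] by force
  qed
  then have "D = 0"
    by (simp add: matrix_vector_mult_basis column_def vec_eq_iff)
  then show ?thesis by (simp add: D_def)
qed

text \<open>Spectral calculus: \<open>f\<close> multiplies each eigenvector \<open>b\<close> by
  \<open>sqrt (l b)\<close>. Symmetry and positivity are visible in the expansion along the
  orthonormal basis.\<close>

lemma pos_def_sqrt_exists:
  fixes P :: "real^'n^'n"
  assumes P: "pos_def P"
  obtains R where "pos_def R" "R ** R = P"
proof -
  obtain B :: "(real^'n) set" where orth: "pairwise orthogonal B" and nB: "\<And>b. b \<in> B \<Longrightarrow> norm b = 1"
    and spB: "span B = UNIV" and "\<And>b. b \<in> B \<Longrightarrow> \<exists>l. P *v b = l *\<^sub>R b"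
    using symmetric_orthonormal_eigenbasis P unfolding pos_def_def by metis
  then obtain l where l: "\<And>b. b \<in> B \<Longrightarrow> P *v b = l b *\<^sub>R b" by metis
  have bb: "b \<bullet> b' = (if b = b' then 1 else 0)" if "b \<in> B" "b' \<in> B" for b b'
    using that orth nB by (auto simp: pairwise_def orthogonal_def norm_eq_1)
  have fin: "finite B" using orth nB by (intro pairwise_orthogonal_imp_finite)
  have lpos: "l b > 0" if "b \<in> B" for b
  proof -
    have "b \<noteq> 0" using nB[OF that] by auto
    then show ?thesis using P l[OF that] unfolding pos_def_def eigenvalue_def
      by (metis scalar_mult_eq_scaleR_vec)
  qed
  define f where "f v = (\<Sum>b\<in>B. (sqrt (l b) * (b \<bullet> v)) *\<^sub>R b)" for v
  have linf: "linear f"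
    by (rule linearI)
      (simp_all add: f_def inner_add algebra_simps sum.distrib scaleR_sum_right scaleR_add_left)
  define R where "R = matrix f"
  have Rf: "R *v v = f v" for v by (simp add: R_def matrix_works linf)
  have fB: "f b = sqrt (l b) *\<^sub>R b" if "b \<in> B" for b
  proof -
    have "f b = (\<Sum>b'\<in>B. if b' = b then sqrt (l b) *\<^sub>R b else 0)"
      unfolding f_def by (rule sum.cong) (auto simp: bb that)
    then show ?thesis using fin that by simp
  qed
  have "(R ** R) *v v = P *v v" for v
  proof -
    have "f (f b) = P *v b" if "b \<in> B" for b
      using that lpos[OF that] by (simp add: fB linear_scale[OF linf] l)
    then have "f (f v) = P *v v"
      using linear_eq_on_span[of "f \<circ> f" "(*v) P" B v] linf spB
      by (auto simp: linear_compose)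
    then show ?thesis by (simp add: Rf matrix_vector_mul_assoc[symmetric])
  qed
  then have RR: "R ** R = P" using matrix_eq by blast
  have fsym: "f v \<bullet> w = v \<bullet> f w" for v w
    by (simp add: f_def inner_sum_left inner_sum_right inner_commute mult_ac)
  have "transpose R = R"
  proof -
    have "transpose R *v v = R *v v" for v
    proof (rule vector_eq_ldot[THEN iffD1], rule allI)
      fix w show "w \<bullet> (transpose R *v v) = w \<bullet> (R *v v)"
        using inner_transpose_mult[of R v w] fsym[of v w] by (simp add: Rf inner_commute)
    qed
    then show ?thesis using matrix_eq by blast
  qed
  moreover have "w \<bullet> (R *v w) > 0" if "w \<noteq> 0" for w
  proof -
    have "w \<bullet> (R *v w) = (\<Sum>b\<in>B. sqrt (l b) * (b \<bullet> w)\<^sup>2)"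
      by (simp add: Rf f_def inner_sum_right inner_commute power2_eq_square mult_ac)
    moreover have "\<exists>b\<in>B. b \<bullet> w \<noteq> 0"
    proof (rule ccontr)
      assume "\<not> (\<exists>b\<in>B. b \<bullet> w \<noteq> 0)"
      then have "orthogonal w v" if "v \<in> span B" for v
        using that by (intro orthogonal_to_span[of v B w]) (auto simp: orthogonal_def inner_commute)
      then have "orthogonal w w" using spB by blast
      then show False using that by (simp add: orthogonal_def)
    qed
    ultimately show ?thesis using fin lpos
      by (auto intro!: sum_pos2 simp: less_imp_le)
  qed
  ultimately have "pos_def R" by (rule pos_defI)
  then show ?thesis using RR by (rule that)
qed

lemma matrix_sqrt_props:
  fixes P :: "real^'n^'n"
  assumes "pos_def P"
  shows "pos_def (matrix_sqrt P)" "matrix_sqrt P ** matrix_sqrt P = P"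
proof -
  have "\<exists>!R. pos_def R \<and> R ** R = P"
    using pos_def_sqrt_exists[OF assms] pos_def_sqrt_unique by (metis (no_types))
  from theI'[OF this] show "pos_def (matrix_sqrt P)" "matrix_sqrt P ** matrix_sqrt P = P"
    unfolding matrix_sqrt_def by auto
qed

section \<open>Matrix inverses and weighted traces\<close>

lemma trace_transpose: "trace (transpose P) = trace P"
  by (simp add: trace_def transpose_def)

lemma invertible_matrix_inv:
  assumes "invertible (P :: 'a::semiring_1^'n^'m)"
  shows "P ** matrix_inv P = mat 1" "matrix_inv P ** P = mat 1"
proof -
  have "\<exists>P'. P ** P' = mat 1 \<and> P' ** P = mat 1" using assms by (simp add: invertible_def)
  from someI_ex[OF this] show "P ** matrix_inv P = mat 1" "matrix_inv P ** P = mat 1"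
    unfolding matrix_inv_def by auto
qed

lemma invertible_iff_ker: "invertible (P :: 'a::field^'n^'n) \<longleftrightarrow> (\<forall>v. P *v v = 0 \<longrightarrow> v = 0)"
  by (simp add: invertible_left_inverse matrix_left_invertible_ker)

lemma transpose_add: "transpose (P + Q) = transpose P + transpose Q"
  by (simp add: transpose_def vec_eq_iff)

text \<open>The trace is the squared Frobenius norm of \<open>P^(1/2) E C^(1/2)\<close>. Only the
  root \<open>S\<close> of \<open>C\<close> is taken explicitly: cyclicity gives
  \<open>trace (S ** G ** S)\<close>, a sum of values of the form of \<open>P\<close> at the vectors
  \<open>E *v (S *v axis i 1)\<close>. Hence \<open>E ** S = 0\<close>, and \<open>S\<close> is
  invertible.\<close>

lemma trace_weighted_square_zero:
  fixes E P C :: "real^'n^'n"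
  assumes P: "pos_def P" and C: "pos_def C" and tr: "trace (transpose E ** P ** E ** C) = 0"
  shows "E = 0"
proof -
  define S where "S = matrix_sqrt C"
  define G where "G = transpose E ** P ** E"
  have S: "pos_def S" "S ** S = C" using matrix_sqrt_props[OF C] by (simp_all add: S_def)
  then have St: "transpose S = S" by (simp add: pos_def_def)
  have G: "w \<bullet> (G *v w) = (E *v w) \<bullet> (P *v (E *v w))" for w
  proof -
    have "w \<bullet> (G *v w) = w \<bullet> (transpose E *v (P *v (E *v w)))"
      by (simp only: G_def matrix_vector_mul_assoc matrix_mul_assoc)
    then show ?thesis
      using inner_transpose_mult[of E "P *v (E *v w)" w] by (simp add: inner_commute)
  qed
  have nn: "w \<bullet> (P *v w) \<ge> 0" for w
    using pos_def_quadratic_form_pos[OF P, of w] by (cases "w = 0") auto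
  have "trace (S ** G ** S) = trace (S ** (S ** G))" by (rule trace_mul_sym)
  also have "\<dots> = trace (G ** C)"
    by (simp add: matrix_mul_assoc S(2) trace_mul_sym[of C])
  also have "\<dots> = 0" using tr by (simp add: G_def)
  finally have "(\<Sum>i\<in>UNIV. (S ** G ** S) $ i $ i) = 0" by (simp add: trace_def)
  then have "(S ** G ** S) $ i $ i = 0" for i
    by (subst (asm) sum_nonneg_eq_0_iff) (auto simp: trace_conjugation_diag[OF St] G nn)
  then have ES0: "E *v (S *v axis i 1) = 0" for i
    using pos_def_quadratic_form_pos[OF P, of "E *v (S *v axis i 1)"]
    by (fastforce simp: trace_conjugation_diag[OF St] G)
  have "(E ** S) *v axis i 1 = 0" for i
    using ES0 by (simp add: matrix_vector_mul_assoc)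
  then have ES: "E ** S = 0"
    by (simp add: matrix_vector_mult_basis column_def vec_eq_iff)
  have "invertible S"
    unfolding invertible_iff_ker using pos_def_quadratic_form_pos[OF S(1)] by force
  then have "E = E ** S ** matrix_inv S"
    by (simp add: matrix_mul_assoc[symmetric] invertible_matrix_inv)
  then show ?thesis by (simp add: ES)
qed

lemma pos_def_inverse:
  fixes P :: "real^'n^'n"
  assumes P: "pos_def P"
  shows "invertible P" "pos_def (matrix_inv P)"
proof -
  show inv: "invertible P"
    unfolding invertible_iff_ker using pos_def_quadratic_form_pos[OF P] by force
  define V where "V = matrix_inv P"
  have V: "P ** V = mat 1" "V ** P = mat 1"
    using invertible_matrix_inv[OF inv] by (simp_all add: V_def)
  have Pt: "transpose P = P" using P by (simp add: pos_def_def)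
  have "transpose V ** P = mat 1"
    using arg_cong[OF V(1), of transpose] by (simp add: matrix_transpose_mul Pt)
  then have "transpose V = V"
    by (metis V(1) matrix_mul_assoc matrix_mul_lid matrix_mul_rid)
  moreover have "w \<bullet> (V *v w) > 0" if "w \<noteq> 0" for w
  proof -
    have w: "P *v (V *v w) = w" by (simp add: matrix_vector_mul_assoc V)
    then have "V *v w \<noteq> 0" using that by auto
    from pos_def_quadratic_form_pos[OF P this] show ?thesis by (simp add: w inner_commute)
  qed
  ultimately show "pos_def (matrix_inv P)" unfolding V_def by (rule pos_defI)
qed

text \<open>\<open>E\<close> is self-adjoint for the inner product defined by \<open>P\<inverse>\<close>. The trace of \<open>P\<inverse> E\<close> times the
  second equation is a weighted square norm of \<open>E\<close>, because only the symmetric part \<open>C\<close> of \<open>Y\<close>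
  contributes to it.\<close>

lemma self_adjoint_skew_product_zero:
  fixes E P Y C :: "real^'n^'n"
  assumes P: "pos_def P" and C: "pos_def C"
    and sa: "E ** P = P ** transpose E"
    and skew: "E ** Y + transpose Y ** transpose E = 0"
    and Y: "Y + transpose Y = C"
  shows "E = 0"
proof (rule trace_weighted_square_zero[OF pos_def_inverse(2)[OF P] C])
  define V where "V = matrix_inv P"
  have V: "P ** V = mat 1" "V ** P = mat 1"
    using invertible_matrix_inv[OF pos_def_inverse(1)[OF P]] by (simp_all add: V_def)
  have Vt: "transpose V = V"
    using pos_def_inverse(2)[OF P] by (simp add: V_def pos_def_def)
  have EV: "transpose E ** V = V ** E"
  proof -
    have "V ** (E ** P) ** V = V ** (P ** transpose E) ** V" by (simp add: sa)
    then show ?thesis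
      by (metis V matrix_mul_assoc matrix_mul_lid matrix_mul_rid)
  qed
  define G where "G = transpose E ** V ** E"
  have Gt: "transpose G = G"
    by (simp add: G_def matrix_transpose_mul Vt matrix_mul_assoc)
  have "trace (V ** E ** (transpose Y ** transpose E)) = trace (transpose (V ** E ** (transpose Y ** transpose E)))"
    by (simp only: trace_transpose)
  also have "\<dots> = trace ((E ** Y) ** (transpose E ** V))"
    by (simp add: matrix_transpose_mul Vt)
  also have "\<dots> = trace ((transpose E ** V) ** (E ** Y))" by (rule trace_mul_sym)
  finally have "trace (V ** E ** (transpose Y ** transpose E)) = trace (G ** Y)"
    by (simp add: G_def matrix_mul_assoc)
  moreover have "trace (V ** E ** (E ** Y)) = trace (G ** Y)"
    by (simp add: G_def matrix_mul_assoc EV)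
  ultimately have "2 * trace (G ** Y) = trace (V ** E ** (E ** Y + transpose Y ** transpose E))"
    by (simp only: matrix_add_ldistrib trace_add)
  then have "trace (G ** Y) = 0" by (simp add: skew trace_def)
  moreover have "trace (G ** transpose Y) = trace (transpose (G ** transpose Y))"
    by (simp only: trace_transpose)
  then have "trace (G ** transpose Y) = trace (G ** Y)"
    by (simp add: matrix_transpose_mul Gt trace_mul_sym[of Y])
  ultimately show "trace (transpose E ** matrix_inv P ** E ** C) = 0"
    by (simp add: Y[symmetric] G_def[symmetric] V_def[symmetric] matrix_add_ldistrib trace_add)
qed

section \<open>Hurwitz matrices\<close>

text \<open>An annihilating polynomial of the orbit of \<open>v\<close> splits over \<open>\<complex>\<close>. Linear factors
  \<open>H - l\<close> with \<open>l\<close> not an eigenvalue are injective and can be dropped.\<close>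

lemma eigenvalue_induct:
  fixes H :: "complex^'n^'n"
  assumes zero: "P 0" and step: "\<And>l v. eigenvalue H l \<Longrightarrow> P (H *v v - l *s v) \<Longrightarrow> P v"
  shows "P v"
proof -
  define pw where "pw k v = ((*v) H ^^ k) v" for k :: nat and v
  define act where "act p v = (\<Sum>k\<le>degree p. coeff p k *s pw k v)" for p v
  have pw_H: "pw k (H *v v) = pw (Suc k) v" for k v
    by (simp add: pw_def funpow_swap1)
  have act_ge: "act p v = (\<Sum>k\<le>N. coeff p k *s pw k v)" if "degree p \<le> N" for p v N
    unfolding act_def using that
    by (intro sum.mono_neutral_left) (auto simp: coeff_eq_0)
  have act_linear: "act q (H *v v - a *s v) = H *v act q v - a *s act q v" for q a v
  proof -
    have pwl: "pw k (H *v v - a *s v) = H *v pw k v - a *s pw k v" for k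
    proof (induction k)
      case (Suc k)
      then show ?case
        by (simp add: pw_def matrix_vector_mult_diff_distrib vector_scalar_commute)
    qed (simp add: pw_def)
    show ?thesis
      by (simp add: act_def pwl vec.linear_sum vec.sum vec.scale vec.scale_sum_right sum_subtractf
          vector_ssub_ldistrib vector_scalar_commute mult.commute)
  qed
  \<comment> \<open>\<open>act p v\<close> is \<open>p(H) v\<close>. A linear factor is moved from
    the polynomial to the vector, so the induction on the degree has to let the vector vary.\<close>
  have act_factor: "act ([:- a, 1:] * q) v = act q (H *v v - a *s v)" for a q v
  proof -
    have "act ([:- a, 1:] * q) v = (\<Sum>k\<le>Suc (degree q). coeff ([:- a, 1:] * q) k *s pw k v)"
      by (rule act_ge) (use degree_mult_le[of "[:- a, 1:]" q] in simp)
    also have "\<dots> = (\<Sum>k\<le>Suc (degree q). coeff (pCons 0 q) k *s pw k v) - a *s (\<Sum>k\<le>Suc (degree q). coeff q k *s pw k v)"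
      unfolding vec.scale_sum_right sum_subtractf[symmetric]
      by (rule sum.cong) (simp_all add: vec.scale_left_diff_distrib)
    also have "(\<Sum>k\<le>Suc (degree q). coeff (pCons 0 q) k *s pw k v) = H *v act q v"
      by (subst sum.atMost_Suc_shift)
        (simp add: act_def vec.sum vector_scalar_commute pw_def)
    finally show ?thesis by (simp add: act_linear act_ge[of q "Suc (degree q)"])
  qed
  have annihilated: "P v" if "p \<noteq> 0" "act p v = 0" for p v
    using that
  proof (induction "degree p" arbitrary: p v rule: less_induct)
    case less
    show ?case
    proof (cases "degree p = 0")
      case True
      then obtain c where "p = [:c:]" by (rule degree_eq_zeroE)
      then have "v = 0" using less.prems by (simp add: act_def pw_def)
      then show ?thesis using zero by simp
    next
      case False
      then obtain a where "poly p a = 0" using fundamental_theorem_of_algebra_alt[of p] by force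
      then obtain q where q: "p = [:- a, 1:] * q" unfolding poly_eq_0_iff_dvd by (auto elim: dvdE)
      then have "q \<noteq> 0" using less.prems(1) by auto
      then have dq: "degree q < degree p" using q by (simp add: degree_mult_eq del: mult_pCons_left)
      have act0: "act q (H *v v - a *s v) = 0" using less.prems(2) unfolding q act_factor .
      show ?thesis
      proof (cases "eigenvalue H a")
        case True
        then show ?thesis using less.hyps[OF dq \<open>q \<noteq> 0\<close> act0] step by blast
      next
        case False
        then have "act q v = 0" using act0 unfolding act_linear eigenvalue_def by auto
        then show ?thesis using less.hyps[OF dq \<open>q \<noteq> 0\<close>] by blast
      qed
    qed
  qed
  define n where "n = CARD('n)"
  \<comment> \<open>The \<open>n + 1\<close> vectors \<open>pw 0 v\<close> to \<open>pw n v\<close>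
    are dependent in dimension \<open>n\<close>. If two of them coincide, the image set is too small
    for the dimension count, and their difference supplies the relation.\<close>
  obtain c :: "nat \<Rightarrow> complex" where c: "\<exists>k\<le>n. c k \<noteq> 0" "(\<Sum>k\<le>n. c k *s pw k v) = 0"
  proof (cases "inj_on (\<lambda>k. pw k v) {..n}")
    case True
    let ?S = "(\<lambda>k. pw k v) ` {..n}"
    have "vec.dim ?S < card ?S"
      using vec.dim_subset[OF subset_UNIV, of ?S] unfolding card_image[OF True] vec_dim_card
      by (simp add: n_def)
    then have "vec.dependent ?S" by (intro vec.dependent_biggerset_general)
    then obtain u where "\<exists>w\<in>?S. u w \<noteq> 0" "(\<Sum>w\<in>?S. u w *s w) = 0"
      by (subst (asm) vec.dependent_finite) auto
    then show ?thesis
      by (intro that[of "\<lambda>k. u (pw k v)"]) (auto simp: sum.reindex[OF True])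
  next
    case False
    then obtain i j where ij: "i \<le> n" "j \<le> n" "i \<noteq> j" "pw i v = pw j v"
      by (auto simp: inj_on_def)
    define c where "c k = (if k = i then 1 else 0) - (if k = j then 1 else 0 :: complex)" for k
    have "(\<Sum>k\<le>n. c k *s pw k v) = (\<Sum>k\<le>n. (if k = i then pw i v else 0) - (if k = j then pw j v else 0))"
      by (rule sum.cong) (auto simp: c_def)
    also have "\<dots> = 0" using ij by (simp add: sum_subtractf)
    finally show ?thesis using ij by (intro that[of c]) (auto simp: c_def)
  qed
  define p where "p = (\<Sum>k\<le>n. monom (c k) k)"
  have cp: "coeff p k = (if k \<le> n then c k else 0)" for k
    by (simp add: p_def coeff_sum)
  have "p \<noteq> 0" using c(1) cp by (metis coeff_0)
  moreover have "degree p \<le> n" by (rule degree_le) (simp add: cp)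
  then have "act p v = 0" using c(2) by (simp add: act_ge cp)
  ultimately show ?thesis by (rule annihilated)
qed

lemma eigenvalue_iff_not_invertible: "eigenvalue (H :: 'a::field^'n^'n) l \<longleftrightarrow> \<not> invertible (H - mat l)"
proof -
  have "(H - mat l) *v v = H *v v - l *s v" for v
    by (simp add: matrix_vector_mult_diff_rdistrib mat_def matrix_vector_mult_def vec_eq_iff left_diff_distrib sum_subtractf if_distrib[of "\<lambda>x. x * _"] cong: if_cong)
  then show ?thesis unfolding eigenvalue_def invertible_iff_ker by auto
qed

lemma eigenvalue_transpose: "eigenvalue (transpose H) l \<longleftrightarrow> eigenvalue (H :: 'a::field^'n^'n) l"
proof -
  have "transpose H - mat l = transpose (H - mat l)"
    by (simp add: transpose_def mat_def vec_eq_iff)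
  then show ?thesis
    by (simp add: eigenvalue_iff_not_invertible invertible_det_nz det_transpose)
qed

text \<open>The induction acts on row vectors. Paired with a solution of
  \<open>y' = A y + f\<close>, the row \<open>c\<close> satisfies a scalar equation with damping
  \<open>Re l < 0\<close> whose forcing contains the pairing of \<open>c v* A - l *s c\<close>. What
  is known about that row passes on to \<open>c\<close>, which replaces a Jordan form.\<close>

lemma hurwitz_induct:
  fixes A :: "real^'n^'n" and P :: "complex^'n \<Rightarrow> bool"
  assumes A: "hurwitz A" and zero: "P 0"
    and step: "\<And>l c. Re l < 0 \<Longrightarrow> P (c v* map_matrix complex_of_real A - l *s c) \<Longrightarrow> P c"
  shows "P c"
proof (rule eigenvalue_induct[of P "transpose (map_matrix complex_of_real A)"])
  fix l v assume "eigenvalue (transpose (map_matrix complex_of_real A)) l"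
    and P: "P (transpose (map_matrix complex_of_real A) *v v - l *s v)"
  then have "Re l < 0" using A by (simp add: eigenvalue_transpose hurwitz_def)
  then show "P v" by (rule step) (use P in simp)
qed (rule zero)

lemma map_matrix_of_real_mult_vec:
  "map_matrix complex_of_real P *v (\<chi> i. complex_of_real (v $ i)) = (\<chi> i. complex_of_real ((P *v v) $ i))"
  by (simp add: matrix_vector_mult_def vec_eq_iff)

lemma matrix_add_rdistrib: "(A + B) ** C = A ** C + B ** (C :: 'a::semiring_1^'n^'m)"
  by (simp add: matrix_matrix_mult_def vec_eq_iff distrib_right sum.distrib)

lemma hurwitz_real_eigenvalue:
  assumes "hurwitz A" "v \<noteq> 0" "A *v v = l *\<^sub>R v"
  shows "l < 0"
proof -
  let ?v = "\<chi> i. complex_of_real (v $ i)"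
  have "?v \<noteq> 0" using assms(2) by (simp add: vec_eq_iff)
  moreover have "map_matrix complex_of_real A *v ?v = complex_of_real l *s ?v"
    by (simp add: map_matrix_of_real_mult_vec assms(3) vec_eq_iff)
  ultimately have "eigenvalue (map_matrix complex_of_real A) (complex_of_real l)"
    unfolding eigenvalue_def by blast
  then show ?thesis using assms(1) unfolding hurwitz_def by fastforce
qed

lemma scaleR_matrix_mult: "(c *\<^sub>R P) ** Q = c *\<^sub>R (P ** (Q :: real^'n^'m))"
  by (simp add: matrix_matrix_mult_def vec_eq_iff sum_distrib_left mult_ac)

lemma matrix_mult_scaleR: "P ** (c *\<^sub>R Q) = c *\<^sub>R (P ** (Q :: real^'n^'m))"
  by (simp add: matrix_matrix_mult_def vec_eq_iff sum_distrib_left mult_ac)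

text \<open>A nonzero kernel vector of \<open>mat 1 - \<tau> *\<^sub>R A\<close> would be an
  eigenvector of \<open>A\<close> for the positive eigenvalue \<open>1 / \<tau>\<close>.\<close>

lemma resolvent_matrix_inverse:
  fixes A :: "real^'n^'n"
  assumes "\<tau> > 0" "hurwitz A"
  shows "(mat 1 - \<tau> *\<^sub>R A) ** resolvent_matrix \<tau> A = mat 1"
    "resolvent_matrix \<tau> A ** (mat 1 - \<tau> *\<^sub>R A) = mat 1"
proof -
  have "v = 0" if "(mat 1 - \<tau> *\<^sub>R A) *v v = 0" for v
  proof (rule ccontr)
    assume "v \<noteq> 0"
    have "v = \<tau> *\<^sub>R (A *v v)"
      using that by (simp add: matrix_vector_mult_diff_rdistrib scaleR_matrix_vector_assoc[symmetric])
    from arg_cong[OF this, of "(*\<^sub>R) (1 / \<tau>)"] have "A *v v = (1 / \<tau>) *\<^sub>R v"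
      using assms(1) by simp
    then have "1 / \<tau> < 0" using hurwitz_real_eigenvalue[OF assms(2) \<open>v \<noteq> 0\<close>] by blast
    then show False using assms(1) by simp
  qed
  then have "invertible (mat 1 - \<tau> *\<^sub>R A)" unfolding invertible_iff_ker by blast
  from invertible_matrix_inv[OF this]
  show "(mat 1 - \<tau> *\<^sub>R A) ** resolvent_matrix \<tau> A = mat 1"
    "resolvent_matrix \<tau> A ** (mat 1 - \<tau> *\<^sub>R A) = mat 1"
    by (simp_all add: resolvent_matrix_def)
qed

text \<open>Multiplication by \<open>N = mat 1 - \<tau> *\<^sub>R A\<close> on the left and by
  \<open>transpose N\<close> on the right removes the inverses and leaves
  \<open>2 D = \<tau> (A D + D A^T)\<close>, a Lyapunov equation whose spectrum avoids zero because
  \<open>A\<close> is stable.\<close>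

lemma lyapunov_resolvent_unique:
  fixes A D :: "real^'n^'n"
  assumes \<tau>: "\<tau> > 0" and A: "hurwitz A"
    and eq: "D ** transpose (resolvent_matrix \<tau> A) + resolvent_matrix \<tau> A ** D = 0"
  shows "D = 0"
proof -
  define N B where "N = mat 1 - \<tau> *\<^sub>R A" and "B = resolvent_matrix \<tau> A"
  have NB: "N ** B = mat 1" using resolvent_matrix_inverse[OF \<tau> A] by (simp add: N_def B_def)
  have BN: "transpose B ** transpose N = mat 1"
    using arg_cong[OF NB, of transpose] by (simp add: matrix_transpose_mul)
  have "N ** (D ** transpose B + B ** D) ** transpose N = 0"
    using eq by (simp add: B_def)
  moreover have "N ** (D ** transpose B + B ** D) ** transpose N
      = N ** D ** (transpose B ** transpose N) + (N ** B) ** D ** transpose N"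
    by (simp add: matrix_add_ldistrib matrix_add_rdistrib matrix_mul_assoc)
  ultimately have "N ** D + D ** transpose N = 0" by (simp add: BN NB)
  moreover have "transpose N = mat 1 - \<tau> *\<^sub>R transpose A"
    by (simp add: N_def transpose_def vec_eq_iff mat_def)
  ultimately have "(D - \<tau> *\<^sub>R (A ** D)) + (D - \<tau> *\<^sub>R (D ** transpose A)) = 0"
    by (simp add: N_def matrix_diff_ldistrib matrix_diff_rdistrib scaleR_matrix_mult matrix_mult_scaleR)
  from arg_cong[OF this, of "\<lambda>P. P $ i $ j" for i j]
  have ND: "2 * D $ i $ j = \<tau> * ((A ** D) $ i $ j + (D ** transpose A) $ i $ j)" for i j
    by (simp add: algebra_simps)
  let ?A = "map_matrix complex_of_real A" and ?D = "map_matrix complex_of_real D"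
  \<comment> \<open>If \<open>D\<close> kills \<open>A^T c - l c\<close>, then
    \<open>D A^T c = l D c\<close>, and the equation makes \<open>D c\<close> an eigenvector of
    \<open>A\<close> for \<open>2 / \<tau> - l\<close> unless it is zero. The real part of that
    number is positive.\<close>
  have D0: "?D *v c = 0" for c
  proof (rule hurwitz_induct[OF A, of "\<lambda>c. ?D *v c = 0"])
    fix l c assume l: "Re l < 0" and "?D *v (c v* ?A - l *s c) = 0"
    then have Dc: "?D *v (c v* ?A) = l *s (?D *v c)"
      by (simp add: matrix_vector_mult_diff_distrib vector_scalar_commute)
    have mD: "2 * ?D $ i $ j = \<tau> * ((?A ** ?D) $ i $ j + (?D ** transpose ?A) $ i $ j)" for i j
    proof -
      have "complex_of_real (2 * D $ i $ j) = complex_of_real (\<tau> * ((A ** D) $ i $ j + (D ** transpose A) $ i $ j))"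
        by (simp only: ND)
      then show ?thesis by (simp add: matrix_matrix_mult_def transpose_def)
    qed
    have "2 *s (?D *v c) = complex_of_real \<tau> *s (((?A ** ?D) *v c) + ((?D ** transpose ?A) *v c))"
    proof (subst vec_eq_iff, rule allI)
      fix i
      have "(2 *s (?D *v c)) $ i = (\<Sum>j\<in>UNIV. (2 * ?D $ i $ j) * c $ j)"
        by (simp add: matrix_vector_mult_def sum_distrib_left mult_ac)
      also have "\<dots> = (complex_of_real \<tau> *s (((?A ** ?D) *v c) + ((?D ** transpose ?A) *v c))) $ i"
        unfolding mD by (simp add: matrix_vector_mult_def sum_distrib_left distrib_left distrib_right mult_ac sum.distrib)
      finally show "(2 *s (?D *v c)) $ i = (complex_of_real \<tau> *s (((?A ** ?D) *v c) + ((?D ** transpose ?A) *v c))) $ i" .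
    qed
    also have "\<dots> = complex_of_real \<tau> *s (?A *v (?D *v c) + l *s (?D *v c))"
      by (simp add: matrix_vector_mul_assoc[symmetric] Dc)
    finally have e: "2 * (?D *v c) $ i = \<tau> * ((?A *v (?D *v c)) $ i + l * (?D *v c) $ i)" for i
      by (metis vector_add_component vector_smult_component)
    have "?A *v (?D *v c) = (2 / \<tau> - l) *s (?D *v c)"
    proof (subst vec_eq_iff, rule allI)
      fix i show "(?A *v (?D *v c)) $ i = ((2 / \<tau> - l) *s (?D *v c)) $ i"
        using e[of i] \<tau> by (simp add: field_simps)
    qed
    moreover have "Re (2 / \<tau> - l) > 0" using less_trans[OF l, of "2 / \<tau>"] \<tau> by simp
    ultimately show "?D *v c = 0"
      using A unfolding hurwitz_def eigenvalue_def by (metis not_less_iff_gr_or_eq)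
  qed simp
  have "D $ i $ j = 0" for i j
    using arg_cong[OF D0[of "axis j 1"], of "\<lambda>v. v $ i"]
    by (simp add: matrix_vector_mult_def axis_def if_distrib[of "\<lambda>x. _ * x"] cong: if_cong)
  then show ?thesis by (simp add: vec_eq_iff)
qed

lemma transpose_diff: "transpose (P - Q) = transpose P - transpose (Q :: 'a::ring_1^'n^'m)"
  by (simp add: transpose_def vec_eq_iff)

section \<open>Uniqueness of the drift and diffusion matrices\<close>

lemma pos_def_symmetric: "pos_def P \<Longrightarrow> transpose P = P"
  by (simp add: pos_def_def)

lemma pos_def_add:
  assumes "pos_def P" "pos_def Q"
  shows "pos_def (P + Q)"
proof (rule pos_defI)
  show "transpose (P + Q) = P + Q" using assms by (simp add: transpose_add pos_def_symmetric)
  show "w \<bullet> ((P + Q) *v w) > 0" if "w \<noteq> 0" for w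
    using assms[THEN pos_def_quadratic_form_pos, OF that]
    by (simp add: matrix_vector_mult_add_rdistrib inner_add_right)
qed

lemma pos_def_scaleR:
  assumes "pos_def P" "c > 0"
  shows "pos_def (c *\<^sub>R P)"
proof (rule pos_defI)
  show "transpose (c *\<^sub>R P) = c *\<^sub>R P" using assms(1) by (simp add: transpose_scalar pos_def_symmetric)
  show "w \<bullet> ((c *\<^sub>R P) *v w) > 0" if "w \<noteq> 0" for w
    using assms(2) pos_def_quadratic_form_pos[OF assms(1) that]
    by (simp add: scaleR_matrix_vector_assoc[symmetric])
qed

lemma eq_a_unique_Q:
  assumes "\<tau> > 0" "hurwitz A" "eq_a \<tau> C A Q" "eq_a \<tau> C A Q'"
  shows "Q' = Q"
proof -
  let ?B = "resolvent_matrix \<tau> A"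
  have 0: "A ** C + C ** transpose A + Q ** transpose ?B + ?B ** Q = 0"
    "A ** C + C ** transpose A + Q' ** transpose ?B + ?B ** Q' = 0"
    using assms(3,4) by (simp_all add: eq_a_def Let_def)
  have "(Q' - Q) ** transpose ?B + ?B ** (Q' - Q) =
     (A ** C + C ** transpose A + Q' ** transpose ?B + ?B ** Q')
     - (A ** C + C ** transpose A + Q ** transpose ?B + ?B ** Q)"
    by (simp add: matrix_diff_ldistrib matrix_diff_rdistrib)
  then have "(Q' - Q) ** transpose ?B + ?B ** (Q' - Q) = 0" unfolding 0 by simp
  then have "Q' - Q = 0" by (rule lyapunov_resolvent_unique[OF assms(1,2)])
  then show ?thesis by simp
qed

lemma eq_b_diff:
  assumes "eq_b \<tau> C K1 K2 A" "eq_b \<tau> C K1 K2 A'" "transpose C = C"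
  shows "(A' - A) ** (K1 + (1 / \<tau>) *\<^sub>R C) + transpose (K1 + (1 / \<tau>) *\<^sub>R C) ** transpose (A' - A) = 0"
proof -
  define Y where "Y = K1 + (1 / \<tau>) *\<^sub>R C"
  have Yt: "transpose Y = transpose K1 + (1 / \<tau>) *\<^sub>R C"
    by (simp add: Y_def transpose_add transpose_scalar assms(3))
  have "A ** Y + transpose Y ** transpose A = A' ** Y + transpose Y ** transpose A'"
    using assms(1,2) unfolding eq_b_def Yt[symmetric] Y_def[symmetric] by simp
  then show ?thesis
    unfolding Y_def[symmetric] transpose_diff matrix_diff_ldistrib matrix_diff_rdistrib
    by (simp add: algebra_simps)
qed

text \<open>The terms in \<open>K1\<close> cancel; what remains is the self-adjointness premise of
  \<open>self_adjoint_skew_product_zero\<close>.\<close>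

lemma eq_c_diff:
  assumes "eq_c \<tau> C K1 K2 K3 A" "eq_c \<tau> C K1 K2 K3 A'"
  shows "(A' - A) ** ((1 / \<tau>\<^sup>2) *\<^sub>R C - K2) = ((1 / \<tau>\<^sup>2) *\<^sub>R C - K2) ** transpose (A' - A)"
proof -
  define P where "P = (1 / \<tau>\<^sup>2) *\<^sub>R C - K2"
  have P: "K2 - (1 / \<tau>\<^sup>2) *\<^sub>R C = 0 - P" by (simp add: P_def)
  have "(1 / \<tau>\<^sup>2) *\<^sub>R K1 + A ** (0 - P) - (1 / \<tau>\<^sup>2) *\<^sub>R transpose K1 - (0 - P) ** transpose A
     = (1 / \<tau>\<^sup>2) *\<^sub>R K1 + A' ** (0 - P) - (1 / \<tau>\<^sup>2) *\<^sub>R transpose K1 - (0 - P) ** transpose A'"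
    using assms unfolding eq_c_def P by simp
  then show ?thesis
    unfolding P_def[symmetric] transpose_diff matrix_diff_ldistrib matrix_diff_rdistrib
    by (simp add: algebra_simps)
qed

context
  fixes \<tau> :: real and A Q C K1 K2 :: "real^'n^'n"
  assumes \<tau>: "\<tau> > 0" and A: "hurwitz A" and C: "pos_def C" and K1: "transpose K1 = - K1"
    and a: "eq_a \<tau> C A Q" and b: "eq_b \<tau> C K1 K2 A"
begin

text \<open>The skew \<open>K1\<close> drops out, and the positive multiple of \<open>C\<close>
  becomes the second weight in the trace argument.\<close>

lemma symmetric_part_of_eq_b_factor:
  "(K1 + (1 / \<tau>) *\<^sub>R C) + transpose (K1 + (1 / \<tau>) *\<^sub>R C) = (2 / \<tau>) *\<^sub>R C"
  using C by (simp add: transpose_add transpose_scalar K1 pos_def_symmetric) (simp add: vec_eq_iff field_simps)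

lemma pos_C: "pos_def ((2 / \<tau>) *\<^sub>R C)"
  by (rule pos_def_scaleR[OF C]) (use \<tau> in simp)

lemma eqs_abc_unique:
  assumes K2: "neg_def K2" and "eq_c \<tau> C K1 K2 K3 A"
    and "eq_a \<tau> C A' Q'" "eq_b \<tau> C K1 K2 A'" "eq_c \<tau> C K1 K2 K3 A'"
  shows "A' = A" "Q' = Q"
proof -
  have "pos_def ((1 / \<tau>\<^sup>2) *\<^sub>R C + - K2)"
    using K2 \<tau> by (intro pos_def_add pos_def_scaleR[OF C]) (simp_all add: neg_def_iff_pos_def_uminus)
  then have P: "pos_def ((1 / \<tau>\<^sup>2) *\<^sub>R C - K2)" by simp
  have "A' - A = 0"
    by (rule self_adjoint_skew_product_zero[OF P pos_C eq_c_diff[OF assms(2,5)]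
          eq_b_diff[OF b assms(4) pos_def_symmetric[OF C]] symmetric_part_of_eq_b_factor])
  then show "A' = A" by simp
  then show "Q' = Q" using eq_a_unique_Q[OF \<tau> A a] assms(3) by simp
qed

text \<open>A difference of symmetric matrices is self-adjoint for the ordinary inner product, so
  the identity weight takes over the role that (c) plays for general drift matrices.\<close>

lemma eqs_ab_unique_symmetric:
  assumes "transpose A = A" "transpose A' = A'" "eq_a \<tau> C A' Q'" "eq_b \<tau> C K1 K2 A'"
  shows "A' = A" "Q' = Q"
proof -
  have P: "pos_def (mat 1 :: real^'n^'n)" by (rule pos_defI) auto
  have sa: "(A' - A) ** mat 1 = mat 1 ** transpose (A' - A)"
    using assms(1,2) by (simp add: transpose_diff)
  have "A' - A = 0"
    by (rule self_adjoint_skew_product_zero[OF P pos_C sa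
          eq_b_diff[OF b assms(4) pos_def_symmetric[OF C]] symmetric_part_of_eq_b_factor])
  then show "A' = A" by simp
  then show "Q' = Q" using eq_a_unique_Q[OF \<tau> A a] assms(3) by simp
qed

end

section \<open>Square integrable random variables and processes\<close>

definition square_integrable :: "'w measure \<Rightarrow> ('w \<Rightarrow> 'b::real_normed_vector) \<Rightarrow> bool" where
  "square_integrable M X \<longleftrightarrow> X \<in> borel_measurable M \<and> integrable M (\<lambda>\<omega>. (norm (X \<omega>))\<^sup>2)"

lemma square_integrable_measurable: "square_integrable M X \<Longrightarrow> X \<in> borel_measurable M"
  by (simp add: square_integrable_def)

lemma square_integrable_iff_nn_integral:
  fixes X :: "'w \<Rightarrow> 'b::euclidean_space"
  assumes [measurable]: "X \<in> borel_measurable M"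
  shows "square_integrable M X \<longleftrightarrow> (\<integral>\<^sup>+\<omega>. ennreal ((norm (X \<omega>))\<^sup>2) \<partial>M) < \<infinity>"
  by (simp add: square_integrable_def integrable_iff_bounded)

lemma young_ineq: "(x::real) * y \<le> (x\<^sup>2 + y\<^sup>2) / 2"
  using zero_le_power2[of "x - y"] by (simp add: power2_diff)

lemma square_integrable_bound:
  fixes X :: "'w \<Rightarrow> 'b::euclidean_space" and Z :: "'w \<Rightarrow> 'c::euclidean_space"
  assumes "square_integrable M X" and [measurable]: "Z \<in> borel_measurable M"
    and "\<And>\<omega>. norm (Z \<omega>) \<le> c * norm (X \<omega>)"
  shows "square_integrable M Z"
proof -
  have "integrable M (\<lambda>\<omega>. c\<^sup>2 * (norm (X \<omega>))\<^sup>2)"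
    using assms(1) by (simp add: square_integrable_def)
  then have "integrable M (\<lambda>\<omega>. (norm (Z \<omega>))\<^sup>2)"
  proof (rule Bochner_Integration.integrable_bound)
    show "AE \<omega> in M. norm ((norm (Z \<omega>))\<^sup>2) \<le> norm (c\<^sup>2 * (norm (X \<omega>))\<^sup>2)"
      using power_mono[OF assms(3) norm_ge_zero, of _ 2] by (simp add: power_mult_distrib abs_mult)
  qed simp
  then show ?thesis by (simp add: square_integrable_def)
qed

lemma square_integrable_add:
  fixes X Z :: "'w \<Rightarrow> 'b::euclidean_space"
  assumes X: "square_integrable M X" and Z: "square_integrable M Z"
  shows "square_integrable M (\<lambda>\<omega>. X \<omega> + Z \<omega>)"
proof -
  note [measurable] = square_integrable_measurable[OF X] square_integrable_measurable[OF Z]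
  have "integrable M (\<lambda>\<omega>. 2 * (norm (X \<omega>))\<^sup>2 + 2 * (norm (Z \<omega>))\<^sup>2)"
    using assms by (simp add: square_integrable_def)
  then have "integrable M (\<lambda>\<omega>. (norm (X \<omega> + Z \<omega>))\<^sup>2)"
  proof (rule Bochner_Integration.integrable_bound)
    have "(norm (X \<omega> + Z \<omega>))\<^sup>2 \<le> 2 * (norm (X \<omega>))\<^sup>2 + 2 * (norm (Z \<omega>))\<^sup>2" for \<omega>
    proof -
      have "(norm (X \<omega> + Z \<omega>))\<^sup>2 \<le> (norm (X \<omega>) + norm (Z \<omega>))\<^sup>2"
        by (intro power_mono norm_triangle_ineq norm_ge_zero)
      also have "\<dots> \<le> 2 * (norm (X \<omega>))\<^sup>2 + 2 * (norm (Z \<omega>))\<^sup>2"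
        using young_ineq[of "norm (X \<omega>)" "norm (Z \<omega>)"] by (simp add: power2_sum)
      finally show ?thesis .
    qed
    then show "AE \<omega> in M. norm ((norm (X \<omega> + Z \<omega>))\<^sup>2) \<le> norm (2 * (norm (X \<omega>))\<^sup>2 + 2 * (norm (Z \<omega>))\<^sup>2)"
      by simp
  qed simp
  then show ?thesis by (simp add: square_integrable_def)
qed

lemma square_integrable_scaleR:
  fixes X :: "'w \<Rightarrow> 'b::euclidean_space"
  assumes "square_integrable M X"
  shows "square_integrable M (\<lambda>\<omega>. c *\<^sub>R X \<omega>)"
  using assms by (auto simp: square_integrable_def power_mult_distrib)

lemma square_integrable_diff:
  fixes X Z :: "'w \<Rightarrow> 'b::euclidean_space"
  assumes X: "square_integrable M X" and Z: "square_integrable M Z"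
  shows "square_integrable M (\<lambda>\<omega>. X \<omega> - Z \<omega>)"
  using square_integrable_add[OF X square_integrable_scaleR[OF Z, of "-1"]] by simp

lemma square_integrable_bounded_linear:
  fixes X :: "'w \<Rightarrow> 'b::euclidean_space" and f :: "'b \<Rightarrow> 'c::euclidean_space"
  assumes "square_integrable M X" "bounded_linear f"
  shows "square_integrable M (\<lambda>\<omega>. f (X \<omega>))"
proof (rule square_integrable_bound[OF assms(1), where c = "onorm f"])
  have "f \<in> borel_measurable borel"
    using assms(2) by (intro borel_measurable_continuous_onI linear_continuous_on)
  then show "(\<lambda>\<omega>. f (X \<omega>)) \<in> borel_measurable M"
    using square_integrable_measurable[OF assms(1)] by measurable
  show "norm (f (X \<omega>)) \<le> onorm f * norm (X \<omega>)" for \<omega>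
    using assms(2) by (rule onorm)
qed

lemma square_integrable_nth:
  fixes X :: "'w \<Rightarrow> real^'n"
  shows "square_integrable M X \<Longrightarrow> square_integrable M (\<lambda>\<omega>. X \<omega> $ i)"
  by (rule square_integrable_bounded_linear[of M X "\<lambda>v. v $ i"]) (simp_all add: bounded_linear_vec_nth)

lemma square_integrable_vec:
  fixes X :: "'w \<Rightarrow> real^'n"
  assumes "\<And>i. square_integrable M (\<lambda>\<omega>. X \<omega> $ i)"
  shows "square_integrable M X"
proof -
  have [measurable]: "X \<in> borel_measurable M"
    using square_integrable_measurable[OF assms] by (subst borel_measurable_euclidean_space) (auto simp: Basis_vec_def inner_axis)
  have "(norm (X \<omega>))\<^sup>2 = (\<Sum>i\<in>UNIV. (norm (X \<omega> $ i))\<^sup>2)" for \<omega>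
    by (simp add: norm_vec_def L2_set_def sum_nonneg)
  then show ?thesis using assms by (simp add: square_integrable_def)
qed

text \<open>Young's inequality is preferred to the Cauchy-Schwarz inequality: bounds linear in the
  second moments become uniform in time as soon as those moments are stationary.\<close>

lemma integrable_square_integrable_mult:
  fixes X :: "'w \<Rightarrow> 'b::euclidean_space" and Y :: "'w \<Rightarrow> real"
  assumes Y: "square_integrable M Y" and X: "square_integrable M X"
  shows "integrable M (\<lambda>\<omega>. Y \<omega> *\<^sub>R X \<omega>)"
    and "norm (\<integral>\<omega>. Y \<omega> *\<^sub>R X \<omega> \<partial>M) \<le> ((\<integral>\<omega>. (Y \<omega>)\<^sup>2 \<partial>M) + (\<integral>\<omega>. (norm (X \<omega>))\<^sup>2 \<partial>M)) / 2"
    and "(\<integral>\<omega>. norm (Y \<omega> *\<^sub>R X \<omega>) \<partial>M) \<le> ((\<integral>\<omega>. (Y \<omega>)\<^sup>2 \<partial>M) + (\<integral>\<omega>. (norm (X \<omega>))\<^sup>2 \<partial>M)) / 2"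
proof -
  note [measurable] = square_integrable_measurable[OF X] square_integrable_measurable[OF Y]
  have I: "integrable M (\<lambda>\<omega>. ((Y \<omega>)\<^sup>2 + (norm (X \<omega>))\<^sup>2) / 2)"
    using X Y by (simp add: square_integrable_def)
  have le: "norm (Y \<omega> *\<^sub>R X \<omega>) \<le> ((Y \<omega>)\<^sup>2 + (norm (X \<omega>))\<^sup>2) / 2" for \<omega>
    using young_ineq[of "\<bar>Y \<omega>\<bar>" "norm (X \<omega>)"] by simp
  show int: "integrable M (\<lambda>\<omega>. Y \<omega> *\<^sub>R X \<omega>)"
    by (rule Bochner_Integration.integrable_bound[OF I]) (use order_trans[OF le abs_ge_self] in auto)
  have "(\<integral>\<omega>. norm (Y \<omega> *\<^sub>R X \<omega>) \<partial>M) \<le> (\<integral>\<omega>. ((Y \<omega>)\<^sup>2 + (norm (X \<omega>))\<^sup>2) / 2 \<partial>M)"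
    using le by (intro integral_mono I integrable_norm int)
  also have "\<dots> = ((\<integral>\<omega>. (Y \<omega>)\<^sup>2 \<partial>M) + (\<integral>\<omega>. (norm (X \<omega>))\<^sup>2 \<partial>M)) / 2"
    using X Y by (simp add: square_integrable_def)
  finally show *: "(\<integral>\<omega>. norm (Y \<omega> *\<^sub>R X \<omega>) \<partial>M) \<le> ((\<integral>\<omega>. (Y \<omega>)\<^sup>2 \<partial>M) + (\<integral>\<omega>. (norm (X \<omega>))\<^sup>2 \<partial>M)) / 2" .
  show "norm (\<integral>\<omega>. Y \<omega> *\<^sub>R X \<omega> \<partial>M) \<le> ((\<integral>\<omega>. (Y \<omega>)\<^sup>2 \<partial>M) + (\<integral>\<omega>. (norm (X \<omega>))\<^sup>2 \<partial>M)) / 2"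
    using integral_norm_bound * by (rule order_trans)
qed

text \<open>Rounding time down to multiples of \<open>1 / (n + 1)\<close> leaves countably many
  random variables to glue, and path continuity makes these approximations converge pointwise.
  Fubini's theorem needs the joint measurability.\<close>

lemma measurable_continuous_paths:
  fixes g :: "real \<Rightarrow> 'w \<Rightarrow> 'b::euclidean_space"
  assumes meas: "\<And>t. g t \<in> borel_measurable M" and cont: "\<And>\<omega>. continuous_on UNIV (\<lambda>t. g t \<omega>)"
  shows "(\<lambda>(t, \<omega>). g t \<omega>) \<in> borel_measurable (borel \<Otimes>\<^sub>M M)"
proof (rule borel_measurable_LIMSEQ_metric)
  fix n :: nat
  define h where "h = (\<lambda>(t::real, \<omega>). g (real_of_int \<lfloor>real (Suc n) * t\<rfloor> / real (Suc n)) \<omega>)"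
  have "(\<lambda>p. g (real_of_int i / real (Suc n)) (snd p)) \<in> borel_measurable (borel \<Otimes>\<^sub>M M)" for i
    using meas by measurable
  moreover have "(\<lambda>p. \<lfloor>real (Suc n) * fst p\<rfloor>) \<in> borel \<Otimes>\<^sub>M M \<rightarrow>\<^sub>M count_space (UNIV :: int set)"
    by measurable
  ultimately have "(\<lambda>p. g (real_of_int \<lfloor>real (Suc n) * fst p\<rfloor> / real (Suc n)) (snd p)) \<in> borel_measurable (borel \<Otimes>\<^sub>M M)"
    by (rule measurable_compose_countable)
  then show "(\<lambda>(t::real, \<omega>). g (real_of_int \<lfloor>real (Suc n) * t\<rfloor> / real (Suc n)) \<omega>) \<in> borel_measurable (borel \<Otimes>\<^sub>M M)"
    by (simp add: case_prod_beta)
next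
  fix p :: "real \<times> 'w" assume "p \<in> space (borel \<Otimes>\<^sub>M M)"
  obtain t \<omega> where p: "p = (t, \<omega>)" by (cases p)
  have "(\<lambda>n. real_of_int \<lfloor>real (Suc n) * t\<rfloor> / real (Suc n)) \<longlonglongrightarrow> t"
  proof (rule tendsto_sandwich)
    show "\<forall>\<^sub>F n in sequentially. t - inverse (real (Suc n)) \<le> real_of_int \<lfloor>real (Suc n) * t\<rfloor> / real (Suc n)"
    proof (intro always_eventually allI)
      fix n
      have "t - inverse (real (Suc n)) = (real (Suc n) * t - 1) / real (Suc n)"
        by (simp add: field_simps del: of_nat_Suc)
      also have "\<dots> \<le> real_of_int \<lfloor>real (Suc n) * t\<rfloor> / real (Suc n)"
        by (intro divide_right_mono) linarith+
      finally show "t - inverse (real (Suc n)) \<le> real_of_int \<lfloor>real (Suc n) * t\<rfloor> / real (Suc n)" .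
    qed
    show "\<forall>\<^sub>F n in sequentially. real_of_int \<lfloor>real (Suc n) * t\<rfloor> / real (Suc n) \<le> t"
      by (intro always_eventually allI) (simp add: field_simps del: of_nat_Suc)
    show "(\<lambda>n. t - inverse (real (Suc n))) \<longlonglongrightarrow> t"
      using tendsto_diff[OF tendsto_const LIMSEQ_inverse_real_of_nat, of t] by simp
  qed simp
  then show "(\<lambda>n. (\<lambda>(t, \<omega>). g (real_of_int \<lfloor>real (Suc n) * t\<rfloor> / real (Suc n)) \<omega>) p) \<longlonglongrightarrow> (\<lambda>(t, \<omega>). g t \<omega>) p"
    using cont[of \<omega>] unfolding p by (auto intro: continuous_on_tendsto_compose)
qed

text \<open>The bridge from path equations to equations for covariances: Fubini's theorem exchanges
  expectation and time integral, and the uniform bound on second moments makes the integrand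
  integrable on the product space.\<close>

lemma (in prob_space) has_integral_expectation:
  fixes g :: "real \<Rightarrow> 'a \<Rightarrow> 'b::euclidean_space" and Y :: "'a \<Rightarrow> real"
  assumes Y: "square_integrable M Y" and g: "\<And>t. square_integrable M (g t)"
    and cont: "\<And>\<omega>. continuous_on UNIV (\<lambda>t. g t \<omega>)"
    and bound: "\<And>t. a \<le> t \<Longrightarrow> t \<le> b \<Longrightarrow> expectation (\<lambda>\<omega>. (norm (g t \<omega>))\<^sup>2) \<le> c"
  shows "((\<lambda>t. expectation (\<lambda>\<omega>. Y \<omega> *\<^sub>R g t \<omega>)) has_integral
    expectation (\<lambda>\<omega>. Y \<omega> *\<^sub>R integral {a..b} (\<lambda>t. g t \<omega>))) {a..b}"
proof -
  have [measurable]: "(\<lambda>(t, \<omega>). g t \<omega>) \<in> borel_measurable (borel \<Otimes>\<^sub>M M)"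
    using square_integrable_measurable[OF g] cont by (rule measurable_continuous_paths)
  note [measurable] = square_integrable_measurable[OF Y] square_integrable_measurable[OF g]
  interpret P: pair_sigma_finite lborel M by unfold_locales
  define F where "F t \<omega> = indicator {a..b} t *\<^sub>R Y \<omega> *\<^sub>R g t \<omega>" for t \<omega>
  have F[measurable]: "case_prod F \<in> borel_measurable (lborel \<Otimes>\<^sub>M M)"
    unfolding F_def by measurable
  have intF: "integrable M (F t)" for t
    unfolding F_def by (intro integrable_scaleR_right integrable_square_integrable_mult(1)[OF Y g])
  define d where "d = (expectation (\<lambda>\<omega>. (Y \<omega>)\<^sup>2) + c) / 2"
  have nF: "expectation (\<lambda>\<omega>. norm (F t \<omega>)) \<le> indicator {a..b} t * d" for t
  proof (cases "t \<in> {a..b}")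
    case True
    then show ?thesis
      using integrable_square_integrable_mult(3)[OF Y g[of t]] bound[of t]
      by (simp add: F_def d_def)
  qed (simp add: F_def)
  have "integrable lborel (\<lambda>t. expectation (\<lambda>\<omega>. norm (F t \<omega>)))"
  proof (rule Bochner_Integration.integrable_bound)
    show "integrable lborel (\<lambda>t. indicator {a..b} t * d)"
      by (intro integrable_mult_left integrable_real_indicator) (auto simp: emeasure_lborel_Icc_eq)
    show "AE t in lborel. norm (expectation (\<lambda>\<omega>. norm (F t \<omega>))) \<le> norm (indicator {a..b} t * d)"
      using order_trans[OF nF abs_ge_self] by (auto simp: integral_nonneg_AE)
  qed measurable
  then have FI: "integrable (lborel \<Otimes>\<^sub>M M) (case_prod F)"
    by (intro P.Fubini_integrable) (use intF in auto)
  have inner: "(\<integral>t. F t \<omega> \<partial>lborel) = Y \<omega> *\<^sub>R integral {a..b} (\<lambda>t. g t \<omega>)" for \<omega>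
  proof -
    have "set_integrable lborel {a..b} (\<lambda>t. g t \<omega>)"
      by (rule borel_integrable_atLeastAtMost') (rule continuous_on_subset[OF cont], simp)
    moreover have "(\<lambda>t. F t \<omega>) = (\<lambda>t. Y \<omega> *\<^sub>R (indicator {a..b} t *\<^sub>R g t \<omega>))"
      by (simp add: F_def mult.commute)
    ultimately show ?thesis
      using set_borel_integral_eq_integral(2)[of "{a..b}" "\<lambda>t. g t \<omega>"]
      by (simp only: integral_scaleR_right set_lebesgue_integral_def)
  qed
  have "((\<lambda>t. expectation (F t)) has_integral (\<integral>t. expectation (F t) \<partial>lborel)) UNIV"
    using P.integrable_fst'[OF FI] by (intro has_integral_integral_lborel) simp
  also have "(\<integral>t. expectation (F t) \<partial>lborel) = expectation (\<lambda>\<omega>. \<integral>t. F t \<omega> \<partial>lborel)"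
    using P.Fubini_integral[OF FI] by simp
  also have "(\<lambda>t. expectation (F t)) = (\<lambda>t. if t \<in> {a..b} then expectation (\<lambda>\<omega>. Y \<omega> *\<^sub>R g t \<omega>) else 0)"
    by (auto simp: F_def[abs_def] fun_eq_iff)
  finally show ?thesis by (simp only: has_integral_restrict_UNIV inner)
qed

text \<open>The damping contributes \<open>- 2 \<mu>\<close> to the growth rate of the squared norm.
  The weight \<open>exp (\<mu> t)\<close> uses up one half of it, and Young's inequality spends the
  other half on the forcing. The extended nonnegative form allows averaging over paths before any
  moment is known to be finite.\<close>

lemma energy_estimate:
  fixes y f :: "real \<Rightarrow> 'b::real_inner" and g :: "real \<Rightarrow> 'c::real_normed_vector"
  assumes \<mu>: "\<mu> > 0" and "s \<le> 0"
    and y: "\<And>t. (y has_vector_derivative f t) (at t)"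
    and f: "\<And>t. y t \<bullet> f t \<le> - \<mu> * (norm (y t))\<^sup>2 + norm (y t) * norm (g t)"
    and g: "continuous_on UNIV g"
  shows "ennreal ((norm (y 0))\<^sup>2) \<le> ennreal (exp (\<mu> * s) * (norm (y s))\<^sup>2)
    + (\<integral>\<^sup>+t. ennreal (exp (\<mu> * t) * (norm (g t))\<^sup>2 / \<mu>) * indicator {s..0} t \<partial>lborel)"
proof -
  define q where "q t = exp (\<mu> * t) * (norm (g t))\<^sup>2 / \<mu>" for t
  have q0: "q t \<ge> 0" for t using \<mu> by (simp add: q_def)
  define h' where "h' t = exp (\<mu> * t) * (2 * (y t \<bullet> f t) + \<mu> * (norm (y t))\<^sup>2)" for t
  have h: "((\<lambda>t. exp (\<mu> * t) * (norm (y t))\<^sup>2) has_vector_derivative h' t) (at t within S)" for t S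
  proof -
    have "(y has_derivative (\<lambda>x. x *\<^sub>R f t)) (at t within S)"
      using y[of t] by (simp add: has_vector_derivative_def has_derivative_at_withinI)
    then show ?thesis
      unfolding has_vector_derivative_def power2_norm_eq_inner h'_def
      by (auto intro!: derivative_eq_intros simp: fun_eq_iff inner_commute algebra_simps)
  qed
  have le: "h' t \<le> q t" for t
  proof -
    have "norm (y t) * norm (g t) = (sqrt \<mu> * norm (y t)) * (norm (g t) / sqrt \<mu>)" using \<mu> by simp
    also have "\<dots> \<le> (\<mu> * (norm (y t))\<^sup>2 + (norm (g t))\<^sup>2 / \<mu>) / 2"
      using young_ineq[of "sqrt \<mu> * norm (y t)" "norm (g t) / sqrt \<mu>"] \<mu>
      by (simp add: power_mult_distrib power_divide)
    finally have "2 * (y t \<bullet> f t) + \<mu> * (norm (y t))\<^sup>2 \<le> (norm (g t))\<^sup>2 / \<mu>"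
      using f[of t] by (simp add: field_simps)
    then have "h' t \<le> exp (\<mu> * t) * ((norm (g t))\<^sup>2 / \<mu>)"
      unfolding h'_def by (intro mult_left_mono) auto
    then show ?thesis by (simp add: q_def)
  qed
  have "continuous_on {s..0} q"
    unfolding q_def by (intro continuous_intros continuous_on_subset[OF g]) (use \<mu> in auto)
  then have qI: "(q has_integral integral {s..0} q) {s..0}"
    by (intro integrable_integral integrable_continuous_interval)
  have "(h' has_integral (norm (y 0))\<^sup>2 - exp (\<mu> * s) * (norm (y s))\<^sup>2) {s..0}"
    using fundamental_theorem_of_calculus[OF \<open>s \<le> 0\<close> h] by simp
  from has_integral_le[OF this qI] le
  have "(norm (y 0))\<^sup>2 \<le> exp (\<mu> * s) * (norm (y s))\<^sup>2 + integral {s..0} q" by simp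
  moreover have "(\<integral>\<^sup>+t. ennreal (q t) * indicator {s..0} t \<partial>lborel) = ennreal (integral {s..0} q)"
    using q0 qI by (rule nn_integral_has_integral_lebesgue')
  moreover have "integral {s..0} q \<ge> 0" using q0 by (intro integral_nonneg) (use qI in auto)
  ultimately show ?thesis
    unfolding q_def by (simp add: ennreal_plus[symmetric] ennreal_leI del: ennreal_plus)
qed

text \<open>The expectation of \<open>Y\<close> may still be infinite, so the term with
  \<open>r n\<close> cannot simply be sent to zero. After truncation at \<open>k\<close>, equality
  of laws replaces \<open>U n\<close> by \<open>Y\<close>, dominated convergence removes the term,
  and monotone convergence removes the truncation.\<close>

lemma (in prob_space) nn_integral_le_by_stationarity:
  fixes Y :: "'a \<Rightarrow> real" and U :: "nat \<Rightarrow> 'a \<Rightarrow> real" and Z :: "nat \<Rightarrow> 'a \<Rightarrow> ennreal"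
  assumes Y[measurable]: "Y \<in> borel_measurable M" and U[measurable]: "\<And>n. U n \<in> borel_measurable M"
    and Z[measurable]: "\<And>n. Z n \<in> borel_measurable M"
    and distr: "\<And>n. distr M borel (U n) = distr M borel Y"
    and r: "r \<longlonglongrightarrow> 0"
    and le: "\<And>n \<omega>. ennreal (Y \<omega>) \<le> ennreal (r n * U n \<omega>) + Z n \<omega>"
    and Zc: "\<And>n. (\<integral>\<^sup>+\<omega>. Z n \<omega> \<partial>M) \<le> c"
  shows "(\<integral>\<^sup>+\<omega>. ennreal (Y \<omega>) \<partial>M) \<le> c"
proof -
  have trunc: "(\<integral>\<^sup>+\<omega>. min (ennreal (Y \<omega>)) (ennreal k) \<partial>M) \<le> c" for k
  proof (rule tendsto_lowerbound)
    have "(\<lambda>n. \<integral>\<^sup>+\<omega>. min (ennreal (r n * Y \<omega>)) (ennreal k) \<partial>M) \<longlonglongrightarrow> (\<integral>\<^sup>+\<omega>. min (ennreal (0 * Y \<omega>)) (ennreal k) \<partial>M)"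
    proof (rule nn_integral_dominated_convergence[where w = "\<lambda>_. ennreal k"])
      show "AE \<omega> in M. (\<lambda>n. min (ennreal (r n * Y \<omega>)) (ennreal k)) \<longlonglongrightarrow> min (ennreal (0 * Y \<omega>)) (ennreal k)"
        by (intro AE_I2 tendsto_min tendsto_ennrealI tendsto_mult r tendsto_const)
    qed (auto simp: emeasure_space_1)
    then have "(\<lambda>n. (\<integral>\<^sup>+\<omega>. min (ennreal (r n * Y \<omega>)) (ennreal k) \<partial>M) + c) \<longlonglongrightarrow> 0 + c"
      by (intro tendsto_add tendsto_const) simp
    then show "(\<lambda>n. (\<integral>\<^sup>+\<omega>. min (ennreal (r n * Y \<omega>)) (ennreal k) \<partial>M) + c) \<longlonglongrightarrow> c" by simp
    show "\<forall>\<^sub>F n in sequentially. (\<integral>\<^sup>+\<omega>. min (ennreal (Y \<omega>)) (ennreal k) \<partial>M)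
        \<le> (\<integral>\<^sup>+\<omega>. min (ennreal (r n * Y \<omega>)) (ennreal k) \<partial>M) + c"
    proof (intro always_eventually allI)
      fix n
      \<comment> \<open>Capping the first summand alone is enough: if the cap is reached there, it
        already dominates the left side.\<close>
      have "min (ennreal (Y \<omega>)) (ennreal k) \<le> min (ennreal (r n * U n \<omega>)) (ennreal k) + Z n \<omega>" for \<omega>
        using le[of \<omega> n] unfolding min_def
        by (auto intro: order_trans add_increasing2)
      then have "(\<integral>\<^sup>+\<omega>. min (ennreal (Y \<omega>)) (ennreal k) \<partial>M)
          \<le> (\<integral>\<^sup>+\<omega>. min (ennreal (r n * U n \<omega>)) (ennreal k) + Z n \<omega> \<partial>M)"
        by (rule nn_integral_mono)
      also have "\<dots> = (\<integral>\<^sup>+\<omega>. min (ennreal (r n * U n \<omega>)) (ennreal k) \<partial>M) + (\<integral>\<^sup>+\<omega>. Z n \<omega> \<partial>M)"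
        by (rule nn_integral_add) measurable
      also have "(\<integral>\<^sup>+\<omega>. min (ennreal (r n * U n \<omega>)) (ennreal k) \<partial>M)
          = (\<integral>\<^sup>+u. min (ennreal (r n * u)) (ennreal k) \<partial>distr M borel (U n))"
        by (subst nn_integral_distr) measurable
      also have "\<dots> = (\<integral>\<^sup>+\<omega>. min (ennreal (r n * Y \<omega>)) (ennreal k) \<partial>M)"
        unfolding distr by (subst nn_integral_distr) measurable
      also have "\<dots> + (\<integral>\<^sup>+\<omega>. Z n \<omega> \<partial>M) \<le> \<dots> + c" using Zc by (rule add_left_mono)
      finally show "(\<integral>\<^sup>+\<omega>. min (ennreal (Y \<omega>)) (ennreal k) \<partial>M)
        \<le> (\<integral>\<^sup>+\<omega>. min (ennreal (r n * Y \<omega>)) (ennreal k) \<partial>M) + c" .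
    qed
  qed simp
  have "(\<lambda>k. \<integral>\<^sup>+\<omega>. min (ennreal (Y \<omega>)) (ennreal (real k)) \<partial>M) \<longlonglongrightarrow> (\<integral>\<^sup>+\<omega>. ennreal (Y \<omega>) \<partial>M)"
  proof (rule nn_integral_LIMSEQ)
    show "incseq (\<lambda>k \<omega>. min (ennreal (Y \<omega>)) (ennreal (real k)))"
      by (auto simp: incseq_def le_fun_def min.coboundedI2 ennreal_leI)
    fix \<omega>
    have "\<forall>\<^sub>F k in sequentially. min (ennreal (Y \<omega>)) (ennreal (real k)) = ennreal (Y \<omega>)"
      using eventually_ge_at_top[of "nat \<lceil>Y \<omega>\<rceil>"]
      by eventually_elim (auto simp: min_def not_le intro!: antisym ennreal_leI; linarith)
    then show "(\<lambda>k. min (ennreal (Y \<omega>)) (ennreal (real k))) \<longlonglongrightarrow> ennreal (Y \<omega>)"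
      by (rule tendsto_eventually)
  qed measurable
  then show ?thesis by (rule LIMSEQ_le_const2) (use trunc in auto)
qed

text \<open>With damping rate \<open>2 k\<close> the forcing may grow like
  \<open>exp (- k t)\<close> into the past, which covers the linearly growing variance of
  \<open>W\<close>. The bound is the integral of \<open>D / (2 k) * exp (k t)\<close> over all
  \<open>t \<le> 0\<close>, hence independent of \<open>s\<close>.\<close>

lemma (in prob_space) expected_energy_le:
  fixes g :: "real \<Rightarrow> 'a \<Rightarrow> 'b::euclidean_space"
  assumes meas: "\<And>t. g t \<in> borel_measurable M" and cont: "\<And>\<omega>. continuous_on UNIV (\<lambda>t. g t \<omega>)"
    and k: "k > 0" and D: "D \<ge> 0" "\<And>t. t \<le> 0 \<Longrightarrow> (\<integral>\<^sup>+\<omega>. ennreal ((norm (g t \<omega>))\<^sup>2) \<partial>M) \<le> ennreal (D * exp (- k * t))"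
  shows "(\<lambda>\<omega>. \<integral>\<^sup>+t. ennreal (exp (2 * k * t) * (norm (g t \<omega>))\<^sup>2 / (2 * k)) * indicator {s..0} t \<partial>lborel) \<in> borel_measurable M" (is ?meas)
    and "(\<integral>\<^sup>+\<omega>. (\<integral>\<^sup>+t. ennreal (exp (2 * k * t) * (norm (g t \<omega>))\<^sup>2 / (2 * k)) * indicator {s..0} t \<partial>lborel) \<partial>M) \<le> ennreal (D / (2 * k\<^sup>2))" (is ?le)
proof -
  have [measurable]: "(\<lambda>(t, \<omega>). g t \<omega>) \<in> borel_measurable (borel \<Otimes>\<^sub>M M)"
    using meas cont by (rule measurable_continuous_paths)
  note [measurable] = meas
  interpret P: pair_sigma_finite lborel M by unfold_locales
  define F where "F t \<omega> = ennreal (exp (2 * k * t) * (norm (g t \<omega>))\<^sup>2 / (2 * k)) * indicator {s..0} t" for t \<omega>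
  have F[measurable]: "case_prod F \<in> borel_measurable (lborel \<Otimes>\<^sub>M M)"
    unfolding F_def by measurable
  have "(\<lambda>(\<omega>, t). F t \<omega>) \<in> borel_measurable (M \<Otimes>\<^sub>M lborel)"
    using measurable_compose[OF measurable_pair_swap' F] by (simp add: case_prod_beta')
  from lborel.borel_measurable_nn_integral[OF this] show ?meas by (simp add: F_def)
  have "(\<integral>\<^sup>+\<omega>. (\<integral>\<^sup>+t. F t \<omega> \<partial>lborel) \<partial>M) = (\<integral>\<^sup>+t. (\<integral>\<^sup>+\<omega>. F t \<omega> \<partial>M) \<partial>lborel)"
    by (rule P.Fubini'[OF F])
  also have "\<dots> \<le> (\<integral>\<^sup>+t. ennreal (D / (2 * k) * exp (k * t)) * indicator {s..0} t \<partial>lborel)"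
  proof (rule nn_integral_mono)
    fix t
    show "(\<integral>\<^sup>+\<omega>. F t \<omega> \<partial>M) \<le> ennreal (D / (2 * k) * exp (k * t)) * indicator {s..0} t"
    proof (cases "t \<in> {s..0}")
      case True
      have "(\<integral>\<^sup>+\<omega>. F t \<omega> \<partial>M) = (\<integral>\<^sup>+\<omega>. ennreal (exp (2 * k * t) / (2 * k)) * ennreal ((norm (g t \<omega>))\<^sup>2) \<partial>M)"
        using True k by (intro nn_integral_cong) (simp add: F_def ennreal_mult[symmetric])
      also have "\<dots> = ennreal (exp (2 * k * t) / (2 * k)) * (\<integral>\<^sup>+\<omega>. ennreal ((norm (g t \<omega>))\<^sup>2) \<partial>M)"
        by (rule nn_integral_cmult) measurable
      also have "\<dots> \<le> ennreal (exp (2 * k * t) / (2 * k)) * ennreal (D * exp (- k * t))"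
        using D(2)[of t] True by (intro mult_left_mono) auto
      also have "\<dots> = ennreal (D / (2 * k) * (exp (2 * k * t) * exp (- k * t)))"
        using k D(1) by (simp add: ennreal_mult[symmetric] mult_ac)
      also have "exp (2 * k * t) * exp (- k * t) = exp (k * t)"
        by (simp add: exp_add[symmetric])
      finally show ?thesis using True by simp
    qed (simp add: F_def)
  qed
  also have "\<dots> \<le> ennreal (D / (2 * k\<^sup>2))"
  proof (cases "s \<le> 0")
    case True
    have "((\<lambda>t. D / (2 * k) * exp (k * t)) has_integral (D / (2 * k\<^sup>2) * exp (k * 0) - D / (2 * k\<^sup>2) * exp (k * s))) {s..0}"
      using True k
      by (intro fundamental_theorem_of_calculus)
        (auto intro!: derivative_eq_intros simp: has_real_derivative_iff_has_vector_derivative[symmetric] field_simps power2_eq_square)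
    then have "(\<integral>\<^sup>+t. ennreal (D / (2 * k) * exp (k * t)) * indicator {s..0} t \<partial>lborel) = ennreal (D / (2 * k\<^sup>2) * exp (k * 0) - D / (2 * k\<^sup>2) * exp (k * s))"
      using k D(1) by (intro nn_integral_has_integral_lebesgue') auto
    also have "\<dots> \<le> ennreal (D / (2 * k\<^sup>2))"
      using k D(1) by (intro ennreal_leI) simp
    finally show ?thesis .
  qed simp
  finally show ?le by (simp add: F_def)
qed

section \<open>Linear differential equations\<close>

lemma exp_ode_scaleR:
  fixes u :: "real \<Rightarrow> 'b::real_normed_vector"
  assumes "convex S" "\<And>t. t \<in> S \<Longrightarrow> (u has_vector_derivative l *\<^sub>R u t) (at t)" "a \<in> S" "b \<in> S"
  shows "u b = exp (l * (b - a)) *\<^sub>R u a"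
proof -
  have "((\<lambda>t. exp (- l * t) *\<^sub>R u t) has_vector_derivative 0) (at t within S)" if "t \<in> S" for t
    by (rule has_vector_derivative_at_within)
      (auto intro!: derivative_eq_intros assms(2) that simp: algebra_simps)
  from has_vector_derivative_zero_constant[OF assms(1) this]
  have "exp (- l * b) *\<^sub>R u b = exp (- l * a) *\<^sub>R u a" using assms(3,4) by metis
  then have "exp (l * b) *\<^sub>R exp (- l * b) *\<^sub>R u b = exp (l * b) *\<^sub>R exp (- l * a) *\<^sub>R u a" by simp
  then show ?thesis by (simp add: exp_add[symmetric] algebra_simps)
qed

lemma exp_ode_complex:
  fixes u :: "real \<Rightarrow> complex"
  assumes "convex S" "\<And>t. t \<in> S \<Longrightarrow> (u has_vector_derivative l * u t) (at t)" "a \<in> S" "b \<in> S"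
  shows "norm (u b) = exp (Re l * (b - a)) * norm (u a)"
proof -
  have "((\<lambda>t. exp (- l * of_real t) * u t) has_vector_derivative 0) (at t within S)" if "t \<in> S" for t
  proof (rule has_vector_derivative_at_within)
    have "((\<lambda>t. exp (- l * of_real t)) has_vector_derivative - l * exp (- l * of_real t)) (at t)"
      by (rule has_vector_derivative_real_field) (auto intro!: derivative_eq_intros)
    from has_vector_derivative_mult[OF this assms(2)[OF that]]
    show "((\<lambda>t. exp (- l * of_real t) * u t) has_vector_derivative 0) (at t)" by (simp add: algebra_simps)
  qed
  from has_vector_derivative_zero_constant[OF assms(1) this]
  have "exp (- l * b) * u b = exp (- l * a) * u a" using assms(3,4) by metis
  then have "norm (exp (- l * b) * u b) = norm (exp (- l * a) * u a)" by simp
  then have "exp (- Re l * b) * norm (u b) = exp (- Re l * a) * norm (u a)"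
    by (simp add: norm_mult norm_exp_eq_Re)
  then have "exp (Re l * b) * exp (- Re l * b) * norm (u b) = exp (Re l * b) * exp (- Re l * a) * norm (u a)" by simp
  then show ?thesis by (simp add: exp_add[symmetric] algebra_simps)
qed

text \<open>Stability forward in time means that a solution bounded on the whole past vanishes; the
  comparison point \<open>r - n\<close> recedes while the bound \<open>b\<close> stays.\<close>

lemma zero_if_exp_bound:
  fixes v :: "'b::real_normed_vector"
  assumes "l < 0" "\<And>s. s \<le> r \<Longrightarrow> norm v \<le> exp (l * (r - s)) * b"
  shows "v = 0"
proof -
  have "(\<lambda>n. exp (l * real n) * b) \<longlonglongrightarrow> 0"
    using assms(1) by real_asymp
  moreover have "norm v \<le> exp (l * real n) * b" for n
    using assms(2)[of "r - real n"] by simp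
  ultimately have "norm v \<le> 0" by (intro LIMSEQ_le_const) auto
  then show ?thesis by simp
qed

text \<open>First half of a bootstrap: indefinite integrals are continuous, so an integral equation
  makes \<open>F\<close> continuous. In the applications the integrand is then continuous as well,
  and the next lemma turns the integral equation into a derivative.\<close>

lemma continuous_if_has_integral_increments:
  fixes F :: "real \<Rightarrow> 'b::banach"
  assumes "\<And>a b. a \<le> b \<Longrightarrow> (f has_integral F b - F a) {a..b}"
  shows "continuous_on UNIV F"
proof (intro continuous_at_imp_continuous_on ballI)
  fix t :: real
  have "f integrable_on {t - 1..t + 1}" using assms[of "t - 1" "t + 1"] by auto
  then have "continuous_on {t - 1..t + 1} (\<lambda>s. F (t - 1) + integral {t - 1..s} f)"
    by (intro continuous_intros indefinite_integral_continuous_1)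
  moreover have "F (t - 1) + integral {t - 1..s} f = F s" if "s \<in> {t - 1..t + 1}" for s
    using integral_unique[OF assms[of "t - 1" s]] that by simp
  ultimately have "continuous_on {t - 1..t + 1} F" by (rule continuous_on_eq)
  then show "isCont F t" by (rule continuous_on_interior) (simp add: interior_atLeastAtMost_real)
qed

lemma has_vector_derivative_if_has_integral_increments:
  fixes F :: "real \<Rightarrow> 'b::banach"
  assumes F: "\<And>a b. a \<le> b \<Longrightarrow> (f has_integral F b - F a) {a..b}" and f: "continuous_on UNIV f"
  shows "(F has_vector_derivative f t) (at t)"
proof -
  have "((\<lambda>s. integral {t - 1..s} f) has_vector_derivative f t) (at t within {t - 1..t + 1})"
    by (rule integral_has_vector_derivative) (auto intro: continuous_on_subset[OF f])
  then have "((\<lambda>s. F (t - 1) + integral {t - 1..s} f) has_vector_derivative f t) (at t within {t - 1..t + 1})"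
    by (auto intro!: derivative_eq_intros)
  moreover have "F (t - 1) + integral {t - 1..s} f = F s" if "s \<in> {t - 1..t + 1}" for s
    using integral_unique[OF F[of "t - 1" s]] that by simp
  ultimately have "(F has_vector_derivative f t) (at t within {t - 1..t + 1})"
    by (subst has_vector_derivative_transform[where f = "\<lambda>s. F (t - 1) + integral {t - 1..s} f"]) auto
  then show ?thesis by (simp add: at_within_Icc_at)
qed

text \<open>Bilinear, without conjugation, so that a matrix moves to the other side as
  \<open>c v* A\<close> and the pairing is complex linear in \<open>c\<close>.\<close>

definition complex_dot :: "complex^'n \<Rightarrow> real^'n \<Rightarrow> complex" where
  "complex_dot c v = (\<Sum>i\<in>UNIV. c $ i * complex_of_real (v $ i))"

lemma bounded_linear_complex_dot: "bounded_linear (complex_dot c)"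
proof -
  have "linear (complex_dot c)"
    by (rule linearI) (simp_all add: complex_dot_def distrib_left sum.distrib scaleR_conv_of_real[where 'a = complex]
          sum_distrib_left mult_ac)
  then show ?thesis by (simp add: linear_conv_bounded_linear)
qed

lemma complex_dot_matrix: "complex_dot c (A *v v) = complex_dot (c v* map_matrix complex_of_real A) v"
proof -
  have "complex_dot c (A *v v) = (\<Sum>i\<in>UNIV. \<Sum>j\<in>UNIV. c $ i * (of_real (A $ i $ j) * of_real (v $ j)))"
    by (simp add: complex_dot_def matrix_vector_mult_def sum_distrib_left)
  also have "\<dots> = (\<Sum>j\<in>UNIV. \<Sum>i\<in>UNIV. c $ i * (of_real (A $ i $ j) * of_real (v $ j)))"
    by (rule sum.swap)
  also have "\<dots> = complex_dot (c v* map_matrix complex_of_real A) v"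
    by (simp add: complex_dot_def vector_matrix_mult_def sum_distrib_left sum_distrib_right mult_ac)
  finally show ?thesis .
qed

lemma complex_dot_diff: "complex_dot (c - d) v = complex_dot c v - complex_dot d v"
  by (simp add: complex_dot_def left_diff_distrib sum_subtractf)

lemma complex_dot_smult: "complex_dot (l *s c) v = l * complex_dot c v"
  by (simp add: complex_dot_def sum_distrib_left mult_ac)

lemma complex_dot_zero: "complex_dot 0 v = 0"
  by (simp add: complex_dot_def)

lemma complex_dot_axis: "complex_dot (axis i 1) v = complex_of_real (v $ i)"
  by (simp add: complex_dot_def axis_def if_distrib[of "\<lambda>x. x * _"] cong: if_cong)

section \<open>Second moments of the stationary solution\<close>

lemma power2_sum_le: "((x::real) + y)\<^sup>2 \<le> 2 * x\<^sup>2 + 2 * y\<^sup>2"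
  using young_ineq[of x y] by (simp add: power2_sum)

text \<open>The process in the form in which its moments are computed: path statements hold for
  every \<open>\<omega>\<close>, Brownian motion enters through its covariances, stationarity
  through pairs of times. The combination \<open>\<eta> - W / \<tau>\<close> is differentiable, and
  its equation involves no derivative of \<open>W\<close>.\<close>

locale colored_noise_model = prob_space M for M :: "'w measure" +
  fixes \<tau> :: real and A R :: "real^'n^'n" and W x \<eta> :: "real \<Rightarrow> 'w \<Rightarrow> real^'n"
  assumes \<tau>: "\<tau> > 0" and A: "hurwitz A"
    and x_meas[measurable]: "\<And>t. x t \<in> borel_measurable M"
    and \<eta>_meas[measurable]: "\<And>t. \<eta> t \<in> borel_measurable M"
    and W_L2: "\<And>t. square_integrable M (W t)"
    and W_cont: "\<And>\<omega>. continuous_on UNIV (\<lambda>t. W t \<omega>)"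
    and W_0: "\<And>\<omega>. W 0 \<omega> = 0"
    and W_orthogonal: "\<And>s t u v i j. s \<le> t \<Longrightarrow> t \<le> u \<Longrightarrow> u \<le> v \<Longrightarrow>
      expectation (\<lambda>\<omega>. (W t \<omega> - W s \<omega>) $ i * (W v \<omega> - W u \<omega>) $ j) = 0"
    and W_cov: "\<And>s t i j. s \<le> t \<Longrightarrow>
      expectation (\<lambda>\<omega>. (W t \<omega> - W s \<omega>) $ i * (W t \<omega> - W s \<omega>) $ j) = (if i = j then t - s else 0)"
    and x_deriv: "\<And>\<omega> t. ((\<lambda>t. x t \<omega>) has_vector_derivative (A *v x t \<omega> + R *v \<eta> t \<omega>)) (at t)"
    and \<eta>_deriv: "\<And>\<omega> t. ((\<lambda>t. \<eta> t \<omega> - (1 / \<tau>) *\<^sub>R W t \<omega>) has_vector_derivative (- (1 / \<tau>) *\<^sub>R \<eta> t \<omega>)) (at t)"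
    and stationary: "\<And>h s t. distr M borel (\<lambda>\<omega>. ((x (s + h) \<omega>, \<eta> (s + h) \<omega>), (x (t + h) \<omega>, \<eta> (t + h) \<omega>)))
      = distr M borel (\<lambda>\<omega>. ((x s \<omega>, \<eta> s \<omega>), (x t \<omega>, \<eta> t \<omega>)))"
begin

lemma W_meas[measurable]: "W t \<in> borel_measurable M"
  using W_L2 by (rule square_integrable_measurable)

lemma \<eta>_cont: "continuous_on UNIV (\<lambda>t. \<eta> t \<omega>)"
proof -
  have "continuous_on UNIV (\<lambda>t. \<eta> t \<omega> - (1 / \<tau>) *\<^sub>R W t \<omega>)"
    using \<eta>_deriv by (intro continuous_at_imp_continuous_on ballI) (rule has_vector_derivative_continuous)
  from continuous_on_add[OF this continuous_on_scaleR[OF continuous_on_const W_cont[of \<omega>], of "1 / \<tau>"]]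
  show ?thesis by simp
qed

lemma x_cont: "continuous_on UNIV (\<lambda>t. x t \<omega>)"
  using x_deriv by (intro continuous_at_imp_continuous_on ballI) (rule has_vector_derivative_continuous)

lemma stationary_distr:
  assumes [measurable]: "F \<in> borel_measurable (borel :: ((real^'n) \<times> (real^'n)) measure)"
  shows "distr M borel (\<lambda>\<omega>. F (x s \<omega>, \<eta> s \<omega>)) = distr M borel (\<lambda>\<omega>. F (x 0 \<omega>, \<eta> 0 \<omega>))"
proof -
  have [measurable]: "(\<lambda>\<omega>. ((x s \<omega>, \<eta> s \<omega>), (x t \<omega>, \<eta> t \<omega>))) \<in> borel_measurable M" for s t
    by (simp add: borel_prod[symmetric])
  have [measurable]: "(\<lambda>p :: ((real^'n) \<times> (real^'n)) \<times> ((real^'n) \<times> (real^'n)). F (fst p)) \<in> borel_measurable borel"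
    unfolding borel_prod[symmetric, where 'a = "(real^'n) \<times> (real^'n)" and 'b = "(real^'n) \<times> (real^'n)"] by measurable
  from arg_cong[OF stationary[of 0 s 0], of "\<lambda>N. distr N borel (\<lambda>p. F (fst p))"] show ?thesis
    by (simp add: distr_distr o_def)
qed

lemma stationary_expectation:
  fixes F :: "((real^'n) \<times> (real^'n)) \<Rightarrow> ((real^'n) \<times> (real^'n)) \<Rightarrow> 'b::euclidean_space"
  assumes [measurable]: "case_prod F \<in> borel_measurable (borel \<Otimes>\<^sub>M borel)"
  shows "expectation (\<lambda>\<omega>. F (x (s + h) \<omega>, \<eta> (s + h) \<omega>) (x (t + h) \<omega>, \<eta> (t + h) \<omega>))
    = expectation (\<lambda>\<omega>. F (x s \<omega>, \<eta> s \<omega>) (x t \<omega>, \<eta> t \<omega>))"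
proof -
  have [measurable]: "(\<lambda>\<omega>. ((x s \<omega>, \<eta> s \<omega>), (x t \<omega>, \<eta> t \<omega>))) \<in> borel_measurable M" for s t
    by (simp add: borel_prod[symmetric])
  have [measurable]: "case_prod F \<in> borel_measurable (borel :: (((real^'n) \<times> (real^'n)) \<times> ((real^'n) \<times> (real^'n))) measure)"
    using assms unfolding borel_prod[where 'a = "(real^'n) \<times> (real^'n)" and 'b = "(real^'n) \<times> (real^'n)"] .
  from arg_cong[OF stationary[of s h t], of "\<lambda>N. integral\<^sup>L N (case_prod F)"] show ?thesis
    by (simp add: integral_distr)
qed

lemma nn_integral_stationary:
  assumes [measurable]: "F \<in> borel_measurable (borel :: ((real^'n) \<times> (real^'n)) measure)"
  shows "(\<integral>\<^sup>+\<omega>. ennreal (F (x s \<omega>, \<eta> s \<omega>)) \<partial>M) = (\<integral>\<^sup>+\<omega>. ennreal (F (x 0 \<omega>, \<eta> 0 \<omega>)) \<partial>M)"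
proof -
  have [measurable]: "(\<lambda>\<omega>. (x s \<omega>, \<eta> s \<omega>)) \<in> borel_measurable M" for s
    by (simp add: borel_prod[symmetric])
  from arg_cong[OF stationary_distr[OF assms, of s], of "\<lambda>N. \<integral>\<^sup>+u. ennreal u \<partial>N"] show ?thesis
    by (simp add: nn_integral_distr)
qed

lemma expectation_W_sq:
  assumes "t \<le> 0"
  shows "(\<integral>\<^sup>+\<omega>. ennreal ((norm (W t \<omega>))\<^sup>2) \<partial>M) = ennreal (real CARD('n) * (- t))"
proof -
  have "(norm (W t \<omega>))\<^sup>2 = (\<Sum>i\<in>UNIV. (W t \<omega> $ i)\<^sup>2)" for \<omega>
    by (simp add: norm_vec_def L2_set_def sum_nonneg)
  moreover have "expectation (\<lambda>\<omega>. (W t \<omega> $ i)\<^sup>2) = - t" for i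
    using W_cov[OF assms, of i i] by (simp add: W_0 power2_eq_square)
  moreover have "integrable M (\<lambda>\<omega>. (W t \<omega> $ i)\<^sup>2)" for i
    using square_integrable_nth[OF W_L2, of t i] by (simp add: square_integrable_def)
  ultimately have "expectation (\<lambda>\<omega>. (norm (W t \<omega>))\<^sup>2) = CARD('n) * (- t)" by simp
  moreover have "integrable M (\<lambda>\<omega>. (norm (W t \<omega>))\<^sup>2)"
    using W_L2 by (simp add: square_integrable_def)
  ultimately show ?thesis by (simp add: nn_integral_eq_integral)
qed

text \<open>The energy estimate applies to \<open>y = \<eta> - W / \<tau>\<close>, which solves
  \<open>y' = - y / \<tau> - W / \<tau>\<^sup>2\<close> and agrees with \<open>\<eta>\<close> at
  time \<open>0\<close>. Stationarity is available for \<open>\<eta>\<close> rather than for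
  \<open>y\<close>, hence the term \<open>Z2\<close> that pays for the conversion at the remote
  time.\<close>

lemma \<eta>_L2_0: "square_integrable M (\<eta> 0)"
proof -
  define N where "N = real CARD('n)"
  define k where "k = 1 / (2 * \<tau>)"
  have k: "k > 0" "2 * k = 1 / \<tau>" using \<tau> by (simp_all add: k_def)
  define g where "g t \<omega> = (1 / \<tau>\<^sup>2) *\<^sub>R W t \<omega>" for t \<omega>
  \<comment> \<open>Comes from \<open>- t \<le> exp (- k * t) / k\<close> and the second moment
    \<open>N * (- t)\<close> of \<open>W t\<close>; the power of \<open>\<tau>\<close> is the square
    of the factor in \<open>g\<close>.\<close>
  define D where "D = N / (\<tau> ^ 4 * k)"
  have gD: "(\<integral>\<^sup>+\<omega>. ennreal ((norm (g t \<omega>))\<^sup>2) \<partial>M) \<le> ennreal (D * exp (- k * t))" if "t \<le> 0" for t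
  proof -
    have "(\<integral>\<^sup>+\<omega>. ennreal ((norm (g t \<omega>))\<^sup>2) \<partial>M) = (\<integral>\<^sup>+\<omega>. ennreal (1 / \<tau> ^ 4) * ennreal ((norm (W t \<omega>))\<^sup>2) \<partial>M)"
      by (intro nn_integral_cong) (simp add: g_def power_divide ennreal_mult[symmetric])
    also have "\<dots> = ennreal (1 / \<tau> ^ 4) * ennreal (N * (- t))"
      using expectation_W_sq[OF that] by (simp add: nn_integral_cmult N_def)
    also have "\<dots> = ennreal (N / \<tau> ^ 4 * (- t))"
      using that by (subst ennreal_mult[symmetric]) (simp_all add: N_def mult_nonneg_nonpos)
    also have "\<dots> \<le> ennreal (D * exp (- k * t))"
    proof (rule ennreal_leI)
      have "- t \<le> exp (- k * t) / k" using exp_ge_add_one_self[of "- k * t"] k(1) by (simp add: field_simps)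
      then have "N / \<tau> ^ 4 * (- t) \<le> N / \<tau> ^ 4 * (exp (- k * t) / k)"
        by (intro mult_left_mono) (simp_all add: N_def)
      then show "N / \<tau> ^ 4 * (- t) \<le> D * exp (- k * t)" by (simp add: D_def)
    qed
    finally show ?thesis .
  qed
  have g: "\<And>t. g t \<in> borel_measurable M" "\<And>\<omega>. continuous_on UNIV (\<lambda>t. g t \<omega>)"
    unfolding g_def by (measurable, intro continuous_intros W_cont)
  have "D \<ge> 0" using k by (simp add: D_def N_def)
  note E = expected_energy_le[OF g k(1) \<open>D \<ge> 0\<close> gD]
  define Z1 where "Z1 n \<omega> = (\<integral>\<^sup>+t. ennreal (exp (2 * k * t) * (norm (g t \<omega>))\<^sup>2 / (2 * k)) * indicator {- real n..0} t \<partial>lborel)"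
    for n :: nat and \<omega>
  define Z2 where "Z2 n \<omega> = ennreal (2 / \<tau>\<^sup>2 * exp (2 * k * - real n)) * ennreal ((norm (W (- real n) \<omega>))\<^sup>2)"
    for n :: nat and \<omega>
  have [measurable]: "Z1 n \<in> borel_measurable M" for n unfolding Z1_def[abs_def] by (rule E(1))
  have [measurable]: "Z2 n \<in> borel_measurable M" for n unfolding Z2_def[abs_def] by measurable
  have "(\<integral>\<^sup>+\<omega>. ennreal ((norm (\<eta> 0 \<omega>))\<^sup>2) \<partial>M) \<le> ennreal (D / (2 * k\<^sup>2)) + ennreal (2 / \<tau>\<^sup>2 * (N * \<tau>))"
  proof (rule nn_integral_le_by_stationarity)
    show "distr M borel (\<lambda>\<omega>. (norm (\<eta> (- real n) \<omega>))\<^sup>2) = distr M borel (\<lambda>\<omega>. (norm (\<eta> 0 \<omega>))\<^sup>2)" for n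
      using stationary_distr[of "\<lambda>p. (norm (snd p))\<^sup>2" "- real n"] by (simp add: borel_prod[symmetric])
    show "(\<lambda>n. 2 * exp (2 * k * - real n)) \<longlonglongrightarrow> 0" using k(1) by real_asymp
    show "(\<lambda>\<omega>. Z1 n \<omega> + Z2 n \<omega>) \<in> borel_measurable M" for n by measurable
    show "ennreal ((norm (\<eta> 0 \<omega>))\<^sup>2) \<le> ennreal (2 * exp (2 * k * - real n) * (norm (\<eta> (- real n) \<omega>))\<^sup>2) + (Z1 n \<omega> + Z2 n \<omega>)" for n \<omega>
    proof -
      let ?y = "\<lambda>t. \<eta> t \<omega> - (1 / \<tau>) *\<^sub>R W t \<omega>"
      let ?s = "- real n"
      have "?y t \<bullet> (- (1 / \<tau>) *\<^sub>R \<eta> t \<omega>) \<le> - (2 * k) * (norm (?y t))\<^sup>2 + norm (?y t) * norm (g t \<omega>)" for t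
      proof -
        have "?y t \<bullet> (- (1 / \<tau>) *\<^sub>R \<eta> t \<omega>) = ?y t \<bullet> (- (2 * k) *\<^sub>R ?y t - g t \<omega>)"
          unfolding g_def k(2) by (simp add: algebra_simps power2_eq_square)
        also have "\<dots> = - (2 * k) * (norm (?y t))\<^sup>2 - ?y t \<bullet> g t \<omega>"
          by (simp only: inner_diff_right inner_scaleR_right power2_norm_eq_inner)
        also have "\<dots> \<le> - (2 * k) * (norm (?y t))\<^sup>2 + norm (?y t) * norm (g t \<omega>)"
          using Cauchy_Schwarz_ineq2[of "?y t" "g t \<omega>"] by linarith
        finally show ?thesis .
      qed
      from energy_estimate[OF _ _ \<eta>_deriv this g(2), of ?s] k(1)
      have "ennreal ((norm (\<eta> 0 \<omega>))\<^sup>2) \<le> ennreal (exp (2 * k * ?s) * (norm (?y ?s))\<^sup>2) + Z1 n \<omega>"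
        by (simp add: W_0 Z1_def)
      also have "ennreal (exp (2 * k * ?s) * (norm (?y ?s))\<^sup>2)
          \<le> ennreal (2 * exp (2 * k * ?s) * (norm (\<eta> ?s \<omega>))\<^sup>2) + Z2 n \<omega>"
      proof -
        have "(norm (?y ?s))\<^sup>2 \<le> (norm (\<eta> ?s \<omega>) + norm ((1 / \<tau>) *\<^sub>R W ?s \<omega>))\<^sup>2"
          by (intro power_mono norm_triangle_ineq4 norm_ge_zero)
        also have "\<dots> \<le> 2 * (norm (\<eta> ?s \<omega>))\<^sup>2 + 2 * (norm ((1 / \<tau>) *\<^sub>R W ?s \<omega>))\<^sup>2"
          by (rule power2_sum_le)
        also have "\<dots> = 2 * (norm (\<eta> ?s \<omega>))\<^sup>2 + 2 / \<tau>\<^sup>2 * (norm (W ?s \<omega>))\<^sup>2"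
          by (simp add: power_divide)
        finally have "exp (2 * k * ?s) * (norm (?y ?s))\<^sup>2
          \<le> exp (2 * k * ?s) * (2 * (norm (\<eta> ?s \<omega>))\<^sup>2 + 2 / \<tau>\<^sup>2 * (norm (W ?s \<omega>))\<^sup>2)"
          by (intro mult_left_mono) auto
        also have "\<dots> = 2 * exp (2 * k * ?s) * (norm (\<eta> ?s \<omega>))\<^sup>2 + 2 / \<tau>\<^sup>2 * exp (2 * k * ?s) * (norm (W ?s \<omega>))\<^sup>2"
          by (simp add: algebra_simps)
        finally show ?thesis
          unfolding Z2_def by (simp add: ennreal_plus[symmetric] ennreal_mult[symmetric] ennreal_leI del: ennreal_plus)
      qed
      finally show ?thesis by (simp add: add_ac add_mono)
    qed
    show "(\<integral>\<^sup>+\<omega>. Z1 n \<omega> + Z2 n \<omega> \<partial>M) \<le> ennreal (D / (2 * k\<^sup>2)) + ennreal (2 / \<tau>\<^sup>2 * (N * \<tau>))" for n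
    proof -
      have "(\<integral>\<^sup>+\<omega>. Z2 n \<omega> \<partial>M) = ennreal (2 / \<tau>\<^sup>2 * exp (2 * k * - real n)) * ennreal (N * real n)"
        unfolding Z2_def using expectation_W_sq[of "- real n"] by (simp add: nn_integral_cmult N_def)
      also have "\<dots> = ennreal (2 / \<tau>\<^sup>2 * (N * (exp (2 * k * - real n) * real n)))"
        by (simp add: ennreal_mult[symmetric] N_def mult_ac)
      also have "\<dots> \<le> ennreal (2 / \<tau>\<^sup>2 * (N * \<tau>))"
      proof (intro ennreal_leI mult_left_mono)
        \<comment> \<open>The inequality \<open>u \<le> exp u\<close> at
          \<open>u = n / \<tau>\<close> bounds the variance of \<open>W (- n)\<close> against the
          exponential weight, uniformly in \<open>n\<close>.\<close>
        have "real n / \<tau> \<le> exp (real n / \<tau>)" using exp_ge_add_one_self[of "real n / \<tau>"] by linarith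
        then have "exp (- (real n / \<tau>)) * (real n / \<tau>) \<le> exp (- (real n / \<tau>)) * exp (real n / \<tau>)"
          by (intro mult_left_mono) auto
        then have "exp (- (real n / \<tau>)) * real n \<le> \<tau>" using \<tau> by (simp add: exp_add[symmetric] field_simps)
        then show "exp (2 * k * - real n) * real n \<le> \<tau>" unfolding k(2) by simp
      qed (simp_all add: N_def)
      finally show ?thesis
        using E(2)[of "- real n"] unfolding Z1_def[symmetric] by (subst nn_integral_add) (auto intro: add_mono)
    qed
  qed measurable
  also have "\<dots> < \<infinity>" by simp
  finally show ?thesis by (simp add: square_integrable_iff_nn_integral)
qed

lemma \<eta>_L2: "square_integrable M (\<eta> t)"
  using \<eta>_L2_0 nn_integral_stationary[of "\<lambda>p. (norm (snd p))\<^sup>2" t]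
  by (simp add: square_integrable_iff_nn_integral borel_prod[symmetric])

text \<open>In the induction step the pairing with \<open>c\<close> solves
  \<open>z' = l z + g\<close>, where \<open>g\<close> combines the pairing with \<open>d\<close>,
  square integrable by hypothesis, and a linear image of \<open>\<eta>\<close>. By stationarity the
  second moment of \<open>g\<close> is constant, so the energy bound does not depend on the starting
  time.\<close>

lemma complex_dot_x_L2: "square_integrable M (\<lambda>\<omega>. complex_dot c (x 0 \<omega>))"
proof (rule hurwitz_induct[OF A, of "\<lambda>c. square_integrable M (\<lambda>\<omega>. complex_dot c (x 0 \<omega>))"])
  show "square_integrable M (\<lambda>\<omega>. complex_dot 0 (x 0 \<omega>))"
    by (simp add: complex_dot_zero square_integrable_def)
next
  fix l :: complex and c
  define d where "d = c v* map_matrix complex_of_real A - l *s c"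
  assume l: "Re l < 0" and "square_integrable M (\<lambda>\<omega>. complex_dot d (x 0 \<omega>))"
  have [measurable]: "complex_dot c \<in> borel_measurable borel" for c :: "complex^'n"
    by (intro borel_measurable_continuous_onI linear_continuous_on bounded_linear_complex_dot)
  have R[measurable]: "(*v) R \<in> borel_measurable borel"
    by (intro borel_measurable_continuous_onI linear_continuous_on matrix_vector_mul_bounded_linear)
  \<comment> \<open>Thus \<open>2 * k = - Re l\<close>, the damping rate of the modulus: the real
    inner product of \<open>z\<close> and \<open>l * z\<close> is \<open>Re l\<close> times the
    squared modulus.\<close>
  define k where "k = - Re l / 2"
  have k: "k > 0" using l by (simp add: k_def)
  define G where "G p = complex_dot d (fst p) + complex_dot c (R *v snd p)" for p :: "(real^'n) \<times> (real^'n)"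
  have [measurable]: "G \<in> borel_measurable borel"
    unfolding G_def[abs_def] borel_prod[symmetric] by measurable
  define g where "g t \<omega> = G (x t \<omega>, \<eta> t \<omega>)" for t \<omega>
  have g: "\<And>t. g t \<in> borel_measurable M" "\<And>\<omega>. continuous_on UNIV (\<lambda>t. g t \<omega>)"
    unfolding g_def G_def fst_conv snd_conv
    by (measurable, intro continuous_intros x_cont \<eta>_cont
        bounded_linear.continuous_on[OF bounded_linear_complex_dot]
        bounded_linear.continuous_on[OF matrix_vector_mul_bounded_linear])
  have "square_integrable M (g 0)"
    unfolding g_def[abs_def] G_def fst_conv snd_conv
    by (intro square_integrable_add \<open>square_integrable M (\<lambda>\<omega>. complex_dot d (x 0 \<omega>))\<close>
        square_integrable_bounded_linear[OF _ bounded_linear_complex_dot]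
        square_integrable_bounded_linear[OF _ matrix_vector_mul_bounded_linear] \<eta>_L2)
  define D where "D = expectation (\<lambda>\<omega>. (norm (g 0 \<omega>))\<^sup>2)"
  have "D \<ge> 0" by (simp add: D_def)
  have "(\<integral>\<^sup>+\<omega>. ennreal ((norm (g t \<omega>))\<^sup>2) \<partial>M) = ennreal D" for t
  proof -
    have "(\<integral>\<^sup>+\<omega>. ennreal ((norm (g t \<omega>))\<^sup>2) \<partial>M) = (\<integral>\<^sup>+\<omega>. ennreal ((norm (g 0 \<omega>))\<^sup>2) \<partial>M)"
      unfolding g_def by (rule nn_integral_stationary) measurable
    then show ?thesis
      using \<open>square_integrable M (g 0)\<close> by (simp add: square_integrable_def D_def nn_integral_eq_integral)
  qed
  then have gD: "(\<integral>\<^sup>+\<omega>. ennreal ((norm (g t \<omega>))\<^sup>2) \<partial>M) \<le> ennreal (D * exp (- k * t))" if "t \<le> 0" for t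
    using mult_left_mono[of 1 "exp (- k * t)" D] that k \<open>D \<ge> 0\<close>
    by (simp add: mult_nonneg_nonpos ennreal_leI)
  note E = expected_energy_le[OF g k \<open>D \<ge> 0\<close> gD]
  define Z where "Z n \<omega> = (\<integral>\<^sup>+t. ennreal (exp (2 * k * t) * (norm (g t \<omega>))\<^sup>2 / (2 * k)) * indicator {- real n..0} t \<partial>lborel)"
    for n :: nat and \<omega>
  have "(\<integral>\<^sup>+\<omega>. ennreal ((norm (complex_dot c (x 0 \<omega>)))\<^sup>2) \<partial>M) \<le> ennreal (D / (2 * k\<^sup>2))"
  proof (rule nn_integral_le_by_stationarity)
    show "distr M borel (\<lambda>\<omega>. (norm (complex_dot c (x (- real n) \<omega>)))\<^sup>2) = distr M borel (\<lambda>\<omega>. (norm (complex_dot c (x 0 \<omega>)))\<^sup>2)" for n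
      using stationary_distr[of "\<lambda>p. (norm (complex_dot c (fst p)))\<^sup>2" "- real n"] by (simp add: borel_prod[symmetric])
    show "(\<lambda>n. exp (2 * k * - real n)) \<longlonglongrightarrow> 0" using k by real_asymp
    show "Z n \<in> borel_measurable M" for n unfolding Z_def[abs_def] by (rule E(1))
    show "(\<integral>\<^sup>+\<omega>. Z n \<omega> \<partial>M) \<le> ennreal (D / (2 * k\<^sup>2))" for n unfolding Z_def by (rule E(2))
    show "ennreal ((norm (complex_dot c (x 0 \<omega>)))\<^sup>2) \<le> ennreal (exp (2 * k * - real n) * (norm (complex_dot c (x (- real n) \<omega>)))\<^sup>2) + Z n \<omega>" for n \<omega>
    proof -
      have "((\<lambda>t. complex_dot c (x t \<omega>)) has_vector_derivative l * complex_dot c (x t \<omega>) + g t \<omega>) (at t)" for t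
        using bounded_linear.has_vector_derivative[OF bounded_linear_complex_dot x_deriv, of c \<omega> t]
        by (simp add: linear_add[OF bounded_linear.linear[OF bounded_linear_complex_dot]]
            complex_dot_matrix[of c A] g_def G_def d_def complex_dot_diff complex_dot_smult)
      moreover have "complex_dot c (x t \<omega>) \<bullet> (l * complex_dot c (x t \<omega>) + g t \<omega>)
          \<le> - (2 * k) * (norm (complex_dot c (x t \<omega>)))\<^sup>2 + norm (complex_dot c (x t \<omega>)) * norm (g t \<omega>)" for t
      proof -
        have "z \<bullet> (l * z) = - (2 * k) * (norm z)\<^sup>2" for z
          unfolding cmod_power2 by (simp add: k_def inner_complex_def algebra_simps power2_eq_square)
        then show ?thesis
          using Cauchy_Schwarz_ineq2[of "complex_dot c (x t \<omega>)" "g t \<omega>"] by (simp add: inner_add_right)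
      qed
      ultimately show ?thesis
        unfolding Z_def using k by (intro energy_estimate g(2)) auto
    qed
  qed measurable
  also have "\<dots> < \<infinity>" by simp
  finally show "square_integrable M (\<lambda>\<omega>. complex_dot c (x 0 \<omega>))"
    by (simp add: square_integrable_iff_nn_integral)
qed

lemma x_L2: "square_integrable M (x t)"
proof -
  have "square_integrable M (\<lambda>\<omega>. x 0 \<omega> $ i)" for i
    using square_integrable_bounded_linear[OF complex_dot_x_L2[of "axis i 1"] bounded_linear_Re]
    by (simp add: complex_dot_axis)
  then have "square_integrable M (x 0)" by (rule square_integrable_vec)
  then show ?thesis
    using nn_integral_stationary[of "\<lambda>p. (norm (fst p))\<^sup>2" t]
    by (simp add: square_integrable_iff_nn_integral borel_prod[symmetric])
qed

end

lemma has_vector_derivative_vecI: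
  fixes f :: "real \<Rightarrow> 'b::real_normed_vector^'n"
  assumes "\<And>i. ((\<lambda>t. f t $ i) has_vector_derivative f' $ i) F"
  shows "(f has_vector_derivative f') F"
proof -
  have "((\<lambda>y. ((f y - f (Lim F (\<lambda>x. x))) - (y - Lim F (\<lambda>x. x)) *\<^sub>R f') /\<^sub>R norm (y - Lim F (\<lambda>x. x))) \<longlongrightarrow> 0) F"
    using assms by (intro vec_tendstoI) (simp add: has_vector_derivative_def has_derivative_def)
  then show ?thesis
    by (simp add: has_vector_derivative_def has_derivative_def bounded_linear_scaleR_left)
qed

section \<open>Covariances with a fixed random variable\<close>

context prob_space
begin

lemma expectation_scaleR_nth:
  fixes X :: "'a \<Rightarrow> real^'n"
  assumes "square_integrable M Y" "square_integrable M X"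
  shows "expectation (\<lambda>\<omega>. Y \<omega> *\<^sub>R X \<omega>) $ i = expectation (\<lambda>\<omega>. Y \<omega> * X \<omega> $ i)"
  using integral_bounded_linear[OF bounded_linear_vec_nth integrable_square_integrable_mult(1)[OF assms], of i]
  by simp

lemma expectation_scaleR_diff:
  fixes X Z :: "'a \<Rightarrow> 'b::euclidean_space"
  assumes "square_integrable M Y" "square_integrable M X" "square_integrable M Z"
  shows "expectation (\<lambda>\<omega>. Y \<omega> *\<^sub>R (X \<omega> - Z \<omega>)) = expectation (\<lambda>\<omega>. Y \<omega> *\<^sub>R X \<omega>) - expectation (\<lambda>\<omega>. Y \<omega> *\<^sub>R Z \<omega>)"
  unfolding scaleR_diff_right
  by (intro Bochner_Integration.integral_diff integrable_square_integrable_mult(1) assms)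

lemma expectation_scaleR_add:
  fixes X Z :: "'a \<Rightarrow> 'b::euclidean_space"
  assumes "square_integrable M Y" "square_integrable M X" "square_integrable M Z"
  shows "expectation (\<lambda>\<omega>. Y \<omega> *\<^sub>R (X \<omega> + Z \<omega>)) = expectation (\<lambda>\<omega>. Y \<omega> *\<^sub>R X \<omega>) + expectation (\<lambda>\<omega>. Y \<omega> *\<^sub>R Z \<omega>)"
  unfolding scaleR_add_right
  by (intro Bochner_Integration.integral_add integrable_square_integrable_mult(1) assms)

lemma expectation_scaleR_bounded_linear:
  fixes X :: "'a \<Rightarrow> 'b::euclidean_space" and f :: "'b \<Rightarrow> 'c::euclidean_space"
  assumes "square_integrable M Y" "square_integrable M X" "bounded_linear f"
  shows "expectation (\<lambda>\<omega>. Y \<omega> *\<^sub>R f (X \<omega>)) = f (expectation (\<lambda>\<omega>. Y \<omega> *\<^sub>R X \<omega>))"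
  using integral_bounded_linear[OF assms(3) integrable_square_integrable_mult(1)[OF assms(1,2)]]
  by (simp add: linear_scale[OF bounded_linear.linear[OF assms(3)]])

lemma expectation_increment_has_integral:
  fixes p g :: "real \<Rightarrow> 'a \<Rightarrow> 'b::euclidean_space"
  assumes Y: "square_integrable M Y" and p: "\<And>t. square_integrable M (p t)" and g: "\<And>t. square_integrable M (g t)"
    and cont: "\<And>\<omega>. continuous_on UNIV (\<lambda>t. g t \<omega>)"
    and bound: "\<And>t. expectation (\<lambda>\<omega>. (norm (g t \<omega>))\<^sup>2) \<le> c"
    and deriv: "\<And>\<omega> t. ((\<lambda>t. p t \<omega>) has_vector_derivative g t \<omega>) (at t)"
    and "a \<le> b"
  shows "((\<lambda>t. expectation (\<lambda>\<omega>. Y \<omega> *\<^sub>R g t \<omega>)) has_integral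
    expectation (\<lambda>\<omega>. Y \<omega> *\<^sub>R p b \<omega>) - expectation (\<lambda>\<omega>. Y \<omega> *\<^sub>R p a \<omega>)) {a..b}"
proof -
  have eq: "integral {a..b} (\<lambda>t. g t \<omega>) = p b \<omega> - p a \<omega>" for \<omega>
    by (rule integral_unique, rule fundamental_theorem_of_calculus[OF \<open>a \<le> b\<close>])
      (rule has_vector_derivative_at_within[OF deriv])
  have "((\<lambda>t. expectation (\<lambda>\<omega>. Y \<omega> *\<^sub>R g t \<omega>)) has_integral
      expectation (\<lambda>\<omega>. Y \<omega> *\<^sub>R integral {a..b} (\<lambda>t. g t \<omega>))) {a..b}"
    by (rule has_integral_expectation[OF Y g cont bound])
  then show ?thesis unfolding eq expectation_scaleR_diff[OF Y p p] .
qed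

lemma expectation_inner_mult:
  fixes X Z :: "'a \<Rightarrow> real^'n"
  assumes X: "square_integrable M X" and Z: "square_integrable M Z"
  shows "expectation (\<lambda>\<omega>. (a \<bullet> X \<omega>) * (b \<bullet> Z \<omega>)) = a \<bullet> ((\<chi> i j. expectation (\<lambda>\<omega>. X \<omega> $ i * Z \<omega> $ j)) *v b)"
proof -
  have I: "integrable M (\<lambda>\<omega>. X \<omega> $ i * Z \<omega> $ j)" for i j
    using integrable_square_integrable_mult(1)[OF square_integrable_nth[OF X] square_integrable_nth[OF Z]] by simp
  have "(a \<bullet> X \<omega>) * (b \<bullet> Z \<omega>) = (\<Sum>i\<in>UNIV. \<Sum>j\<in>UNIV. a $ i * b $ j * (X \<omega> $ i * Z \<omega> $ j))" for \<omega>
    unfolding inner_vec_def sum_product by (intro sum.cong refl) simp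
  then have "expectation (\<lambda>\<omega>. (a \<bullet> X \<omega>) * (b \<bullet> Z \<omega>))
      = (\<Sum>i\<in>UNIV. \<Sum>j\<in>UNIV. a $ i * b $ j * expectation (\<lambda>\<omega>. X \<omega> $ i * Z \<omega> $ j))"
    by (simp add: I)
  also have "\<dots> = a \<bullet> ((\<chi> i j. expectation (\<lambda>\<omega>. X \<omega> $ i * Z \<omega> $ j)) *v b)"
    unfolding inner_vec_def matrix_vector_mult_def
    by (simp add: sum_distrib_left) (intro sum.cong refl, simp)
  finally show ?thesis .
qed

end

context colored_noise_model
begin

text \<open>Testing with a fixed scalar \<open>Y\<close> turns random path equations into
  deterministic linear equations in time. For \<open>Y\<close> a coordinate of \<open>x\<close>,
  \<open>\<eta>\<close> or \<open>W\<close>, these vectors are rows or columns of covariance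
  matrices.\<close>

abbreviation EY :: "('w \<Rightarrow> real) \<Rightarrow> ('w \<Rightarrow> real^'n) \<Rightarrow> real^'n" where
  "EY Y X \<equiv> expectation (\<lambda>\<omega>. Y \<omega> *\<^sub>R X \<omega>)"

lemma expectation_sq_stationary:
  assumes "F \<in> borel_measurable (borel :: ((real^'n) \<times> (real^'n)) measure)"
  shows "expectation (\<lambda>\<omega>. F (x t \<omega>, \<eta> t \<omega>) :: real) = expectation (\<lambda>\<omega>. F (x 0 \<omega>, \<eta> 0 \<omega>))"
  using stationary_expectation[of "\<lambda>p q. F p" 0 t 0] assms by simp

lemma W_increment_L2: "square_integrable M (\<lambda>\<omega>. (W t \<omega> - W s \<omega>) $ i)"
  by (intro square_integrable_nth square_integrable_diff W_L2)

lemma EY_W_Hoelder: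
  assumes Y: "square_integrable M Y"
  shows "norm (EY Y (W t) - EY Y (W s)) \<le> (expectation (\<lambda>\<omega>. (Y \<omega>)\<^sup>2) + CARD('n)) / 2 * sqrt \<bar>t - s\<bar>"
proof -
  have *: "norm (EY Y (W t) - EY Y (W s)) \<le> (expectation (\<lambda>\<omega>. (Y \<omega>)\<^sup>2) + CARD('n)) / 2 * sqrt (t - s)" if "s < t" for s t
  proof -
    \<comment> \<open>The fourth root balances Young's inequality: scaling \<open>Y\<close> by
      \<open>a\<close> and the increment by \<open>1 / a\<close> makes both terms of order
      \<open>sqrt (t - s)\<close>.\<close>
    define a where "a = sqrt (sqrt (t - s))"
    have a: "a > 0" "a\<^sup>2 = sqrt (t - s)" using that by (simp_all add: a_def)
    let ?D = "\<lambda>\<omega>. W t \<omega> - W s \<omega>"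
    have D: "square_integrable M ?D" by (intro square_integrable_diff W_L2)
    have "(norm (?D \<omega>))\<^sup>2 = (\<Sum>i\<in>UNIV. ?D \<omega> $ i * ?D \<omega> $ i)" for \<omega>
      by (simp only: power2_norm_eq_inner inner_vec_def inner_real_def)
    moreover have "integrable M (\<lambda>\<omega>. ?D \<omega> $ i * ?D \<omega> $ i)" for i
      using integrable_square_integrable_mult(1)[OF square_integrable_nth[OF D] square_integrable_nth[OF D]] by simp
    ultimately have ED: "expectation (\<lambda>\<omega>. (norm (?D \<omega>))\<^sup>2) = CARD('n) * (t - s)"
      using W_cov[of s t] that by (simp del: vector_minus_component)
    have "EY Y (W t) - EY Y (W s) = expectation (\<lambda>\<omega>. (a * Y \<omega>) *\<^sub>R ((1 / a) *\<^sub>R ?D \<omega>))"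
      using a(1) by (simp add: expectation_scaleR_diff[OF Y W_L2 W_L2])
    also have "norm \<dots> \<le> (expectation (\<lambda>\<omega>. (a * Y \<omega>)\<^sup>2) + expectation (\<lambda>\<omega>. (norm ((1 / a) *\<^sub>R ?D \<omega>))\<^sup>2)) / 2"
      using square_integrable_scaleR[OF Y, of a] square_integrable_scaleR[OF D, of "1 / a"]
      by (intro integrable_square_integrable_mult(2)) simp_all
    also have "\<dots> = (a\<^sup>2 * expectation (\<lambda>\<omega>. (Y \<omega>)\<^sup>2) + CARD('n) * (t - s) / a\<^sup>2) / 2"
      using ED by (simp add: power_mult_distrib power_divide)
    also have "\<dots> = (expectation (\<lambda>\<omega>. (Y \<omega>)\<^sup>2) + CARD('n)) / 2 * sqrt (t - s)"
      unfolding times_divide_eq_right[symmetric] using that by (simp add: a(2) real_div_sqrt algebra_simps)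
    finally show ?thesis .
  qed
  consider "s < t" | "s = t" | "t < s" by linarith
  then show ?thesis
    by cases (use *[of s t] *[of t s] in \<open>simp_all add: norm_minus_commute abs_minus_commute\<close>)
qed

lemma EY_W_cont:
  assumes Y: "square_integrable M Y"
  shows "continuous_on UNIV (\<lambda>t. EY Y (W t))"
  unfolding continuous_on
proof
  fix s :: real
  have "((\<lambda>t. (expectation (\<lambda>\<omega>. (Y \<omega>)\<^sup>2) + CARD('n)) / 2 * sqrt \<bar>t - s\<bar>) \<longlongrightarrow> (expectation (\<lambda>\<omega>. (Y \<omega>)\<^sup>2) + CARD('n)) / 2 * sqrt \<bar>s - s\<bar>) (at s)"
    by (intro tendsto_intros)
  then have "((\<lambda>t. EY Y (W t) - EY Y (W s)) \<longlongrightarrow> 0) (at s)"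
    by (intro Lim_null_comparison[OF always_eventually[OF allI[OF EY_W_Hoelder[OF Y]]]]) simp
  then show "((\<lambda>t. EY Y (W t)) \<longlongrightarrow> EY Y (W s)) (at s)" by (rule LIM_zero_cancel)
qed

lemma EY_\<eta>_increment:
  assumes Y: "square_integrable M Y" and "a \<le> b"
  shows "((\<lambda>t. - (1 / \<tau>) *\<^sub>R EY Y (\<eta> t)) has_integral
    (EY Y (\<eta> b) - (1 / \<tau>) *\<^sub>R EY Y (W b)) - (EY Y (\<eta> a) - (1 / \<tau>) *\<^sub>R EY Y (W a))) {a..b}"
proof -
  have L: "square_integrable M (\<lambda>\<omega>. (1 / \<tau>) *\<^sub>R W t \<omega>)" for t
    by (intro square_integrable_scaleR W_L2)
  have e1: "EY Y (\<lambda>\<omega>. \<eta> t \<omega> - (1 / \<tau>) *\<^sub>R W t \<omega>) = EY Y (\<eta> t) - (1 / \<tau>) *\<^sub>R EY Y (W t)" for t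
    unfolding expectation_scaleR_diff[OF Y \<eta>_L2 L]
      expectation_scaleR_bounded_linear[OF Y W_L2 bounded_linear_scaleR_right] ..
  have e2: "EY Y (\<lambda>\<omega>. - (1 / \<tau>) *\<^sub>R \<eta> t \<omega>) = - (1 / \<tau>) *\<^sub>R EY Y (\<eta> t)" for t
    by (rule expectation_scaleR_bounded_linear[OF Y \<eta>_L2 bounded_linear_scaleR_right])
  have "expectation (\<lambda>\<omega>. (norm (- (1 / \<tau>) *\<^sub>R \<eta> t \<omega>))\<^sup>2) = expectation (\<lambda>\<omega>. (norm (- (1 / \<tau>) *\<^sub>R \<eta> 0 \<omega>))\<^sup>2)" for t
    using expectation_sq_stationary[of "\<lambda>p. (norm (- (1 / \<tau>) *\<^sub>R snd p))\<^sup>2" t] by (simp add: borel_prod[symmetric])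
  then have "((\<lambda>t. EY Y (\<lambda>\<omega>. - (1 / \<tau>) *\<^sub>R \<eta> t \<omega>)) has_integral
      EY Y (\<lambda>\<omega>. \<eta> b \<omega> - (1 / \<tau>) *\<^sub>R W b \<omega>) - EY Y (\<lambda>\<omega>. \<eta> a \<omega> - (1 / \<tau>) *\<^sub>R W a \<omega>)) {a..b}"
    by (intro expectation_increment_has_integral[OF Y square_integrable_diff[OF \<eta>_L2 L]
          square_integrable_scaleR[OF \<eta>_L2] _ _ \<eta>_deriv \<open>a \<le> b\<close>] continuous_intros \<eta>_cont) (rule eq_refl)
  then show ?thesis unfolding e1 e2 .
qed

lemma EY_\<eta>_cont:
  assumes Y: "square_integrable M Y"
  shows "continuous_on UNIV (\<lambda>t. EY Y (\<eta> t))"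
proof -
  have "continuous_on UNIV (\<lambda>t. EY Y (\<eta> t) - (1 / \<tau>) *\<^sub>R EY Y (W t))"
    by (rule continuous_if_has_integral_increments) (rule EY_\<eta>_increment[OF Y])
  from continuous_on_add[OF this continuous_on_scaleR[OF continuous_on_const EY_W_cont[OF Y], of "1 / \<tau>"]]
  show ?thesis by simp
qed

lemma EY_\<eta>_deriv:
  assumes Y: "square_integrable M Y"
  shows "((\<lambda>t. EY Y (\<eta> t) - (1 / \<tau>) *\<^sub>R EY Y (W t)) has_vector_derivative - (1 / \<tau>) *\<^sub>R EY Y (\<eta> t)) (at t)"
  by (rule has_vector_derivative_if_has_integral_increments[OF EY_\<eta>_increment[OF Y]])
    (assumption, intro continuous_intros EY_\<eta>_cont[OF Y])

lemma EY_x_deriv: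
  assumes Y: "square_integrable M Y"
  shows "((\<lambda>t. EY Y (x t)) has_vector_derivative A *v EY Y (x t) + R *v EY Y (\<eta> t)) (at t)"
proof -
  note bl = matrix_vector_mul_bounded_linear
  have L: "square_integrable M (\<lambda>\<omega>. A *v x t \<omega>)" "square_integrable M (\<lambda>\<omega>. R *v \<eta> t \<omega>)" for t
    by (intro square_integrable_bounded_linear[OF _ bl] x_L2 \<eta>_L2)+
  have E: "EY Y (\<lambda>\<omega>. A *v x t \<omega> + R *v \<eta> t \<omega>) = A *v EY Y (x t) + R *v EY Y (\<eta> t)" for t
    unfolding expectation_scaleR_add[OF Y L]
      expectation_scaleR_bounded_linear[OF Y x_L2 bl] expectation_scaleR_bounded_linear[OF Y \<eta>_L2 bl] ..
  have [measurable]: "(*v) P \<in> borel_measurable borel" for P :: "real^'n^'n"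
    by (intro borel_measurable_continuous_onI linear_continuous_on bl)
  have "expectation (\<lambda>\<omega>. (norm (A *v x t \<omega> + R *v \<eta> t \<omega>))\<^sup>2) = expectation (\<lambda>\<omega>. (norm (A *v x 0 \<omega> + R *v \<eta> 0 \<omega>))\<^sup>2)" for t
  proof -
    have "(\<lambda>p. (norm (A *v fst p + R *v snd p))\<^sup>2) \<in> borel_measurable (borel :: ((real^'n) \<times> (real^'n)) measure)"
      unfolding borel_prod[symmetric] by measurable
    from expectation_sq_stationary[OF this] show ?thesis by simp
  qed
  then have inc: "((\<lambda>t. A *v EY Y (x t) + R *v EY Y (\<eta> t)) has_integral EY Y (x b) - EY Y (x a)) {a..b}" if "a \<le> b" for a b
    unfolding E[symmetric]
    by (intro expectation_increment_has_integral[OF Y x_L2 square_integrable_add[OF L] _ _ x_deriv that]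
        continuous_intros bounded_linear.continuous_on[OF bl] x_cont \<eta>_cont) (rule eq_refl)
  have "continuous_on UNIV (\<lambda>t. EY Y (x t))"
    by (rule continuous_if_has_integral_increments) (rule inc)
  then have "continuous_on UNIV (\<lambda>t. A *v EY Y (x t) + R *v EY Y (\<eta> t))"
    by (intro continuous_intros bounded_linear.continuous_on[OF bl] EY_\<eta>_cont[OF Y])
  with inc show ?thesis by (rule has_vector_derivative_if_has_integral_increments)
qed

lemma EY_bounded:
  assumes Y: "square_integrable M Y"
  obtains b where "\<And>t. norm (EY Y (\<eta> t)) \<le> b" "\<And>t. norm (EY Y (x t)) \<le> b"
proof -
  have e: "expectation (\<lambda>\<omega>. (norm (\<eta> t \<omega>))\<^sup>2) = expectation (\<lambda>\<omega>. (norm (\<eta> 0 \<omega>))\<^sup>2)"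
    "expectation (\<lambda>\<omega>. (norm (x t \<omega>))\<^sup>2) = expectation (\<lambda>\<omega>. (norm (x 0 \<omega>))\<^sup>2)" for t
    using expectation_sq_stationary[of "\<lambda>p. (norm (snd p))\<^sup>2" t] expectation_sq_stationary[of "\<lambda>p. (norm (fst p))\<^sup>2" t]
    by (simp_all add: borel_prod[symmetric])
  let ?b = "\<lambda>X. (expectation (\<lambda>\<omega>. (Y \<omega>)\<^sup>2) + expectation (\<lambda>\<omega>. (norm (X 0 \<omega>))\<^sup>2)) / 2"
  show ?thesis
  proof (rule that)
    fix t
    show "norm (EY Y (\<eta> t)) \<le> max (?b \<eta>) (?b x)"
      using integrable_square_integrable_mult(2)[OF Y \<eta>_L2[of t]] unfolding e[of t] by (rule max.coboundedI1)
    show "norm (EY Y (x t)) \<le> max (?b \<eta>) (?b x)"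
      using integrable_square_integrable_mult(2)[OF Y x_L2[of t]] unfolding e[of t] by (rule max.coboundedI2)
  qed
qed

text \<open>While the covariance with \<open>W\<close> is constant, the noise drops out. The
  auxiliary \<open>u\<close> is built from the differentiable part of \<open>\<eta>\<close>, so it
  has a two-sided derivative even at an endpoint of \<open>S\<close>, where
  \<open>EY Y (\<eta> t)\<close> itself may have a kink.\<close>

lemma EY_\<eta>_exponential:
  assumes Y: "square_integrable M Y" and S: "convex S" and W: "\<And>t. t \<in> S \<Longrightarrow> EY Y (W t) = w"
    and "a \<in> S" "b \<in> S"
  shows "EY Y (\<eta> b) = exp (- ((b - a) / \<tau>)) *\<^sub>R EY Y (\<eta> a)"
proof -
  define u where "u t = (EY Y (\<eta> t) - (1 / \<tau>) *\<^sub>R EY Y (W t)) + (1 / \<tau>) *\<^sub>R w" for t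
  have u: "u t = EY Y (\<eta> t)" if "t \<in> S" for t using W[OF that] by (simp add: u_def)
  have "(u has_vector_derivative - (1 / \<tau>) *\<^sub>R u t) (at t)" if "t \<in> S" for t
    unfolding u[OF that] unfolding u_def
    using has_vector_derivative_add[OF EY_\<eta>_deriv[OF Y] has_vector_derivative_const] by simp
  from exp_ode_scaleR[OF S this assms(4,5)] show ?thesis using assms(4,5) by (simp add: u)
qed

text \<open>The backward flow expands, so stationarity leaves zero as the only possible covariance
  of the past with an increment of \<open>W\<close>: this replaces adaptedness.\<close>

lemma increment_uncorrelated_with_past:
  assumes "s \<le> r" "r \<le> u"
  shows "EY (\<lambda>\<omega>. (W u \<omega> - W r \<omega>) $ j) (\<eta> s) = 0" "EY (\<lambda>\<omega>. (W u \<omega> - W r \<omega>) $ j) (x s) = 0"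
proof -
  let ?Y = "\<lambda>\<omega>. (W u \<omega> - W r \<omega>) $ j"
  have Y: "square_integrable M ?Y" by (rule W_increment_L2)
  obtain b where b: "\<And>t. norm (EY ?Y (\<eta> t)) \<le> b" "\<And>t. norm (EY ?Y (x t)) \<le> b"
    using EY_bounded[OF Y] by blast
  \<comment> \<open>Increments over disjoint intervals are orthogonal, so no noise correlated with
    \<open>?Y\<close> enters before time \<open>r\<close>.\<close>
  have W: "EY ?Y (W t) = EY ?Y (W r)" if "t \<in> {..r}" for t
  proof -
    have "(EY ?Y (W r) - EY ?Y (W t)) $ i = 0" for i
    proof -
      have "(EY ?Y (W r) - EY ?Y (W t)) $ i = EY ?Y (\<lambda>\<omega>. W r \<omega> - W t \<omega>) $ i"
        by (simp only: expectation_scaleR_diff[OF Y W_L2 W_L2])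
      also have "\<dots> = expectation (\<lambda>\<omega>. ?Y \<omega> * (W r \<omega> - W t \<omega>) $ i)"
        by (intro expectation_scaleR_nth Y square_integrable_diff W_L2)
      also have "\<dots> = expectation (\<lambda>\<omega>. (W r \<omega> - W t \<omega>) $ i * ?Y \<omega>)" by (simp only: mult.commute)
      also have "\<dots> = 0" using that assms(2) by (intro W_orthogonal) auto
      finally show ?thesis .
    qed
    then have "EY ?Y (W r) - EY ?Y (W t) = 0" by (simp add: vec_eq_iff)
    then show ?thesis by simp
  qed
  have \<eta>: "EY ?Y (\<eta> s) = 0" if "s \<le> r" for s
  proof (rule zero_if_exp_bound[of "- 1 / \<tau>"])
    show "- 1 / \<tau> < 0" using \<tau> by simp
    fix q assume "q \<le> s"
    then have "EY ?Y (\<eta> s) = exp (- ((s - q) / \<tau>)) *\<^sub>R EY ?Y (\<eta> q)"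
      using that by (intro EY_\<eta>_exponential[OF Y convex_real_interval(2) W]) auto
    then show "norm (EY ?Y (\<eta> s)) \<le> exp (- 1 / \<tau> * (s - q)) * b"
      using b(1)[of q] by (simp add: mult_left_mono)
  qed
  then show "EY ?Y (\<eta> s) = 0" using assms(1) by blast
  \<comment> \<open>On the half-line up to \<open>r\<close> the \<open>\<eta>\<close> term is gone
    and the induction hypothesis removes the remaining forcing. The paired covariance then solves a
    homogeneous damped equation and is bounded, so it vanishes.\<close>
  have "\<forall>s\<le>r. complex_dot c (EY ?Y (x s)) = 0" for c
  proof (rule hurwitz_induct[OF A, of "\<lambda>c. \<forall>s\<le>r. complex_dot c (EY ?Y (x s)) = 0"])
    show "\<forall>s\<le>r. complex_dot 0 (EY ?Y (x s)) = 0" by (simp add: complex_dot_zero)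
  next
    fix l :: complex and c
    assume l: "Re l < 0" and IH: "\<forall>s\<le>r. complex_dot (c v* map_matrix complex_of_real A - l *s c) (EY ?Y (x s)) = 0"
    have d: "((\<lambda>t. complex_dot c (EY ?Y (x t))) has_vector_derivative l * complex_dot c (EY ?Y (x t))) (at t)" if "t \<in> {..r}" for t
      using bounded_linear.has_vector_derivative[OF bounded_linear_complex_dot EY_x_deriv[OF Y], of c t] IH that \<eta>[of t]
      by (simp add: complex_dot_matrix complex_dot_diff complex_dot_smult)
    show "\<forall>s\<le>r. complex_dot c (EY ?Y (x s)) = 0"
    proof (intro allI impI)
      fix s assume "s \<le> r"
      show "complex_dot c (EY ?Y (x s)) = 0"
      proof (rule zero_if_exp_bound[OF l])
        fix q assume "q \<le> s"
        then have "norm (complex_dot c (EY ?Y (x s))) = exp (Re l * (s - q)) * norm (complex_dot c (EY ?Y (x q)))"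
          using \<open>s \<le> r\<close> by (intro exp_ode_complex[OF convex_real_interval(2) d]) auto
        moreover have "norm (complex_dot c (EY ?Y (x q))) \<le> b * onorm (complex_dot c)"
          using order_trans[OF onorm[OF bounded_linear_complex_dot] mult_left_mono[OF b(2) onorm_pos_le[OF bounded_linear_complex_dot]]]
          by (simp add: mult.commute)
        ultimately show "norm (complex_dot c (EY ?Y (x s))) \<le> exp (Re l * (s - q)) * (b * onorm (complex_dot c))"
          by simp
      qed
    qed
  qed
  from this[of "axis i 1" for i] assms(1) show "EY ?Y (x s) = 0"
    by (simp add: complex_dot_axis vec_eq_iff)
qed

end

section \<open>Explicit covariances of the stationary solution\<close>

context colored_noise_model
begin

lemma EY_W_const_after:
  assumes Y: "square_integrable M Y" and unc: "\<And>t i. r \<le> t \<Longrightarrow> expectation (\<lambda>\<omega>. Y \<omega> * (W t \<omega> - W r \<omega>) $ i) = 0"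
    and "r \<le> t"
  shows "EY Y (W t) = EY Y (W r)"
proof -
  have "(EY Y (W t) - EY Y (W r)) $ i = 0" for i
  proof -
    have "(EY Y (W t) - EY Y (W r)) $ i = EY Y (\<lambda>\<omega>. W t \<omega> - W r \<omega>) $ i"
      by (simp only: expectation_scaleR_diff[OF Y W_L2 W_L2])
    also have "\<dots> = expectation (\<lambda>\<omega>. Y \<omega> * (W t \<omega> - W r \<omega>) $ i)"
      by (intro expectation_scaleR_nth Y square_integrable_diff W_L2)
    also have "\<dots> = 0" by (rule unc[OF \<open>r \<le> t\<close>])
    finally show ?thesis .
  qed
  then have "EY Y (W t) - EY Y (W r) = 0" by (simp add: vec_eq_iff)
  then show ?thesis by simp
qed

text \<open>A variable uncorrelated with the noise after \<open>r\<close> sees only the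
  deterministic decay of \<open>\<eta>\<close>.\<close>

lemma \<eta>_regression:
  assumes Y: "square_integrable M Y" and unc: "\<And>t i. r \<le> t \<Longrightarrow> expectation (\<lambda>\<omega>. Y \<omega> * (W t \<omega> - W r \<omega>) $ i) = 0"
    and "r \<le> t"
  shows "EY Y (\<eta> t) = exp (- ((t - r) / \<tau>)) *\<^sub>R EY Y (\<eta> r)"
proof (rule EY_\<eta>_exponential[OF Y convex_real_interval(1)])
  show "EY Y (W u) = EY Y (W r)" if "u \<in> {r..}" for u
    using that by (intro EY_W_const_after[OF Y unc]) auto
qed (use \<open>r \<le> t\<close> in auto)

lemma \<eta>_nth_L2: "square_integrable M (\<lambda>\<omega>. \<eta> t \<omega> $ i)"
  by (rule square_integrable_nth[OF \<eta>_L2])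

lemma x_nth_L2: "square_integrable M (\<lambda>\<omega>. x t \<omega> $ i)"
  by (rule square_integrable_nth[OF x_L2])

lemma past_uncorrelated_with_increment:
  assumes "s \<le> r" "r \<le> t"
  shows "expectation (\<lambda>\<omega>. \<eta> s \<omega> $ j * (W t \<omega> - W r \<omega>) $ i) = 0" "expectation (\<lambda>\<omega>. x s \<omega> $ j * (W t \<omega> - W r \<omega>) $ i) = 0"
proof -
  have "expectation (\<lambda>\<omega>. (W t \<omega> - W r \<omega>) $ i * \<eta> s \<omega> $ j) = 0" "expectation (\<lambda>\<omega>. (W t \<omega> - W r \<omega>) $ i * x s \<omega> $ j) = 0"
    using expectation_scaleR_nth[OF W_increment_L2 \<eta>_L2, of t r i s j] expectation_scaleR_nth[OF W_increment_L2 x_L2, of t r i s j]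
      increment_uncorrelated_with_past[OF assms, of i] by simp_all
  then show "expectation (\<lambda>\<omega>. \<eta> s \<omega> $ j * (W t \<omega> - W r \<omega>) $ i) = 0" "expectation (\<lambda>\<omega>. x s \<omega> $ j * (W t \<omega> - W r \<omega>) $ i) = 0"
    by (simp_all only: mult.commute)
qed

lemma covariance_stationary:
  shows "expectation (\<lambda>\<omega>. \<eta> (s + h) \<omega> $ i * \<eta> (t + h) \<omega> $ j) = expectation (\<lambda>\<omega>. \<eta> s \<omega> $ i * \<eta> t \<omega> $ j)"
    and "expectation (\<lambda>\<omega>. \<eta> (s + h) \<omega> $ i * x (t + h) \<omega> $ j) = expectation (\<lambda>\<omega>. \<eta> s \<omega> $ i * x t \<omega> $ j)"
    and "expectation (\<lambda>\<omega>. x (s + h) \<omega> $ i * x (t + h) \<omega> $ j) = expectation (\<lambda>\<omega>. x s \<omega> $ i * x t \<omega> $ j)"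
proof -
  have [measurable]: "(\<lambda>v :: real^'n. v $ i) \<in> borel_measurable borel" for i
    by (intro borel_measurable_continuous_onI linear_continuous_on bounded_linear_vec_nth)
  note st = stationary_expectation[of _ s h t, unfolded borel_prod[symmetric]]
  show "expectation (\<lambda>\<omega>. \<eta> (s + h) \<omega> $ i * \<eta> (t + h) \<omega> $ j) = expectation (\<lambda>\<omega>. \<eta> s \<omega> $ i * \<eta> t \<omega> $ j)"
    using st[of "\<lambda>p q. snd p $ i * snd q $ j"] by simp
  show "expectation (\<lambda>\<omega>. \<eta> (s + h) \<omega> $ i * x (t + h) \<omega> $ j) = expectation (\<lambda>\<omega>. \<eta> s \<omega> $ i * x t \<omega> $ j)"
    using st[of "\<lambda>p q. snd p $ i * fst q $ j"] by simp
  show "expectation (\<lambda>\<omega>. x (s + h) \<omega> $ i * x (t + h) \<omega> $ j) = expectation (\<lambda>\<omega>. x s \<omega> $ i * x t \<omega> $ j)"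
    using st[of "\<lambda>p q. fst p $ i * fst q $ j"] by simp
qed

definition \<Lambda> :: "real \<Rightarrow> real^'n^'n" where
  "\<Lambda> s = (\<chi> i j. expectation (\<lambda>\<omega>. \<eta> s \<omega> $ i * x 0 \<omega> $ j))"

definition V :: "real^'n^'n" where
  "V = (\<chi> i j. expectation (\<lambda>\<omega>. \<eta> 0 \<omega> $ i * \<eta> 0 \<omega> $ j))"

definition Kx :: "real \<Rightarrow> real^'n^'n" where
  "Kx s = (\<chi> i j. expectation (\<lambda>\<omega>. x s \<omega> $ i * x 0 \<omega> $ j))"

lemma \<Lambda>_decay:
  assumes "s \<ge> 0"
  shows "\<Lambda> s = exp (- (s / \<tau>)) *\<^sub>R \<Lambda> 0"
proof -
  have "\<Lambda> s $ i $ j = exp (- (s / \<tau>)) * \<Lambda> 0 $ i $ j" for i j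
  proof -
    have \<Lambda>: "\<Lambda> s $ i $ j = EY (\<lambda>\<omega>. x 0 \<omega> $ j) (\<eta> s) $ i" for s
      unfolding expectation_scaleR_nth[OF x_nth_L2 \<eta>_L2] by (simp add: \<Lambda>_def mult.commute)
    have "EY (\<lambda>\<omega>. x 0 \<omega> $ j) (\<eta> s) = exp (- ((s - 0) / \<tau>)) *\<^sub>R EY (\<lambda>\<omega>. x 0 \<omega> $ j) (\<eta> 0)"
      using assms by (intro \<eta>_regression[OF x_nth_L2] past_uncorrelated_with_increment(2)) auto
    then show ?thesis by (simp add: \<Lambda>)
  qed
  then show ?thesis by (simp add: vec_eq_iff)
qed

lemma \<eta>_covariance_decay:
  assumes "s \<ge> 0"
  shows "expectation (\<lambda>\<omega>. \<eta> s \<omega> $ i * \<eta> 0 \<omega> $ j) = exp (- (s / \<tau>)) * V $ i $ j"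
proof -
  have \<Lambda>: "expectation (\<lambda>\<omega>. \<eta> s \<omega> $ i * \<eta> 0 \<omega> $ j) = EY (\<lambda>\<omega>. \<eta> 0 \<omega> $ j) (\<eta> s) $ i" for s
    unfolding expectation_scaleR_nth[OF \<eta>_nth_L2 \<eta>_L2] by (simp add: mult.commute)
  have "EY (\<lambda>\<omega>. \<eta> 0 \<omega> $ j) (\<eta> s) = exp (- ((s - 0) / \<tau>)) *\<^sub>R EY (\<lambda>\<omega>. \<eta> 0 \<omega> $ j) (\<eta> 0)"
    using assms by (intro \<eta>_regression[OF \<eta>_nth_L2] past_uncorrelated_with_increment(1)) auto
  moreover have "V $ i $ j = EY (\<lambda>\<omega>. \<eta> 0 \<omega> $ j) (\<eta> 0) $ i"
    unfolding \<Lambda>[symmetric] by (simp add: V_def)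
  ultimately show ?thesis unfolding \<Lambda> by simp
qed

lemma EY_W1_W:
  assumes "0 \<le> t" "t \<le> 1"
  shows "EY (\<lambda>\<omega>. (W 1 \<omega> - W 0 \<omega>) $ j) (W t) = t *\<^sub>R axis j 1"
proof -
  have "EY (\<lambda>\<omega>. (W 1 \<omega> - W 0 \<omega>) $ j) (W t) $ i = (t *\<^sub>R axis j 1) $ i" for i
  proof -
    have I: "integrable M (\<lambda>\<omega>. (W t \<omega> - W 0 \<omega>) $ i * (W b \<omega> - W a \<omega>) $ j)" for a b
      using integrable_square_integrable_mult(1)[OF W_increment_L2 W_increment_L2, of t 0 i b a j] by simp
    have "EY (\<lambda>\<omega>. (W 1 \<omega> - W 0 \<omega>) $ j) (W t) $ i
        = expectation (\<lambda>\<omega>. (W 1 \<omega> - W 0 \<omega>) $ j * W t \<omega> $ i)"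
      by (rule expectation_scaleR_nth[OF W_increment_L2 W_L2])
    also have "\<dots> = expectation (\<lambda>\<omega>. (W t \<omega> - W 0 \<omega>) $ i * (W 1 \<omega> - W t \<omega>) $ j + (W t \<omega> - W 0 \<omega>) $ i * (W t \<omega> - W 0 \<omega>) $ j)"
      by (simp add: W_0 algebra_simps)
    also have "\<dots> = expectation (\<lambda>\<omega>. (W t \<omega> - W 0 \<omega>) $ i * (W 1 \<omega> - W t \<omega>) $ j)
        + expectation (\<lambda>\<omega>. (W t \<omega> - W 0 \<omega>) $ i * (W t \<omega> - W 0 \<omega>) $ j)"
      by (rule Bochner_Integration.integral_add[OF I I])
    also have "\<dots> = (if i = j then t else 0)"
      using W_orthogonal[of 0 t t 1 i j] W_cov[of 0 t i j] assms by simp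
    finally show ?thesis by (simp add: axis_def)
  qed
  then show ?thesis by (simp add: vec_eq_iff)
qed

text \<open>On the unit interval the increment feeds \<open>\<eta>\<close> at constant rate: the
  covariance \<open>p\<close> solves \<open>p' = (e - p) / \<tau>\<close> with \<open>p = 0\<close>
  at time \<open>0\<close>, since \<open>\<eta> 0\<close> is uncorrelated with later noise.
  Subtracting the equilibrium \<open>e\<close> gives the decaying function \<open>u\<close>.\<close>

lemma EY_W1_\<eta>1: "EY (\<lambda>\<omega>. (W 1 \<omega> - W 0 \<omega>) $ j) (\<eta> 1) = (1 - exp (- (1 / \<tau>))) *\<^sub>R axis j 1"
proof -
  let ?Y = "\<lambda>\<omega>. (W 1 \<omega> - W 0 \<omega>) $ j"
  define e :: "real^'n" where "e = axis j 1"
  have Y: "square_integrable M ?Y" by (rule W_increment_L2)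
  define u where "u t = (EY ?Y (\<eta> t) - (1 / \<tau>) *\<^sub>R EY ?Y (W t)) + (t *\<^sub>R (1 / \<tau>) *\<^sub>R e - e)" for t
  have u: "u t = EY ?Y (\<eta> t) - e" if "t \<in> {0..1}" for t
    using EY_W1_W[of t j] that by (simp add: u_def e_def mult.commute)
  have "(u has_vector_derivative - (1 / \<tau>) *\<^sub>R EY ?Y (\<eta> t) + (1 / \<tau>) *\<^sub>R e) (at t)" for t
    unfolding u_def
    by (intro has_vector_derivative_add[OF EY_\<eta>_deriv[OF Y]]) (use \<tau> in \<open>auto intro!: derivative_eq_intros\<close>)
  then have "(u has_vector_derivative - (1 / \<tau>) *\<^sub>R u t) (at t)" if "t \<in> {0..1}" for t
    using \<tau> by (simp add: u[OF that] algebra_simps)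
  from exp_ode_scaleR[OF convex_real_interval(5) this, where a = 0 and b = 1]
  have "u 1 = exp (- (1 / \<tau>)) *\<^sub>R u 0" by simp
  moreover have "u 0 = - e"
    using u[of 0] increment_uncorrelated_with_past(1)[of 0 0 1 j] by simp
  moreover have "u 1 = EY ?Y (\<eta> 1) - e" using u[of 1] by simp
  ultimately show ?thesis by (simp add: e_def[symmetric] algebra_simps)
qed

text \<open>Decay and stationarity give the covariance of \<open>\<eta> 1\<close> with earlier
  values of \<open>\<eta>\<close> as an exponential times \<open>V\<close>, and its covariance with
  \<open>W 1\<close> is \<open>1 - \<epsilon>\<close> in the matching coordinate. The equation for
  \<open>\<eta>\<close>, integrated against \<open>\<eta> 1\<close>, then determines
  \<open>V\<close>; this replaces Ito's formula for the square of \<open>\<eta>\<close>.\<close>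

lemma V_eq: "V = (1 / (2 * \<tau>)) *\<^sub>R mat 1"
proof -
  have "V $ i = (1 / (2 * \<tau>)) *\<^sub>R axis i 1" for i
  proof -
    define \<epsilon> where "\<epsilon> = exp (- (1 / \<tau>))"
    let ?Y = "\<lambda>\<omega>. \<eta> 1 \<omega> $ i"
    have \<psi>: "EY ?Y (\<eta> t) = exp (- ((1 - t) / \<tau>)) *\<^sub>R V $ i" if "t \<le> 1" for t
    proof -
      have "EY ?Y (\<eta> t) $ j = exp (- ((1 - t) / \<tau>)) * V $ i $ j" for j
      proof -
        have "EY ?Y (\<eta> t) $ j = expectation (\<lambda>\<omega>. \<eta> 1 \<omega> $ i * \<eta> t \<omega> $ j)"
          by (rule expectation_scaleR_nth[OF \<eta>_nth_L2 \<eta>_L2])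
        also have "\<dots> = expectation (\<lambda>\<omega>. \<eta> (1 - t) \<omega> $ i * \<eta> 0 \<omega> $ j)"
          using covariance_stationary(1)[of "1 - t" t i 0 j] by simp
        also have "\<dots> = exp (- ((1 - t) / \<tau>)) * V $ i $ j"
          using that by (intro \<eta>_covariance_decay) simp
        finally show ?thesis .
      qed
      then show ?thesis by (simp add: vec_eq_iff)
    qed
    have \<omega>0: "EY ?Y (W 0) = 0" by (simp add: W_0)
    have \<omega>1: "EY ?Y (W 1) = (1 - \<epsilon>) *\<^sub>R axis i 1"
    proof -
      have "EY ?Y (W 1) $ j = (1 - \<epsilon>) * axis i 1 $ j" for j
      proof -
        have "EY ?Y (W 1) $ j = expectation (\<lambda>\<omega>. \<eta> 1 \<omega> $ i * W 1 \<omega> $ j)"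
          by (rule expectation_scaleR_nth[OF \<eta>_nth_L2 W_L2])
        also have "\<dots> = expectation (\<lambda>\<omega>. (W 1 \<omega> - W 0 \<omega>) $ j * \<eta> 1 \<omega> $ i)"
          by (simp add: W_0 mult.commute)
        also have "\<dots> = (EY (\<lambda>\<omega>. (W 1 \<omega> - W 0 \<omega>) $ j) (\<eta> 1)) $ i"
          by (rule expectation_scaleR_nth[OF W_increment_L2 \<eta>_L2, symmetric])
        also have "\<dots> = (1 - \<epsilon>) * axis i 1 $ j"
          by (simp only: EY_W1_\<eta>1 \<epsilon>_def) (simp add: axis_def)
        finally show ?thesis .
      qed
      then show ?thesis by (simp add: vec_eq_iff)
    qed
    \<comment> \<open>The same integral is evaluated twice: by an antiderivative of the explicit
      exponential, and by the integrated equation for \<open>\<eta>\<close>.\<close>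
    have "((\<lambda>t. - (1 / \<tau>) *\<^sub>R exp (- ((1 - t) / \<tau>)) *\<^sub>R V $ i) has_integral
        (- exp (- ((1 - 1) / \<tau>))) *\<^sub>R V $ i - (- exp (- ((1 - 0) / \<tau>))) *\<^sub>R V $ i) {0..1}"
      by (rule fundamental_theorem_of_calculus)
        (use \<tau> in \<open>auto intro!: derivative_eq_intros simp: has_real_derivative_iff_has_vector_derivative[symmetric]\<close>)
    moreover have "((\<lambda>t. - (1 / \<tau>) *\<^sub>R exp (- ((1 - t) / \<tau>)) *\<^sub>R V $ i) has_integral
        (EY ?Y (\<eta> 1) - (1 / \<tau>) *\<^sub>R EY ?Y (W 1)) - (EY ?Y (\<eta> 0) - (1 / \<tau>) *\<^sub>R EY ?Y (W 0))) {0..1}"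
      using EY_\<eta>_increment[OF \<eta>_nth_L2, of 0 1 1 i] by (rule has_integral_eq[rotated]) (simp_all add: \<psi>)
    ultimately have "(EY ?Y (\<eta> 1) - (1 / \<tau>) *\<^sub>R EY ?Y (W 1)) - (EY ?Y (\<eta> 0) - (1 / \<tau>) *\<^sub>R EY ?Y (W 0))
        = (- exp (- ((1 - 1) / \<tau>))) *\<^sub>R V $ i - (- exp (- ((1 - 0) / \<tau>))) *\<^sub>R V $ i"
      by (rule has_integral_unique[rotated])
    then have eq: "(V $ i - (1 / \<tau>) *\<^sub>R (1 - \<epsilon>) *\<^sub>R axis i 1) - \<epsilon> *\<^sub>R V $ i = - V $ i + \<epsilon> *\<^sub>R V $ i"
      by (simp add: \<omega>0 \<omega>1 \<psi> \<epsilon>_def)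
    have "V $ i $ j = (1 / (2 * \<tau>)) * axis i 1 $ j" for j
    proof -
      have "(V $ i $ j - 1 / \<tau> * ((1 - \<epsilon>) * axis i 1 $ j)) - \<epsilon> * V $ i $ j = - V $ i $ j + \<epsilon> * V $ i $ j"
        using arg_cong[OF eq, of "\<lambda>v. v $ j"] by simp
      then have "(1 - \<epsilon>) * (2 * V $ i $ j) = (1 - \<epsilon>) * (1 / \<tau> * axis i 1 $ j)"
        by (simp add: algebra_simps diff_divide_distrib)
      moreover have "1 - \<epsilon> \<noteq> 0" using \<tau> by (simp add: \<epsilon>_def)
      ultimately have "2 * V $ i $ j = 1 / \<tau> * axis i 1 $ j" by (metis mult_left_cancel)
      then show ?thesis using \<tau> by (simp add: field_simps)
    qed
    then show ?thesis by (simp add: vec_eq_iff)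
  qed
  then show ?thesis by (simp add: vec_eq_iff mat_def axis_def)
qed

text \<open>For \<open>t \<le> 0\<close> the covariance of \<open>\<eta> 0\<close> with
  \<open>x t\<close> is that of \<open>\<eta> (- t)\<close> with \<open>x 0\<close>, hence an
  explicit exponential. Its left derivative at \<open>0\<close> is computed once from this formula
  and once from the equation for \<open>x\<close>.\<close>

lemma \<Lambda>_equation: "(1 / \<tau>) *\<^sub>R \<Lambda> 0 = \<Lambda> 0 ** transpose A + (1 / (2 * \<tau>)) *\<^sub>R transpose R"
proof -
  have "(1 / \<tau>) *\<^sub>R \<Lambda> 0 $ i = A *v \<Lambda> 0 $ i + R *v V $ i" for i
  proof -
    let ?Y = "\<lambda>\<omega>. \<eta> 0 \<omega> $ i"
    have \<phi>: "EY ?Y (x t) = exp (t / \<tau>) *\<^sub>R \<Lambda> 0 $ i" if "t \<in> {..0}" for t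
    proof -
      have "EY ?Y (x t) $ j = exp (t / \<tau>) * \<Lambda> 0 $ i $ j" for j
      proof -
        have "EY ?Y (x t) $ j = expectation (\<lambda>\<omega>. \<eta> 0 \<omega> $ i * x t \<omega> $ j)"
          by (rule expectation_scaleR_nth[OF \<eta>_nth_L2 x_L2])
        also have "\<dots> = expectation (\<lambda>\<omega>. \<eta> (- t) \<omega> $ i * x 0 \<omega> $ j)"
          using covariance_stationary(2)[of "- t" t i 0 j] by simp
        also have "\<dots> = \<Lambda> (- t) $ i $ j" by (simp add: \<Lambda>_def)
        also have "\<dots> = exp (t / \<tau>) * \<Lambda> 0 $ i $ j"
          using that by (subst \<Lambda>_decay) auto
        finally show ?thesis .
      qed
      then show ?thesis by (simp add: vec_eq_iff)
    qed
    have "EY ?Y (\<eta> 0) $ j = V $ i $ j" for j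
      unfolding expectation_scaleR_nth[OF \<eta>_nth_L2 \<eta>_L2] by (simp add: V_def)
    then have \<psi>: "EY ?Y (\<eta> 0) = V $ i" by (simp add: vec_eq_iff)
    have "((\<lambda>t. EY ?Y (x t)) has_vector_derivative A *v \<Lambda> 0 $ i + R *v V $ i) (at 0 within {- 1..0})"
      using has_vector_derivative_at_within[OF EY_x_deriv[OF \<eta>_nth_L2, of 0 i 0]] \<phi>[of 0] \<psi> by simp
    then have "((\<lambda>t. exp (t / \<tau>) *\<^sub>R \<Lambda> 0 $ i) has_vector_derivative A *v \<Lambda> 0 $ i + R *v V $ i) (at 0 within {- 1..0})"
      by (rule has_vector_derivative_transform[rotated 2]) (simp_all add: \<phi>)
    moreover have "((\<lambda>t. exp (t / \<tau>) *\<^sub>R \<Lambda> 0 $ i) has_vector_derivative (1 / \<tau>) *\<^sub>R \<Lambda> 0 $ i) (at 0 within {- 1..0})"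
      using \<tau> by (auto intro!: derivative_eq_intros)
    ultimately show ?thesis
      by (intro vector_derivative_unique_within_closed_interval[of "- 1" 0 0]) auto
  qed
  then have "(1 / \<tau>) * \<Lambda> 0 $ i $ j = (A *v \<Lambda> 0 $ i) $ j + (R *v V $ i) $ j" for i j
    by (metis vector_add_component vector_scaleR_component real_scaleR_def)
  moreover have "(A *v \<Lambda> 0 $ i) $ j = (\<Lambda> 0 ** transpose A) $ i $ j" for i j
    by (simp add: matrix_vector_mult_def matrix_matrix_mult_def transpose_def mult.commute)
  moreover have "(R *v V $ i) $ j = (1 / (2 * \<tau>)) * transpose R $ i $ j" for i j
    by (simp add: V_eq matrix_vector_mult_def mat_def transpose_def if_distrib[of "\<lambda>x. _ * x"] cong: if_cong)
  ultimately show ?thesis by (simp add: vec_eq_iff)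
qed

lemma correlation_eq_Kx: "correlation M x t = Kx"
proof
  fix s
  have "expectation (\<lambda>\<omega>. x (t + s) \<omega> $ i * x t \<omega> $ j) = expectation (\<lambda>\<omega>. x s \<omega> $ i * x 0 \<omega> $ j)" for i j
    using covariance_stationary(3)[of s t i 0 j] by (simp add: add.commute)
  then show "correlation M x t s = Kx s" by (simp add: correlation_def Kx_def)
qed

lemma Kx_minus: "Kx (- s) = transpose (Kx s)"
proof -
  have "expectation (\<lambda>\<omega>. x (- s) \<omega> $ i * x 0 \<omega> $ j) = expectation (\<lambda>\<omega>. x s \<omega> $ j * x 0 \<omega> $ i)" for i j
    using covariance_stationary(3)[of "- s" s i 0 j] by (simp add: mult.commute)
  then show ?thesis by (simp add: Kx_def transpose_def vec_eq_iff)
qed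

lemma Kx_deriv: "(Kx has_vector_derivative A ** Kx s + R ** \<Lambda> s) (at s)"
proof (intro has_vector_derivative_vecI)
  fix i j
  let ?Y = "\<lambda>\<omega>. x 0 \<omega> $ j"
  have Kx: "EY ?Y (x s) $ i = Kx s $ i $ j" for s i
    unfolding expectation_scaleR_nth[OF x_nth_L2 x_L2] by (simp add: Kx_def mult.commute)
  have \<Lambda>: "EY ?Y (\<eta> s) $ i = \<Lambda> s $ i $ j" for s i
    unfolding expectation_scaleR_nth[OF x_nth_L2 \<eta>_L2] by (simp add: \<Lambda>_def mult.commute)
  have "((\<lambda>s. EY ?Y (x s) $ i) has_vector_derivative (A *v EY ?Y (x s) + R *v EY ?Y (\<eta> s)) $ i) (at s)"
    by (rule bounded_linear.has_vector_derivative[OF bounded_linear_vec_nth EY_x_deriv[OF x_nth_L2]])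
  then show "((\<lambda>s. Kx s $ i $ j) has_vector_derivative (A ** Kx s + R ** \<Lambda> s) $ i $ j) (at s)"
    by (simp add: Kx \<Lambda> matrix_vector_mult_def matrix_matrix_mult_def)
qed

text \<open>The right side is the second moment of
  \<open>w \<bullet> x 0 + r \<bullet> \<eta> 0\<close>. This is how probability enters the
  definiteness statements.\<close>

lemma joint_covariance_nonneg:
  "0 \<le> w \<bullet> (Kx 0 *v w) + 2 * (r \<bullet> (\<Lambda> 0 *v w)) + (r \<bullet> r) / (2 * \<tau>)"
proof -
  have L: "square_integrable M (\<lambda>\<omega>. w \<bullet> x 0 \<omega>)" "square_integrable M (\<lambda>\<omega>. r \<bullet> \<eta> 0 \<omega>)"
    by (rule square_integrable_bounded_linear[OF _ bounded_linear_inner_right], rule x_L2 \<eta>_L2)+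
  have I: "integrable M (\<lambda>\<omega>. (w \<bullet> x 0 \<omega>) * (w \<bullet> x 0 \<omega>))" "integrable M (\<lambda>\<omega>. (r \<bullet> \<eta> 0 \<omega>) * (w \<bullet> x 0 \<omega>))"
    "integrable M (\<lambda>\<omega>. (r \<bullet> \<eta> 0 \<omega>) * (r \<bullet> \<eta> 0 \<omega>))"
    using integrable_square_integrable_mult(1)[OF L(1) L(1)] integrable_square_integrable_mult(1)[OF L(2) L(1)]
      integrable_square_integrable_mult(1)[OF L(2) L(2)] by simp_all
  have "0 \<le> expectation (\<lambda>\<omega>. (w \<bullet> x 0 \<omega> + r \<bullet> \<eta> 0 \<omega>)\<^sup>2)" by simp
  also have "\<dots> = expectation (\<lambda>\<omega>. (w \<bullet> x 0 \<omega>) * (w \<bullet> x 0 \<omega>) + 2 * ((r \<bullet> \<eta> 0 \<omega>) * (w \<bullet> x 0 \<omega>)) + (r \<bullet> \<eta> 0 \<omega>) * (r \<bullet> \<eta> 0 \<omega>))"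
    by (simp add: power2_eq_square algebra_simps)
  also have "\<dots> = expectation (\<lambda>\<omega>. (w \<bullet> x 0 \<omega>) * (w \<bullet> x 0 \<omega>)) + 2 * expectation (\<lambda>\<omega>. (r \<bullet> \<eta> 0 \<omega>) * (w \<bullet> x 0 \<omega>))
      + expectation (\<lambda>\<omega>. (r \<bullet> \<eta> 0 \<omega>) * (r \<bullet> \<eta> 0 \<omega>))"
    using I by simp
  also have "\<dots> = w \<bullet> (Kx 0 *v w) + 2 * (r \<bullet> (\<Lambda> 0 *v w)) + r \<bullet> (V *v r)"
    by (simp only: expectation_inner_mult x_L2 \<eta>_L2 Kx_def \<Lambda>_def V_def)
  finally show ?thesis by (simp add: V_eq scaleR_matrix_vector_assoc[symmetric])
qed

end

section \<open>Derivatives of the correlation function\<close>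

lemma bounded_linear_matrix_mult_left: "bounded_linear (\<lambda>P. A ** (P :: real^'n^'m))"
  unfolding linear_conv_bounded_linear[symmetric]
  by (rule linearI) (simp_all add: matrix_add_ldistrib matrix_mult_scaleR)

lemma bounded_linear_transpose: "bounded_linear (transpose :: real^'n^'m \<Rightarrow> real^'m^'n)"
  unfolding linear_conv_bounded_linear[symmetric]
  by (rule linearI) (simp_all add: transpose_add transpose_scalar)

lemma has_vector_derivative_within_Un:
  assumes "(f has_vector_derivative f') (at t within S)" "(f has_vector_derivative f') (at t within T)"
  shows "(f has_vector_derivative f') (at t within (S \<union> T))"
  using assms unfolding has_vector_derivative_def has_derivative_within
  by (auto intro: Lim_Un)

lemma has_vector_derivative_reflect:
  fixes f :: "real \<Rightarrow> 'b::real_normed_vector"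
  assumes "(f has_vector_derivative f') (at (- t))"
  shows "((\<lambda>s. f (- s)) has_vector_derivative - f') (at t)"
proof -
  have "(uminus has_vector_derivative - 1) (at t)"
    using has_vector_derivative_minus[OF has_vector_derivative_id] by simp
  from vector_diff_chain_at[OF this assms] show ?thesis by (simp add: o_def)
qed

lemma linear_term_zero_if_quadratic_nonneg:
  fixes b c :: real
  assumes "\<And>s. 0 \<le> 2 * s * b + s\<^sup>2 * c" "c \<ge> 0"
  shows "b = 0"
proof -
  \<comment> \<open>Nearly the minimiser \<open>- b / c\<close> of the quadratic; the summand
    \<open>1\<close> keeps the denominator positive when \<open>c = 0\<close>.\<close>
  define s where "s = - b / (c + 1)"
  have s: "s * (c + 1) = - b" using assms(2) by (simp add: s_def)
  have "s\<^sup>2 * c \<le> s * (s * (c + 1))" by (simp add: power2_eq_square algebra_simps)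
  then have "0 \<le> s * b" using assms(1)[of s] unfolding s by simp
  then have "b\<^sup>2 / (c + 1) \<le> 0" by (simp add: s_def power2_eq_square)
  then have "b\<^sup>2 \<le> 0" using assms(2) by (simp add: divide_le_0_iff)
  then show ?thesis by simp
qed

lemma transpose_minus: "transpose (- P) = - transpose (P :: 'a::ring_1^'n^'m)"
  by (simp add: transpose_def vec_eq_iff)

text \<open>The process is now represented by two matrix functions, with \<open>\<Lambda> s\<close>
  standing for the covariance of \<open>\<eta> s\<close> with \<open>x 0\<close>. The assumption
  \<open>nonneg\<close> says that the joint covariance of \<open>x\<close> and \<open>\<eta>\<close>
  at one time is positive semidefinite, its \<open>\<eta>\<close> block being
  \<open>1 / (2 \<tau>)\<close> times the identity.\<close>

locale colored_noise_covariance =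
  fixes \<tau> :: real and A Q R :: "real^'n^'n" and K \<Lambda> :: "real \<Rightarrow> real^'n^'n"
  assumes \<tau>: "\<tau> > 0" and A: "hurwitz A" and R: "pos_def R" and RR: "R ** R = 2 *\<^sub>R Q"
    and K_minus: "\<And>s. K (- s) = transpose (K s)"
    and K_deriv: "\<And>s. (K has_vector_derivative A ** K s + R ** \<Lambda> s) (at s)"
    and \<Lambda>_decay: "\<And>s. s \<ge> 0 \<Longrightarrow> \<Lambda> s = exp (- (s / \<tau>)) *\<^sub>R \<Lambda> 0"
    and \<Lambda>_eq: "(1 / \<tau>) *\<^sub>R \<Lambda> 0 = \<Lambda> 0 ** transpose A + (1 / (2 * \<tau>)) *\<^sub>R transpose R"
    and nonneg: "\<And>w r. 0 \<le> w \<bullet> (K 0 *v w) + 2 * (r \<bullet> (\<Lambda> 0 *v w)) + (r \<bullet> r) / (2 * \<tau>)"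
begin

abbreviation "C \<equiv> K 0"
abbreviation "L \<equiv> \<Lambda> 0"
abbreviation "B \<equiv> resolvent_matrix \<tau> A"

definition K1 :: "real \<Rightarrow> real^'n^'n" where "K1 s = A ** K s + R ** \<Lambda> s"

text \<open>The second derivative of \<open>K\<close> for \<open>s \<ge> 0\<close>. For negative
  \<open>s\<close> that derivative is \<open>transpose (K2 (- s))\<close> instead.\<close>

definition K2 :: "real \<Rightarrow> real^'n^'n" where
  "K2 s = A ** K1 s - (exp (- (s / \<tau>)) / \<tau>) *\<^sub>R (R ** L)"

lemma R_sym: "transpose R = R" using R by (rule pos_def_symmetric)

lemma C_sym: "transpose C = C" using K_minus[of 0] by simp

lemma Q_sym: "transpose Q = Q"
proof -
  have "transpose (R ** R) = R ** R" by (simp add: matrix_transpose_mul R_sym)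
  then have "2 *\<^sub>R transpose Q = 2 *\<^sub>R Q" unfolding RR transpose_scalar .
  then show ?thesis by simp
qed

text \<open>The equation for \<open>L\<close> reads \<open>L (I - \<tau> A^T) = R / 2\<close>, that
  is \<open>L = R B^T / 2\<close>; then \<open>R ** R = 2 *\<^sub>R Q\<close> gives the
  claim.\<close>

lemma RL: "R ** L = Q ** transpose B"
proof -
  define N where "N = mat 1 - \<tau> *\<^sub>R A"
  have "transpose N = mat 1 - \<tau> *\<^sub>R transpose A"
    by (simp add: N_def transpose_diff transpose_scalar)
  then have "L ** transpose N = L - \<tau> *\<^sub>R (L ** transpose A)"
    by (simp add: matrix_diff_ldistrib matrix_mult_scaleR)
  also have "\<tau> *\<^sub>R (L ** transpose A) = L - (1 / 2) *\<^sub>R R"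
  proof -
    have "L ** transpose A = (1 / \<tau>) *\<^sub>R L - (1 / (2 * \<tau>)) *\<^sub>R R"
      using \<Lambda>_eq by (simp add: R_sym)
    then show ?thesis using \<tau> by (simp add: scaleR_diff_right)
  qed
  finally have LN: "L ** transpose N = (1 / 2) *\<^sub>R R" by simp
  have "B ** N = mat 1" using resolvent_matrix_inverse[OF \<tau> A] by (simp add: N_def)
  then have "transpose N ** transpose B = mat 1"
    by (metis matrix_transpose_mul transpose_mat)
  then have "L = (L ** transpose N) ** transpose B"
    by (simp add: matrix_mul_assoc[symmetric])
  then have "R ** L = (1 / 2) *\<^sub>R ((R ** R) ** transpose B)"
    by (simp add: LN scaleR_matrix_mult matrix_mult_scaleR matrix_mul_assoc)
  then show ?thesis by (simp add: RR scaleR_matrix_mult)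
qed

lemma K1_deriv: "(K has_vector_derivative K1 s) (at s)"
  using K_deriv by (simp add: K1_def)

lemma K1_minus: "K1 (- s) = - transpose (K1 s)"
proof -
  have "((\<lambda>s. K (- s)) has_vector_derivative - K1 (- s)) (at s)"
    by (rule has_vector_derivative_reflect[OF K1_deriv])
  moreover have "((\<lambda>s. K (- s)) has_vector_derivative transpose (K1 s)) (at s)"
    unfolding K_minus by (rule bounded_linear.has_vector_derivative[OF bounded_linear_transpose K1_deriv])
  ultimately have "- K1 (- s) = transpose (K1 s)" by (rule vector_derivative_unique_at)
  then show ?thesis by (simp add: minus_equation_iff[of "K1 (- s)"])
qed

lemma K1_skew: "transpose (K1 0) = - K1 0"
  using K1_minus[of 0] by (metis minus_minus minus_zero)

lemma K1_0: "K1 0 = A ** C + Q ** transpose B"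
  by (simp add: K1_def RL)

lemma K1_0_transpose: "transpose (K1 0) = C ** transpose A + B ** Q"
  by (simp add: K1_0 transpose_add matrix_transpose_mul C_sym Q_sym)

text \<open>Relation (a) is the vanishing symmetric part of \<open>K1 0\<close>, written
  out.\<close>

lemma eq_a_holds: "eq_a \<tau> C A Q"
proof -
  have "A ** C + C ** transpose A + Q ** transpose B + B ** Q = K1 0 + transpose (K1 0)"
    unfolding K1_0_transpose unfolding K1_0 by simp
  then show ?thesis by (simp add: eq_a_def Let_def K1_skew)
qed

lemma K1_0_antisymmetrized: "K1 0 = (1 / 2) *\<^sub>R (A ** C - C ** transpose A + Q ** transpose B - B ** Q)"
proof -
  have "A ** C - C ** transpose A + Q ** transpose B - B ** Q = K1 0 - transpose (K1 0)"
    unfolding K1_0_transpose unfolding K1_0 by simp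
  then show ?thesis by (simp add: K1_skew vec_eq_iff)
qed

lemma K2_0: "K2 0 = A ** (K1 0 + (1 / \<tau>) *\<^sub>R C) - (1 / \<tau>) *\<^sub>R K1 0"
proof -
  have "R ** L = K1 0 - A ** C" by (simp add: K1_def)
  then show ?thesis
    by (simp add: K2_def matrix_add_ldistrib matrix_mult_scaleR scaleR_diff_right)
qed

text \<open>The covariance matrix of the velocity \<open>A x + R \<eta>\<close>, expanded in blocks.
  Skewness of \<open>K1 0\<close> transforms the term \<open>A ** K1 0\<close>, and the equation for
  \<open>L\<close> the other one. Symmetry and definiteness of \<open>K2 0\<close> are read off from
  this form.\<close>

lemma minus_K2_0:
  "- K2 0 = A ** C ** transpose A + A ** transpose L ** R + R ** L ** transpose A + (1 / (2 * \<tau>)) *\<^sub>R (R ** R)"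
proof -
  have "transpose (K1 0) = C ** transpose A + transpose L ** R"
    by (simp add: K1_def transpose_add matrix_transpose_mul C_sym R_sym)
  then have "K1 0 = - (C ** transpose A + transpose L ** R)" using K1_skew by (metis minus_minus)
  then have "A ** K1 0 = A ** (0 - (C ** transpose A + transpose L ** R))" by simp
  then have 1: "A ** K1 0 = - (A ** C ** transpose A + A ** transpose L ** R)"
    by (simp only: matrix_diff_ldistrib matrix_add_ldistrib matrix_mul_assoc) simp
  have "(1 / \<tau>) *\<^sub>R (R ** L) = R ** ((1 / \<tau>) *\<^sub>R L)" by (simp add: matrix_mult_scaleR)
  also have "\<dots> = R ** L ** transpose A + (1 / (2 * \<tau>)) *\<^sub>R (R ** R)"
    unfolding \<Lambda>_eq by (simp add: matrix_add_ldistrib matrix_mult_scaleR R_sym matrix_mul_assoc)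
  finally show ?thesis using 1 by (simp add: K2_def)
qed

lemma K2_sym: "transpose (K2 0) = K2 0"
proof -
  have "transpose (- K2 0) = - K2 0"
    unfolding minus_K2_0
    by (simp add: transpose_add transpose_scalar matrix_transpose_mul C_sym R_sym matrix_mul_assoc)
  then show ?thesis by (simp add: transpose_minus)
qed

text \<open>Symmetrisation of \<open>K2_0\<close>: because \<open>K1 0\<close> is skew, the two
  terms with \<open>K1 0 / \<tau>\<close> outside the products cancel.\<close>

lemma eq_b_holds: "eq_b \<tau> C (K1 0) (K2 0) A"
proof -
  have "K2 0 = (1 / 2) *\<^sub>R (K2 0 + transpose (K2 0))" by (simp add: K2_sym vec_eq_iff)
  also have "transpose (K2 0) = (transpose (K1 0) + (1 / \<tau>) *\<^sub>R C) ** transpose A + (1 / \<tau>) *\<^sub>R K1 0"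
    unfolding K2_0 by (simp add: transpose_diff transpose_add transpose_scalar matrix_transpose_mul C_sym K1_skew)
  finally show ?thesis unfolding eq_b_def by (subst (asm) K2_0) simp
qed

lemma K2_deriv:
  assumes "s \<ge> 0"
  shows "((\<lambda>s. A ** K s + exp (- (s / \<tau>)) *\<^sub>R (R ** L)) has_vector_derivative K2 s) (at s)"
proof -
  have "((\<lambda>s. exp (- (s / \<tau>))) has_real_derivative - (exp (- (s / \<tau>)) / \<tau>)) (at s)"
    using \<tau> by (auto intro!: derivative_eq_intros)
  from has_vector_derivative_scaleR[OF this has_vector_derivative_const]
  have "((\<lambda>s. exp (- (s / \<tau>)) *\<^sub>R (R ** L)) has_vector_derivative - (exp (- (s / \<tau>)) / \<tau>) *\<^sub>R (R ** L)) (at s)"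
    by simp
  from has_vector_derivative_add[OF bounded_linear.has_vector_derivative[OF bounded_linear_matrix_mult_left K1_deriv] this]
  show ?thesis by (simp add: K2_def)
qed

lemma K1_right: "s \<ge> 0 \<Longrightarrow> K1 s = A ** K s + exp (- (s / \<tau>)) *\<^sub>R (R ** L)"
  unfolding K1_def by (subst \<Lambda>_decay) (simp_all add: matrix_mult_scaleR)

lemma K1_left: "s \<le> 0 \<Longrightarrow> K1 s = - transpose (A ** K (- s) + exp (- (- s / \<tau>)) *\<^sub>R (R ** L))"
  using K1_minus[of "- s"] K1_right[of "- s"] by simp

lemma K2_deriv_left:
  assumes "s \<le> 0"
  shows "((\<lambda>s. - transpose (A ** K (- s) + exp (- (- s / \<tau>)) *\<^sub>R (R ** L))) has_vector_derivative transpose (K2 (- s))) (at s)"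
proof -
  have "((\<lambda>s. A ** K (- s) + exp (- (- s / \<tau>)) *\<^sub>R (R ** L)) has_vector_derivative - K2 (- s)) (at s)"
    using assms by (intro has_vector_derivative_reflect K2_deriv) simp
  from has_vector_derivative_minus[OF bounded_linear.has_vector_derivative[OF bounded_linear_transpose this]]
  show ?thesis by (simp add: transpose_minus)
qed

text \<open>Each half-line has its own differentiable formula, the left one by reflection. At
  \<open>0\<close> their derivatives are \<open>K2 0\<close> and \<open>transpose (K2 0)\<close>,
  which agree by symmetry; a mismatch can appear only one order later.\<close>

lemma K1_has_derivative:
  "(K1 has_vector_derivative (if s \<ge> 0 then K2 s else transpose (K2 (- s)))) (at s)"
proof -
  consider "s > 0" | "s < 0" | "s = 0" by linarith
  then show ?thesis
  proof cases
    case 1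
    have "(K1 has_vector_derivative K2 s) (at s)"
      by (rule has_vector_derivative_transform_within_open[OF K2_deriv, of s "{0<..}"])
        (use 1 K1_right in auto)
    then show ?thesis using 1 by simp
  next
    case 2
    have "(K1 has_vector_derivative transpose (K2 (- s))) (at s)"
      by (rule has_vector_derivative_transform_within_open[OF K2_deriv_left, of s "{..<0}"])
        (use 2 K1_left in auto)
    then show ?thesis using 2 by simp
  next
    case 3
    have "(K1 has_vector_derivative K2 0) (at 0 within {0..})"
      by (rule has_vector_derivative_transform[OF _ _ has_vector_derivative_at_within[OF K2_deriv]])
        (use K1_right in auto)
    moreover have "(K1 has_vector_derivative K2 0) (at 0 within {..0})"
      by (rule has_vector_derivative_transform[OF _ _ has_vector_derivative_at_within])
        (use K2_deriv_left[of 0] K1_left in \<open>auto simp: K2_sym\<close>)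
    ultimately have "(K1 has_vector_derivative K2 0) (at 0 within ({0..} \<union> {..0}))"
      by (rule has_vector_derivative_within_Un)
    moreover have "{0..} \<union> {..0 :: real} = UNIV" by auto
    ultimately show ?thesis using 3 by simp
  qed
qed

text \<open>The right-hand third derivative of \<open>K\<close> at \<open>0\<close>. The left-hand
  one is \<open>- transpose K3r\<close>, so their mean is the skew part of \<open>K3r\<close>, which
  (c) describes.\<close>

definition K3r :: "real^'n^'n" where "K3r = A ** K2 0 + (1 / \<tau>\<^sup>2) *\<^sub>R (R ** L)"

text \<open>Two-sided although \<open>K2\<close> represents the second derivative on one side: it is
  built from \<open>K1\<close>, which is differentiable at \<open>0\<close> from both sides, and
  from a smooth exponential.\<close>

lemma K2_has_derivative: "(K2 has_vector_derivative K3r) (at 0)"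
proof -
  have "((\<lambda>s. exp (- (s / \<tau>)) / \<tau>) has_real_derivative - (1 / \<tau>\<^sup>2)) (at 0)"
    using \<tau> by (auto intro!: derivative_eq_intros simp: power2_eq_square)
  from has_vector_derivative_scaleR[OF this has_vector_derivative_const]
  have "((\<lambda>s. (exp (- (s / \<tau>)) / \<tau>) *\<^sub>R (R ** L)) has_vector_derivative - (1 / \<tau>\<^sup>2) *\<^sub>R (R ** L)) (at 0)"
    by simp
  moreover have "(K1 has_vector_derivative K2 0) (at 0)" using K1_has_derivative[of 0] by simp
  ultimately show ?thesis
    using has_vector_derivative_diff[OF bounded_linear.has_vector_derivative[OF bounded_linear_matrix_mult_left]]
    unfolding K2_def[abs_def] K3r_def by fastforce
qed

lemma second_derivative_right:
  "((\<lambda>s. if s \<ge> 0 then K2 s else transpose (K2 (- s))) has_vector_derivative K3r) (at_right 0)"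
proof -
  have "((\<lambda>s. if s \<ge> 0 then K2 s else transpose (K2 (- s))) has_vector_derivative K3r) (at 0 within {0..})"
    by (rule has_vector_derivative_transform[OF _ _ has_vector_derivative_at_within[OF K2_has_derivative]]) auto
  then show ?thesis by (rule has_vector_derivative_within_subset) auto
qed

lemma second_derivative_left:
  "((\<lambda>s. if s \<ge> 0 then K2 s else transpose (K2 (- s))) has_vector_derivative - transpose K3r) (at_left 0)"
proof -
  have "((\<lambda>s. K2 (- s)) has_vector_derivative - K3r) (at 0)"
    using K2_has_derivative by (intro has_vector_derivative_reflect) simp
  from bounded_linear.has_vector_derivative[OF bounded_linear_transpose this]
  have "((\<lambda>s. transpose (K2 (- s))) has_vector_derivative transpose (- K3r)) (at 0)" .
  then have "((\<lambda>s. if s \<ge> 0 then K2 s else transpose (K2 (- s))) has_vector_derivative transpose (- K3r)) (at 0 within {..0})"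
    by (rule has_vector_derivative_transform[OF _ _ has_vector_derivative_at_within, rotated 2]) (auto simp: K2_sym)
  then show ?thesis
    unfolding transpose_minus by (rule has_vector_derivative_within_subset) auto
qed

lemma K3r_eq: "K3r = (1 / \<tau>\<^sup>2) *\<^sub>R K1 0 + A ** (K2 0 - (1 / \<tau>\<^sup>2) *\<^sub>R C)"
proof -
  have "R ** L = K1 0 - A ** C" by (simp add: K1_def)
  then show ?thesis
    by (simp add: K3r_def matrix_diff_ldistrib matrix_mult_scaleR scaleR_diff_right)
qed

lemma eq_c_holds: "eq_c \<tau> C (K1 0) (K2 0) ((1 / 2) *\<^sub>R (K3r - transpose K3r)) A"
proof -
  have "transpose K3r = (1 / \<tau>\<^sup>2) *\<^sub>R transpose (K1 0) + (K2 0 - (1 / \<tau>\<^sup>2) *\<^sub>R C) ** transpose A"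
    by (simp add: K3r_eq transpose_add transpose_diff transpose_scalar matrix_transpose_mul C_sym K2_sym)
  then show ?thesis unfolding eq_c_def K3r_eq by (simp only: diff_diff_eq)
qed

text \<open>A positive semidefinite form that vanishes at a vector has vanishing polar form there,
  since otherwise a small move in a test direction would make it negative. The test directions are
  those with \<open>w' = 0\<close> and those with \<open>r' = 0\<close>.\<close>

lemma joint_covariance_kernel:
  assumes 0: "w \<bullet> (C *v w) + 2 * (r \<bullet> (L *v w)) + (r \<bullet> r) / (2 * \<tau>) = 0"
  shows "L *v w = - ((1 / (2 * \<tau>)) *\<^sub>R r)" "C *v w = - (transpose L *v r)"
proof -
  have Lt: "(transpose L *v u) \<bullet> v = u \<bullet> (L *v v)" for u v by (rule inner_transpose_mult)
  have Ct: "(C *v u) \<bullet> v = u \<bullet> (C *v v)" for u v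
    using inner_transpose_mult[of C u v] by (simp only: C_sym)
  have b0: "w' \<bullet> (C *v w) + r' \<bullet> (L *v w) + r \<bullet> (L *v w') + (r \<bullet> r') / (2 * \<tau>) = 0" (is "?b = 0") for w' r'
  proof (rule linear_term_zero_if_quadratic_nonneg)
    let ?q = "w' \<bullet> (C *v w') + 2 * (r' \<bullet> (L *v w')) + (r' \<bullet> r') / (2 * \<tau>)"
    show "?q \<ge> 0" by (rule nonneg)
    fix s
    have "w \<bullet> (C *v w') = w' \<bullet> (C *v w)" using Ct[of w' w] Ct[of w w'] by (simp add: inner_commute)
    then have "(w + s *\<^sub>R w') \<bullet> (C *v (w + s *\<^sub>R w')) + 2 * ((r + s *\<^sub>R r') \<bullet> (L *v (w + s *\<^sub>R w')))
        + ((r + s *\<^sub>R r') \<bullet> (r + s *\<^sub>R r')) / (2 * \<tau>)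
      = (w \<bullet> (C *v w) + 2 * (r \<bullet> (L *v w)) + (r \<bullet> r) / (2 * \<tau>)) + (2 * s * ?b + s\<^sup>2 * ?q)"
      by (simp add: matrix_vector_right_distrib matrix_vector_mult_scaleR inner_add_left inner_add_right
          inner_commute[of r' r] add_divide_distrib distrib_left distrib_right power2_eq_square mult_ac)
    then show "0 \<le> 2 * s * ?b + s\<^sup>2 * ?q"
      using nonneg[of "w + s *\<^sub>R w'" "r + s *\<^sub>R r'"] by (simp only: 0)
  qed
  have "u \<bullet> (L *v w + (1 / (2 * \<tau>)) *\<^sub>R r) = 0" for u
    using b0[of 0 u] by (simp add: inner_add_right inner_commute)
  then have "L *v w + (1 / (2 * \<tau>)) *\<^sub>R r = 0" by (metis inner_eq_zero_iff)
  then show "L *v w = - ((1 / (2 * \<tau>)) *\<^sub>R r)" by (simp add: eq_neg_iff_add_eq_0)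
  have "u \<bullet> (C *v w + transpose L *v r) = 0" for u
    using b0[of u 0] Lt[of r u] by (simp add: inner_add_right inner_commute)
  then have "C *v w + transpose L *v r = 0" by (metis inner_eq_zero_iff)
  then show "C *v w = - (transpose L *v r)" by (simp only: eq_neg_iff_add_eq_0)
qed

lemma K1_inner: "w \<bullet> (K1 0 *v w) = 0"
proof -
  have "w \<bullet> (K1 0 *v w) = (transpose (K1 0) *v w) \<bullet> w" by (rule inner_transpose_mult[symmetric])
  also have "\<dots> = - (w \<bullet> (K1 0 *v w))"
    unfolding K1_skew by (simp only: uminus_matrix_vector_mult inner_minus_left) (simp only: inner_commute)
  finally show ?thesis by simp
qed

text \<open>The form of \<open>- K2 0\<close> at \<open>v\<close> is the joint covariance form at
  \<open>w = A^T v\<close> and \<open>r = R v\<close>, hence nonnegative. If it were zero, the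
  kernel relations, inserted into \<open>w \<bullet> (K1 0 *v w) = 0\<close> together with the
  equation for \<open>L\<close>, would give \<open>r = 0\<close> and so
  \<open>v = 0\<close>.\<close>

lemma K2_neg_def: "neg_def (K2 0)"
  unfolding neg_def_iff_pos_def_uminus
proof (rule pos_defI)
  show "transpose (- K2 0) = - K2 0"
    by (simp add: transpose_minus K2_sym)
  fix v :: "real^'n" assume "v \<noteq> 0"
  define w r where "w = transpose A *v v" and "r = R *v v"
  have At: "v \<bullet> (A *v u) = w \<bullet> u" for u
    unfolding w_def by (rule inner_transpose_mult[symmetric])
  have Rt: "v \<bullet> (R *v u) = r \<bullet> u" "u \<bullet> (R *v u') = (R *v u) \<bullet> u'" for u u'
    using inner_transpose_mult[of R v u] inner_transpose_mult[of R u u'] unfolding r_def R_sym by simp_all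
  have Lt: "w \<bullet> (transpose L *v u) = u \<bullet> (L *v w)" for u
    using inner_transpose_mult[of L u w] by (simp only: inner_commute)
  define q where "q = w \<bullet> (C *v w) + 2 * (r \<bullet> (L *v w)) + (r \<bullet> r) / (2 * \<tau>)"
  have "v \<bullet> (- K2 0 *v v) = v \<bullet> (A *v (C *v (transpose A *v v))) + v \<bullet> (A *v (transpose L *v (R *v v)))
      + v \<bullet> (R *v (L *v (transpose A *v v))) + v \<bullet> (R *v (R *v v)) / (2 * \<tau>)"
    unfolding minus_K2_0
    by (simp only: matrix_vector_mult_add_rdistrib inner_add_right matrix_vector_mul_assoc[symmetric]
        scaleR_matrix_vector_assoc[symmetric] inner_scaleR_right) simp
  also have "\<dots> = q"
    unfolding w_def[symmetric] r_def[symmetric] At Rt(1) Lt q_def by simp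
  finally have vq: "v \<bullet> (- K2 0 *v v) = q" .
  have "q \<noteq> 0"
  proof
    assume "q = 0"
    then have Lw: "L *v w = - ((1 / (2 * \<tau>)) *\<^sub>R r)" and Cw: "C *v w = - (transpose L *v r)"
      using joint_covariance_kernel[of w r] by (simp_all only: q_def)
    \<comment> \<open>The two terms with \<open>r \<bullet> (R *v w)\<close> cancel, and the
      remainder \<open>- (r \<bullet> (L *v w)) / \<tau>\<close> equals
      \<open>(r \<bullet> r) / (2 * \<tau>\<^sup>2)\<close>.\<close>
    have "0 = w \<bullet> (K1 0 *v w)" by (simp only: K1_inner)
    also have "\<dots> = w \<bullet> (A *v (C *v w)) + w \<bullet> (R *v (L *v w))"
      by (simp only: K1_def matrix_vector_mult_add_rdistrib inner_add_right matrix_vector_mul_assoc)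
    also have "w \<bullet> (A *v (C *v w)) = - (r \<bullet> (L *v (transpose A *v w)))"
    proof -
      have "w \<bullet> (A *v (C *v w)) = (transpose A *v w) \<bullet> (- (transpose L *v r))"
        unfolding Cw by (rule inner_transpose_mult[symmetric])
      also have "\<dots> = - ((transpose L *v r) \<bullet> (transpose A *v w))"
        by (simp only: inner_minus_right inner_commute)
      also have "\<dots> = - (r \<bullet> (L *v (transpose A *v w)))" by (simp only: inner_transpose_mult)
      finally show ?thesis .
    qed
    also have "L *v (transpose A *v w) = (1 / \<tau>) *\<^sub>R (L *v w) - (1 / (2 * \<tau>)) *\<^sub>R (R *v w)"
    proof -
      have "(L ** transpose A) *v w = ((1 / \<tau>) *\<^sub>R L - (1 / (2 * \<tau>)) *\<^sub>R R) *v w"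
        using \<Lambda>_eq by (simp add: R_sym)
      then show ?thesis
        by (simp only: matrix_vector_mul_assoc matrix_vector_mult_diff_rdistrib scaleR_matrix_vector_assoc)
    qed
    also have "w \<bullet> (R *v (L *v w)) = - (r \<bullet> (R *v w)) / (2 * \<tau>)"
      unfolding Lw Rt(2)[of w] by (simp add: inner_commute)
    finally have "r \<bullet> (L *v w) / \<tau> = 0"
      by (simp add: inner_diff_right)
    then have "r \<bullet> r = 0" using \<tau> by (simp add: Lw)
    then have "R *v v = 0" by (simp add: r_def)
    then show False using pos_def_quadratic_form_pos[OF R \<open>v \<noteq> 0\<close>] by simp
  qed
  moreover have "q \<ge> 0" unfolding q_def by (rule nonneg)
  ultimately show "v \<bullet> (- K2 0 *v v) > 0" by (simp add: vq)
qed

text \<open>If the form of \<open>C\<close> vanishes at \<open>w\<close>, the joint form vanishes at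
  \<open>(w, 0)\<close>, so both \<open>C\<close> and \<open>L\<close> annihilate \<open>w\<close>.
  Then \<open>K1 0\<close> and \<open>K2 0\<close> annihilate it too, against the definiteness of
  \<open>K2 0\<close>.\<close>

lemma C_pos_def: "pos_def C"
proof (rule pos_defI[OF C_sym])
  fix w :: "real^'n" assume "w \<noteq> 0"
  have "w \<bullet> (C *v w) \<noteq> 0"
  proof
    assume "w \<bullet> (C *v w) = 0"
    then have "L *v w = 0" "C *v w = 0"
      using joint_covariance_kernel[of w 0] by (simp_all add: transpose_matrix_vector[symmetric] del: transpose_matrix_vector)
    then have RL0: "(R ** L) *v w = 0" and "K1 0 *v w = 0"
      by (simp_all add: K1_def matrix_vector_mult_add_rdistrib matrix_vector_mul_assoc[symmetric])
    then have "K2 0 *v w = 0"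
      by (simp add: K2_def matrix_vector_mult_diff_rdistrib matrix_vector_mul_assoc[symmetric]
          scaleR_matrix_vector_assoc[symmetric])
    moreover have "pos_def (- K2 0)" using K2_neg_def by (simp add: neg_def_iff_pos_def_uminus)
    then have "w \<bullet> (- K2 0 *v w) > 0" using \<open>w \<noteq> 0\<close> by (rule pos_def_quadratic_form_pos)
    ultimately show False by (simp add: uminus_matrix_vector_mult)
  qed
  then show "w \<bullet> (C *v w) > 0" using nonneg[of w 0] by simp
qed

end

section \<open>From Brownian motion to the covariance structure\<close>

lemma (in prob_space) square_integrable_integrable:
  fixes X :: "'a \<Rightarrow> real"
  assumes "square_integrable M X"
  shows "integrable M X"
  by (rule square_integrable_imp_integrable) (use assms in \<open>simp_all add: square_integrable_def\<close>)

lemma (in prob_space) centered_normal_moments: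
  assumes "\<sigma> > 0" "distributed M lborel X (normal_density 0 \<sigma>)"
  shows "square_integrable M X" "expectation X = 0" "expectation (\<lambda>\<omega>. X \<omega> * X \<omega>) = \<sigma>\<^sup>2"
proof -
  show 0: "expectation X = 0" by (rule normal_distributed_expectation[OF assms])
  from normal_distributed_variance[OF assms] show "expectation (\<lambda>\<omega>. X \<omega> * X \<omega>) = \<sigma>\<^sup>2"
    by (simp add: 0 power2_eq_square)
  have "integrable lborel (\<lambda>u. normal_density 0 \<sigma> u * u ^ 2)"
    using integrable_normal_moment[where \<mu> = 0 and k = 2] assms(1) by simp
  then have "integrable M (\<lambda>\<omega>. (X \<omega>)\<^sup>2)"
    by (subst distributed_integrable[OF assms(2), symmetric]) auto
  moreover have "X \<in> borel_measurable M"
    using distributed_measurable[OF assms(2)] by simp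
  ultimately show "square_integrable M X" by (simp add: square_integrable_def)
qed

lemma (in prob_space) indep_vars_expectation_mult:
  fixes X :: "'i \<Rightarrow> 'a \<Rightarrow> real"
  assumes "indep_vars (\<lambda>_. borel) X I" "k \<in> I" "l \<in> I" "k \<noteq> l" "integrable M (X k)" "integrable M (X l)"
  shows "expectation (\<lambda>\<omega>. X k \<omega> * X l \<omega>) = expectation (X k) * expectation (X l)"
proof -
  have "indep_vars (\<lambda>_. borel) X {k, l}"
    using assms(1-3) by (intro indep_vars_subset[OF assms(1)]) auto
  from indep_vars_lebesgue_integral[OF _ this] assms(4-6) show ?thesis by auto
qed

lemma brownian_increment_moments:
  fixes W :: "real \<Rightarrow> 'w \<Rightarrow> real^'n"
  assumes BM: "brownian_motion M W" and "s \<le> t"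
  shows "square_integrable M (\<lambda>\<omega>. (W t \<omega> - W s \<omega>) $ i)" "(\<integral>\<omega>. (W t \<omega> - W s \<omega>) $ i \<partial>M) = 0"
    and "(\<integral>\<omega>. (W t \<omega> - W s \<omega>) $ i * (W t \<omega> - W s \<omega>) $ j \<partial>M) = (if i = j then t - s else 0)"
proof -
  interpret prob_space M using BM by (simp add: brownian_motion_def)
  note increments = BM[unfolded brownian_motion_def, THEN conjunct2, THEN conjunct2, THEN conjunct2,
      THEN conjunct2, THEN conjunct2, rule_format]
  have I: "indep_vars (\<lambda>_. borel) (\<lambda>i \<omega>. (W t \<omega> - W s \<omega>) $ i) UNIV" if "s < t"
    by (rule conjunct1[OF increments[OF that]])
  have D: "distributed M lborel (\<lambda>\<omega>. (W t \<omega> - W s \<omega>) $ i) (normal_density 0 (sqrt (t - s)))" if "s < t" for i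
    by (rule conjunct2[OF increments[OF that], rule_format])
  have N: "square_integrable M (\<lambda>\<omega>. (W t \<omega> - W s \<omega>) $ i)" "expectation (\<lambda>\<omega>. (W t \<omega> - W s \<omega>) $ i) = 0"
    "expectation (\<lambda>\<omega>. (W t \<omega> - W s \<omega>) $ i * (W t \<omega> - W s \<omega>) $ i) = t - s" if "s < t" for i
  proof -
    have "sqrt (t - s) > 0" "(sqrt (t - s))\<^sup>2 = t - s" using that by simp_all
    with centered_normal_moments[OF _ D[OF that], of i]
    show "square_integrable M (\<lambda>\<omega>. (W t \<omega> - W s \<omega>) $ i)" "expectation (\<lambda>\<omega>. (W t \<omega> - W s \<omega>) $ i) = 0"
      "expectation (\<lambda>\<omega>. (W t \<omega> - W s \<omega>) $ i * (W t \<omega> - W s \<omega>) $ i) = t - s"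
      by (simp_all only:)
  qed
  \<comment> \<open>The normal law is prescribed for \<open>s < t\<close>; for \<open>s = t\<close>
    the increment is zero and is treated separately.\<close>
  show S: "square_integrable M (\<lambda>\<omega>. (W t \<omega> - W s \<omega>) $ i)" for i
  proof (cases "s = t")
    case False
    then show ?thesis using \<open>s \<le> t\<close> by (intro N(1)) simp
  qed (simp add: square_integrable_def)
  show E: "expectation (\<lambda>\<omega>. (W t \<omega> - W s \<omega>) $ i) = 0" for i
  proof (cases "s = t")
    case False
    then show ?thesis using \<open>s \<le> t\<close> by (intro N(2)) simp
  qed simp
  show "expectation (\<lambda>\<omega>. (W t \<omega> - W s \<omega>) $ i * (W t \<omega> - W s \<omega>) $ j) = (if i = j then t - s else 0)"
  proof (cases "s = t")
    case False
    then have "s < t" using \<open>s \<le> t\<close> by simp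
    show ?thesis
    proof (cases "i = j")
      case True
      then show ?thesis unfolding True[symmetric] N(3)[OF \<open>s < t\<close>] by simp
    next
      case False
      have int: "integrable M (\<lambda>\<omega>. (W t \<omega> - W s \<omega>) $ i)" for i
        using S[of i] by (rule square_integrable_integrable)
      have "expectation (\<lambda>\<omega>. (W t \<omega> - W s \<omega>) $ i * (W t \<omega> - W s \<omega>) $ j)
          = expectation (\<lambda>\<omega>. (W t \<omega> - W s \<omega>) $ i) * expectation (\<lambda>\<omega>. (W t \<omega> - W s \<omega>) $ j)"
        by (rule indep_vars_expectation_mult[OF I[OF \<open>s < t\<close>] UNIV_I UNIV_I False int int])
      then show ?thesis using False by (simp only: E) simp
    qed
  qed simp
qed

lemma brownian_increments_orthogonal:
  fixes W :: "real \<Rightarrow> 'w \<Rightarrow> real^'n"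
  assumes BM: "brownian_motion M W" and st: "s \<le> t" and tu: "t \<le> u" and uv: "u \<le> v"
  shows "(\<integral>\<omega>. (W t \<omega> - W s \<omega>) $ i * (W v \<omega> - W u \<omega>) $ j \<partial>M) = 0"
proof -
  interpret prob_space M using BM by (simp add: brownian_motion_def)
  \<comment> \<open>A monotone sequence through the four times: steps \<open>0\<close> and
    \<open>2\<close> are the two increments, step \<open>1\<close> is the gap between them, and
    \<open>{..<3}\<close> covers exactly these.\<close>
  define p where "p k = (if k = 0 then s else if k = 1 then t else if k = 2 then u else v)" for k :: nat
  have "mono p" unfolding mono_def p_def using st tu uv by auto
  then have "indep_vars (\<lambda>_. borel) (\<lambda>k \<omega>. W (p (Suc k)) \<omega> - W (p k) \<omega>) {..<3}"
    using BM by (simp add: brownian_motion_def)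
  from indep_vars_compose2[OF this, of "\<lambda>k v. if k = 0 then v $ i else v $ j" "\<lambda>_. borel"]
  have ind: "indep_vars (\<lambda>_. borel) (\<lambda>k \<omega>. if k = 0 then (W (p (Suc k)) \<omega> - W (p k) \<omega>) $ i else (W (p (Suc k)) \<omega> - W (p k) \<omega>) $ j) {..<3}"
    by (simp add: borel_measurable_continuous_onI linear_continuous_on bounded_linear_vec_nth)
  have int: "integrable M (\<lambda>\<omega>. (W t \<omega> - W s \<omega>) $ i)" if "s \<le> t" for s t i
    using brownian_increment_moments(1)[OF BM that, of i]
    by (rule square_integrable_integrable)
  from indep_vars_expectation_mult[OF ind, of 0 2] int[OF st, of i] int[OF uv, of j]
    brownian_increment_moments(2)[OF BM st, of i]
  show ?thesis by (simp add: p_def numeral_2_eq_2 del: vector_minus_component)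
qed

lemma brownian_square_integrable:
  fixes W :: "real \<Rightarrow> 'w \<Rightarrow> real^'n"
  assumes BM: "brownian_motion M W"
  shows "square_integrable M (W t)"
proof -
  have S: "square_integrable M (\<lambda>\<omega>. W t \<omega> - W 0 \<omega>)"
  proof (cases "t \<ge> 0")
    case True
    then show ?thesis by (intro square_integrable_vec brownian_increment_moments(1)[OF BM])
  next
    case False
    then have "square_integrable M (\<lambda>\<omega>. W 0 \<omega> - W t \<omega>)"
      by (intro square_integrable_vec brownian_increment_moments(1)[OF BM]) simp
    from square_integrable_scaleR[OF this, of "-1"] show ?thesis by simp
  qed
  have [measurable]: "W t \<in> borel_measurable M" for t using BM by (simp add: brownian_motion_def)
  have "AE \<omega> in M. W 0 \<omega> = 0" using BM by (simp add: brownian_motion_def)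
  then have "integrable M (\<lambda>\<omega>. (norm (W t \<omega>))\<^sup>2) \<longleftrightarrow> integrable M (\<lambda>\<omega>. (norm (W t \<omega> - W 0 \<omega>))\<^sup>2)"
    by (intro integrable_cong_AE) auto
  then show ?thesis using S by (simp add: square_integrable_def)
qed

text \<open>All path properties are made to hold everywhere by setting the processes to zero on a null set.\<close>

lemma colored_noise_modification:
  fixes W x \<eta> :: "real \<Rightarrow> 'w \<Rightarrow> real^'n"
  assumes "\<tau> > 0" "hurwitz A" and BM: "brownian_motion M W"
    and st: "stationary_process M (\<lambda>t \<omega>. (x t \<omega>, \<eta> t \<omega>))"
    and sol: "colored_noise_solution M \<tau> A Q W x \<eta>"
  obtains W' x' \<eta>' where "colored_noise_model M \<tau> A (matrix_sqrt (2 *\<^sub>R Q)) W' x' \<eta>'"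
    "\<And>t s. correlation M x' t s = correlation M x t s"
proof -
  interpret prob_space M using BM by (simp add: brownian_motion_def)
  define R where "R = matrix_sqrt (2 *\<^sub>R Q)"
  define good where "good \<omega> \<longleftrightarrow> W 0 \<omega> = 0 \<and> continuous_on UNIV (\<lambda>t. W t \<omega>) \<and>
    (\<forall>t. ((\<lambda>t. x t \<omega>) has_vector_derivative (A *v x t \<omega> + R *v \<eta> t \<omega>)) (at t)) \<and>
    (\<forall>s t. s \<le> t \<longrightarrow> ((\<lambda>u. - (1 / \<tau>) *\<^sub>R \<eta> u \<omega>) has_integral
        (\<eta> t \<omega> - \<eta> s \<omega> - (1 / \<tau>) *\<^sub>R (W t \<omega> - W s \<omega>))) {s..t})" for \<omega>
  have "AE \<omega> in M. W 0 \<omega> = 0" "AE \<omega> in M. continuous_on UNIV (\<lambda>t. W t \<omega>)"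
    using BM unfolding brownian_motion_def by blast+
  moreover have "AE \<omega> in M. \<forall>t. ((\<lambda>t. x t \<omega>) has_vector_derivative (A *v x t \<omega> + R *v \<eta> t \<omega>)) (at t)"
    "AE \<omega> in M. \<forall>s t. s \<le> t \<longrightarrow> ((\<lambda>u. - (1 / \<tau>) *\<^sub>R \<eta> u \<omega>) has_integral
        (\<eta> t \<omega> - \<eta> s \<omega> - (1 / \<tau>) *\<^sub>R (W t \<omega> - W s \<omega>))) {s..t}"
    using sol unfolding colored_noise_solution_def R_def by blast+
  ultimately have "AE \<omega> in M. good \<omega>"
    by eventually_elim (unfold good_def, blast)
  then obtain N where N: "{\<omega> \<in> space M. \<not> good \<omega>} \<subseteq> N" "N \<in> null_sets M"
    by (rule AE_E3) auto
  define G where "G = space M - N"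
  have G[measurable]: "G \<in> sets M" using N(2) by (auto simp: G_def)
  have good: "good \<omega>" if "\<omega> \<in> G" for \<omega> using that N(1) by (auto simp: G_def)
  have AEG: "AE \<omega> in M. \<omega> \<in> G"
    using AE_not_in[OF N(2)] by (auto simp: G_def)
  \<comment> \<open>Off \<open>G\<close> the zero processes solve both equations and start
    \<open>W'\<close> at \<open>0\<close>, so the path properties hold there as well.\<close>
  define W' x' \<eta>' where "W' t \<omega> = (if \<omega> \<in> G then W t \<omega> else 0)"
    and "x' t \<omega> = (if \<omega> \<in> G then x t \<omega> else 0)" and "\<eta>' t \<omega> = (if \<omega> \<in> G then \<eta> t \<omega> else 0)" for t \<omega>
  have Wm[measurable]: "W t \<in> borel_measurable M" for t using BM by (simp add: brownian_motion_def)
  have z[measurable]: "(\<lambda>\<omega>. (x t \<omega>, \<eta> t \<omega>)) \<in> borel_measurable M" for t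
    using st by (simp add: stationary_process_def)
  have [measurable]: "x t \<in> borel_measurable M" "\<eta> t \<in> borel_measurable M" for t
    using measurable_compose[OF z[unfolded borel_prod[symmetric]] measurable_fst, of t]
      measurable_compose[OF z[unfolded borel_prod[symmetric]] measurable_snd, of t] by simp_all
  have [measurable]: "W' t \<in> borel_measurable M" "x' t \<in> borel_measurable M" "\<eta>' t \<in> borel_measurable M" for t
    unfolding W'_def[abs_def] x'_def[abs_def] \<eta>'_def[abs_def] by measurable
  have ae: "AE \<omega> in M. W' t \<omega> = W t \<omega>" "AE \<omega> in M. x' t \<omega> = x t \<omega>" "AE \<omega> in M. \<eta>' t \<omega> = \<eta> t \<omega>" for t
    using AEG by (auto simp: W'_def x'_def \<eta>'_def)
  have W'_moment: "expectation (\<lambda>\<omega>. (W' a \<omega> - W' b \<omega>) $ i * (W' c \<omega> - W' d \<omega>) $ j)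
      = expectation (\<lambda>\<omega>. (W a \<omega> - W b \<omega>) $ i * (W c \<omega> - W d \<omega>) $ j)" for a b c d i j
  proof (rule integral_cong_AE)
    have [measurable]: "(\<lambda>v :: real^'n. v $ i) \<in> borel_measurable borel" for i
      by (intro borel_measurable_continuous_onI linear_continuous_on bounded_linear_vec_nth)
    show "(\<lambda>\<omega>. (W' a \<omega> - W' b \<omega>) $ i * (W' c \<omega> - W' d \<omega>) $ j) \<in> borel_measurable M"
      "(\<lambda>\<omega>. (W a \<omega> - W b \<omega>) $ i * (W c \<omega> - W d \<omega>) $ j) \<in> borel_measurable M"
      by measurable
    show "AE \<omega> in M. (W' a \<omega> - W' b \<omega>) $ i * (W' c \<omega> - W' d \<omega>) $ j = (W a \<omega> - W b \<omega>) $ i * (W c \<omega> - W d \<omega>) $ j"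
      using AEG by eventually_elim (simp add: W'_def)
  qed
  have "colored_noise_model M \<tau> A R W' x' \<eta>'"
  proof (unfold_locales)
    show "\<tau> > 0" "hurwitz A" by fact+
    show "x' t \<in> borel_measurable M" "\<eta>' t \<in> borel_measurable M" for t by measurable
    show "square_integrable M (W' t)" for t
    proof -
      have "integrable M (\<lambda>\<omega>. (norm (W' t \<omega>))\<^sup>2) \<longleftrightarrow> integrable M (\<lambda>\<omega>. (norm (W t \<omega>))\<^sup>2)"
        using ae(1)[of t] by (intro integrable_cong_AE) auto
      then show ?thesis using brownian_square_integrable[OF BM, of t] by (simp add: square_integrable_def)
    qed
    show W'_cont: "continuous_on UNIV (\<lambda>t. W' t \<omega>)" for \<omega>
      using good[of \<omega>] by (cases "\<omega> \<in> G") (simp_all add: W'_def good_def)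
    show "W' 0 \<omega> = 0" for \<omega> using good[of \<omega>] by (simp add: W'_def good_def)
    show "expectation (\<lambda>\<omega>. (W' t \<omega> - W' s \<omega>) $ i * (W' v \<omega> - W' u \<omega>) $ j) = 0"
      if "s \<le> t" "t \<le> u" "u \<le> v" for s t u v i j
      unfolding W'_moment using that by (rule brownian_increments_orthogonal[OF BM])
    show "expectation (\<lambda>\<omega>. (W' t \<omega> - W' s \<omega>) $ i * (W' t \<omega> - W' s \<omega>) $ j) = (if i = j then t - s else 0)"
      if "s \<le> t" for s t i j
      unfolding W'_moment using that by (rule brownian_increment_moments(3)[OF BM])
    show "((\<lambda>t. x' t \<omega>) has_vector_derivative (A *v x' t \<omega> + R *v \<eta>' t \<omega>)) (at t)" for \<omega> t
      using good[of \<omega>] by (cases "\<omega> \<in> G") (simp_all add: x'_def \<eta>'_def good_def)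
    show "((\<lambda>t. \<eta>' t \<omega> - (1 / \<tau>) *\<^sub>R W' t \<omega>) has_vector_derivative (- (1 / \<tau>) *\<^sub>R \<eta>' t \<omega>)) (at t)" for \<omega> t
    proof -
      have inc: "((\<lambda>u. - (1 / \<tau>) *\<^sub>R \<eta>' u \<omega>) has_integral
        (\<eta>' b \<omega> - (1 / \<tau>) *\<^sub>R W' b \<omega>) - (\<eta>' a \<omega> - (1 / \<tau>) *\<^sub>R W' a \<omega>)) {a..b}" if "a \<le> b" for a b
      proof (cases "\<omega> \<in> G")
        case True
        have "((\<lambda>u. - (1 / \<tau>) *\<^sub>R \<eta> u \<omega>) has_integral
          (\<eta> b \<omega> - \<eta> a \<omega> - (1 / \<tau>) *\<^sub>R (W b \<omega> - W a \<omega>))) {a..b}"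
          using good[OF True] that unfolding good_def by blast
        then show ?thesis using True by (simp add: W'_def \<eta>'_def algebra_simps)
      qed (simp add: W'_def \<eta>'_def)
      then have "continuous_on UNIV (\<lambda>t. \<eta>' t \<omega> - (1 / \<tau>) *\<^sub>R W' t \<omega>)"
        by (rule continuous_if_has_integral_increments)
      from continuous_on_add[OF this continuous_on_scaleR[OF continuous_on_const W'_cont[of \<omega>], of "1 / \<tau>"]]
      have "continuous_on UNIV (\<lambda>t. \<eta>' t \<omega>)" by simp
      then have "continuous_on UNIV (\<lambda>t. - (1 / \<tau>) *\<^sub>R \<eta>' t \<omega>)"
        by (rule continuous_on_scaleR[OF continuous_on_const])
      with inc show ?thesis by (rule has_vector_derivative_if_has_integral_increments)
    qed
    show "distr M borel (\<lambda>\<omega>. ((x' (s + h) \<omega>, \<eta>' (s + h) \<omega>), (x' (t + h) \<omega>, \<eta>' (t + h) \<omega>)))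
      = distr M borel (\<lambda>\<omega>. ((x' s \<omega>, \<eta>' s \<omega>), (x' t \<omega>, \<eta>' t \<omega>)))" for h s t
    proof -
      \<comment> \<open>Stationarity is given for the law on path space, and the joint law at two
        times is its image under a coordinate projection. The change on a null set leaves that image
        unchanged.\<close>
      define pr where "pr f = (f s, f t)" for f :: "real \<Rightarrow> (real^'n) \<times> (real^'n)"
      have pr[measurable]: "pr \<in> borel_measurable (\<Pi>\<^sub>M t\<in>(UNIV :: real set). borel)"
        unfolding pr_def[abs_def] borel_prod[symmetric] by measurable
      have path[measurable]: "(\<lambda>\<omega> t. (x (t + h) \<omega>, \<eta> (t + h) \<omega>)) \<in> M \<rightarrow>\<^sub>M (\<Pi>\<^sub>M t\<in>(UNIV :: real set). borel)" for h
        by (rule measurable_PiM_single') (use z in auto)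
      have pair: "(\<lambda>\<omega>. ((x s \<omega>, \<eta> s \<omega>), (x t \<omega>, \<eta> t \<omega>))) \<in> borel_measurable M" for s t
        unfolding borel_prod[symmetric] by measurable
      have pair': "(\<lambda>\<omega>. ((x' s \<omega>, \<eta>' s \<omega>), (x' t \<omega>, \<eta>' t \<omega>))) \<in> borel_measurable M" for s t
        unfolding borel_prod[symmetric] by measurable
      have eq: "distr M borel (\<lambda>\<omega>. ((x' s \<omega>, \<eta>' s \<omega>), (x' t \<omega>, \<eta>' t \<omega>)))
        = distr M borel (\<lambda>\<omega>. ((x s \<omega>, \<eta> s \<omega>), (x t \<omega>, \<eta> t \<omega>)))" for s t
      proof (rule distr_cong_AE[OF refl refl _ pair' pair])
        show "AE \<omega> in M. ((x' s \<omega>, \<eta>' s \<omega>), (x' t \<omega>, \<eta>' t \<omega>)) = ((x s \<omega>, \<eta> s \<omega>), (x t \<omega>, \<eta> t \<omega>))"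
          using AEG by eventually_elim (simp add: x'_def \<eta>'_def)
      qed
      have "distr (distr M (\<Pi>\<^sub>M t\<in>UNIV. borel) (\<lambda>\<omega> t. (x (t + h) \<omega>, \<eta> (t + h) \<omega>))) borel pr
          = distr (distr M (\<Pi>\<^sub>M t\<in>UNIV. borel) (\<lambda>\<omega> t. (x t \<omega>, \<eta> t \<omega>))) borel pr"
        using st by (simp add: stationary_process_def)
      then have "distr M borel (pr \<circ> (\<lambda>\<omega> t. (x (t + h) \<omega>, \<eta> (t + h) \<omega>))) = distr M borel (pr \<circ> (\<lambda>\<omega> t. (x t \<omega>, \<eta> t \<omega>)))"
        using path[of 0] by (simp add: distr_distr)
      then show ?thesis unfolding eq by (simp add: pr_def o_def)
    qed
  qed
  moreover have "correlation M x' t s = correlation M x t s" for t s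
  proof -
    have [measurable]: "(\<lambda>v :: real^'n. v $ i) \<in> borel_measurable borel" for i
      by (intro borel_measurable_continuous_onI linear_continuous_on bounded_linear_vec_nth)
    have "expectation (\<lambda>\<omega>. x' (t + s) \<omega> $ i * x' t \<omega> $ j) = expectation (\<lambda>\<omega>. x (t + s) \<omega> $ i * x t \<omega> $ j)" for i j
    proof (rule integral_cong_AE)
      show "AE \<omega> in M. x' (t + s) \<omega> $ i * x' t \<omega> $ j = x (t + s) \<omega> $ i * x t \<omega> $ j"
        using AEG by eventually_elim (simp add: x'_def)
    qed measurable
    then show ?thesis by (simp add: correlation_def)
  qed
  ultimately show ?thesis unfolding R_def by (rule that)
qed

lemma correlation_covariance_structure:
  fixes W x \<eta> :: "real \<Rightarrow> 'w \<Rightarrow> real^'n"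
  assumes "\<tau> > 0" "hurwitz A" and Q: "pos_def Q" and "brownian_motion M W"
    and "stationary_process M (\<lambda>t \<omega>. (x t \<omega>, \<eta> t \<omega>))"
    and "colored_noise_solution M \<tau> A Q W x \<eta>"
  obtains \<Lambda> where "colored_noise_covariance \<tau> A Q (matrix_sqrt (2 *\<^sub>R Q)) (correlation M x t) \<Lambda>"
proof -
  obtain W' x' \<eta>' where model: "colored_noise_model M \<tau> A (matrix_sqrt (2 *\<^sub>R Q)) W' x' \<eta>'"
    and corr: "\<And>t s. correlation M x' t s = correlation M x t s"
    using colored_noise_modification[OF assms(1,2,4-6)] by blast
  interpret colored_noise_model M \<tau> A "matrix_sqrt (2 *\<^sub>R Q)" W' x' \<eta>' by (rule model)
  have "correlation M x t = Kx" using correlation_eq_Kx[of t] by (simp add: corr fun_eq_iff)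
  moreover have "colored_noise_covariance \<tau> A Q (matrix_sqrt (2 *\<^sub>R Q)) Kx \<Lambda>"
    by (intro colored_noise_covariance.intro \<tau> A matrix_sqrt_props pos_def_scaleR[OF Q] Kx_minus
        Kx_deriv \<Lambda>_decay \<Lambda>_equation joint_covariance_nonneg) simp_all
  ultimately show ?thesis using that by simp
qed

text \<open>The differentiability clauses guarantee that the values of
  \<open>vector_derivative\<close> and \<open>mean_derivative\<close> in question are genuine
  derivatives. Uniqueness is stated as equality with a singleton, which includes that the given pair
  is a solution.\<close>

theorem theorem3:
  fixes M :: "'w measure"
    and \<tau> t :: real
    and A Q B C :: "real^'n^'n"
    and W x \<eta> :: "real \<Rightarrow> 'w \<Rightarrow> real^'n"
    and K K' K'' :: "real \<Rightarrow> real^'n^'n"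
    and K3 :: "real^'n^'n"
  assumes "\<tau> > 0"
    and "hurwitz A"
    and "pos_def Q"
    and "brownian_motion M W"
    and "stationary_process M (\<lambda>t \<omega>. (x t \<omega>, \<eta> t \<omega>))"
    and "colored_noise_solution M \<tau> A Q W x \<eta>"
    and "K = correlation M x t"
    and "K' = (\<lambda>s. vector_derivative K (at s))"
    and "K'' = (\<lambda>s. vector_derivative K' (at s))"
    and "K3 = mean_derivative K'' 0"
    and "C = K 0"
    and "B = resolvent_matrix \<tau> A"
  shows
    "eq_a \<tau> C A Q
     \<and>
     (\<forall>s. K differentiable at s) \<and> (\<forall>s. K' differentiable at s) \<and>
     K'' differentiable at_left 0 \<and> K'' differentiable at_right 0 \<and>
     K' 0 = (1 / 2) *\<^sub>R (A ** C - C ** transpose A + Q ** transpose B - B ** Q) \<and>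
     eq_b \<tau> C (K' 0) (K'' 0) A \<and>
     eq_c \<tau> C (K' 0) (K'' 0) K3 A
     \<and>
     transpose (K' 0) = - K' 0 \<and> transpose K3 = - K3 \<and> neg_def (K'' 0)
     \<and>
     {(A', Q'). hurwitz A' \<and> pos_def Q' \<and> eq_a \<tau> C A' Q' \<and>
        eq_b \<tau> C (K' 0) (K'' 0) A' \<and> eq_c \<tau> C (K' 0) (K'' 0) K3 A'} = {(A, Q)}
     \<and>
     (neg_def A \<longrightarrow>
       {(A', Q'). neg_def A' \<and> pos_def Q' \<and> eq_a \<tau> C A' Q' \<and>
          eq_b \<tau> C (K' 0) (K'' 0) A'} = {(A, Q)})"
proof -
  obtain \<Lambda> where "colored_noise_covariance \<tau> A Q (matrix_sqrt (2 *\<^sub>R Q)) (correlation M x t) \<Lambda>"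
    by (rule correlation_covariance_structure[OF assms(1-6)])
  then interpret S: colored_noise_covariance \<tau> A Q "matrix_sqrt (2 *\<^sub>R Q)" K \<Lambda>
    by (simp only: assms(7))
  let ?K2 = "\<lambda>s. if s \<ge> 0 then S.K2 s else transpose (S.K2 (- s))"
  have K': "K' = S.K1"
    unfolding assms(8) using vector_derivative_at[OF S.K1_deriv] by (rule ext)
  have K'': "K'' = ?K2"
    unfolding assms(9) K' using vector_derivative_at[OF S.K1_has_derivative] by (rule ext)
  have K''0: "K'' 0 = S.K2 0" by (simp add: K'')
  \<comment> \<open>The mean of the right-hand derivative \<open>S.K3r\<close> and the left-hand
    derivative \<open>- transpose S.K3r\<close> of \<open>K''\<close>.\<close>
  have K3: "K3 = (1 / 2) *\<^sub>R (S.K3r - transpose S.K3r)"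
    using vector_derivative_within[OF _ S.second_derivative_left] vector_derivative_within[OF _ S.second_derivative_right]
    by (simp add: assms(10) mean_derivative_def K'')
  have B: "B = resolvent_matrix \<tau> A" and C: "C = K 0" by fact+
  have diff: "\<forall>s. K differentiable at s" "\<forall>s. K' differentiable at s"
    "K'' differentiable at_left 0" "K'' differentiable at_right 0"
    unfolding K' K''
    by (rule allI, rule differentiableI_vector[OF S.K1_deriv],
        rule allI, rule differentiableI_vector[OF S.K1_has_derivative],
        rule differentiableI_vector[OF S.second_derivative_left],
        rule differentiableI_vector[OF S.second_derivative_right])
  have a: "eq_a \<tau> C A Q" and b: "eq_b \<tau> C (K' 0) (K'' 0) A" and c: "eq_c \<tau> C (K' 0) (K'' 0) K3 A"
    unfolding C K''0 K3 unfolding K' by (rule S.eq_a_holds S.eq_b_holds S.eq_c_holds)+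
  have "transpose S.K3r - S.K3r = - (S.K3r - transpose S.K3r)" by simp
  then have skew: "transpose (K' 0) = - K' 0" "transpose K3 = - K3"
    unfolding K' K3 transpose_scalar transpose_diff transpose_transpose
    by (simp_all only: S.K1_skew scaleR_minus_right)
  have neg: "neg_def (K'' 0)" unfolding K''0 by (rule S.K2_neg_def)
  have C_pos: "pos_def C" unfolding C by (rule S.C_pos_def)
  note unique = eqs_abc_unique[OF assms(1,2) C_pos skew(1) a b neg c]
    eqs_ab_unique_symmetric[OF assms(1,2) C_pos skew(1) a b]
  have "{(A', Q'). hurwitz A' \<and> pos_def Q' \<and> eq_a \<tau> C A' Q' \<and>
        eq_b \<tau> C (K' 0) (K'' 0) A' \<and> eq_c \<tau> C (K' 0) (K'' 0) K3 A'} = {(A, Q)}"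
    (is "?S = _")
  proof
    show "?S \<subseteq> {(A, Q)}" using unique(1,2) by blast
    show "{(A, Q)} \<subseteq> ?S" using a b c assms(2,3) by simp
  qed
  moreover have "{(A', Q'). neg_def A' \<and> pos_def Q' \<and> eq_a \<tau> C A' Q' \<and>
          eq_b \<tau> C (K' 0) (K'' 0) A'} = {(A, Q)}" (is "?S = _") if "neg_def A"
  proof
    \<comment> \<open>Negative definiteness includes symmetry of both drift matrices, which stands
      in for (c).\<close>
    have "P \<in> {(A, Q)}" if "P \<in> ?S" for P
      using that unique(3,4)[of "fst P" "snd P"] \<open>neg_def A\<close>
      by (cases P) (auto simp only: neg_def_def fst_conv snd_conv mem_Collect_eq prod.case singleton_iff)
    then show "?S \<subseteq> {(A, Q)}" by blast
    show "{(A, Q)} \<subseteq> ?S" using \<open>neg_def A\<close> a b assms(3) by simp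
  qed
  moreover have "K' 0 = (1 / 2) *\<^sub>R (A ** C - C ** transpose A + Q ** transpose B - B ** Q)"
    unfolding B C K' by (rule S.K1_0_antisymmetrized)
  ultimately show ?thesis using a b c diff skew neg by blast
qed

end
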